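(* Let $W=W(\Phi)$ be a Weyl group, where $\Phi$ is a crystallographic irreducible root system of type $D$ with a simple system $\Delta$. Then for any $I\subseteq\Delta$, $W^I(x)$ is a product of cyclotomic polynomials unless $\Phi\cong D_{2m}$ for some positive integer $m$ and $K\subseteq I\subseteq\Delta$, where $\Phi_K\cong A_1^{\oplus (m+1)}$.
   Context: The root system of type $D_n$ is $\{\pm(e_i\pm e_j): 1\le i<j\le n\}\subset\mathbb{R}^n$, with simple system $\{e_1+e_2\}\cup\{e_{i+1}-e_i: 1\le i\le n-1\}$. For a crystallographic root system $\Phi$ with simple system $\Delta$, let $\Phi^+$ be the set of roots that are nonnegative linear combinations of simple roots and $\Phi^-=-\Phi^+$. The Weyl group $W=W(\Phi)$ is generated by the reflections $s_\alpha$, $\alpha\in\Phi$. The height of a root $\alpha=\sum_{\beta\in\Delta}c_\beta\beta$ is $\mathrm{ht}(\alpha)=\sum_{\beta\in\Delta} c_\beta$. For $w\in W$, the Coxeter length is $\ell(w)=|\{\alpha\in\Phi^+: w(\alpha)\in\Phi^-\}|$ and the odd length is $L(w)=|\{\alpha\in\Phi^+:\mathrm{ht}(\alpha)\equiv1\ (\mathrm{mod}\ 2),\ w(\alpha)\in\Phi^-\}|$. Subsets of $\Delta$ are identified with the corresponding sets of simple reflections $s_\alpha$; for $I\subseteq\Delta$, $W^I=\{w\in W:\ell(ws_\alpha)>\ell(w)\text{ for all }\alpha\in I\}$ is the set of minimal length left coset representatives of the parabolic subgroup $W_I=\langle s_\alpha:\alpha\in I\rangle$, and $W^I(x)=\sum_{w\in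 W^I}(-1)^{\ell(w)}x^{L(w)}$. For $K\subseteq\Delta$, $\Phi_K$ denotes the parabolic root subsystem of $\Phi$ with simple system $K$ (the roots in the span of $K$), and $A_1^{\oplus(m+1)}$ is the orthogonal sum of $m+1$ copies of the root system $A_1$. For a positive integer $k$, the $k$-th cyclotomic polynomial is the monic polynomial $(x-\omega_1)(x-\omega_2)\cdots(x-\omega_r)$, where $\omega_1,\ldots,\omega_r$ are all the distinct primitive $k$-th roots of unity. An empty product equals $1$.
   Formalization: "Product of cyclotomic polynomials" is read up to a global sign: cyclotomic polynomials are monic, but for D_3 and I a single simple root W^I(x) = 1 - x^2 = -(x-1)(x+1), so the claim without the sign is false. *)

theory Defs
  imports "HOL-Analysis.Analysis" "HOL-Computational_Algebra.Polynomial"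
begin

section \<open>Root systems\<close>

definition reflection :: "'a::real_inner \<Rightarrow> 'a \<Rightarrow> 'a" where
  "reflection \<alpha> v = v - (2 * (v \<bullet> \<alpha>) / (\<alpha> \<bullet> \<alpha>)) *\<^sub>R \<alpha>"

definition cartan_number :: "'a::real_inner \<Rightarrow> 'a \<Rightarrow> real" where
  "cartan_number \<alpha> \<beta> = 2 * (\<alpha> \<bullet> \<beta>) / (\<beta> \<bullet> \<beta>)"

text \<open>The roots are not required to span the ambient space.\<close>

definition root_system :: "'a::euclidean_space set \<Rightarrow> bool" where
  "root_system \<Phi> \<longleftrightarrow>
     finite \<Phi> \<and> 0 \<notin> \<Phi> \<and>
     (\<forall>\<alpha>\<in>\<Phi>. \<Phi> \<inter> span {\<alpha>} = {\<alpha>, - \<alpha>}) \<and>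
     (\<forall>\<alpha>\<in>\<Phi>. reflection \<alpha> ` \<Phi> = \<Phi>)"

definition crystallographic :: "'a::euclidean_space set \<Rightarrow> bool" where
  "crystallographic \<Phi> \<longleftrightarrow> (\<forall>\<alpha>\<in>\<Phi>. \<forall>\<beta>\<in>\<Phi>. cartan_number \<alpha> \<beta> \<in> \<int>)"

definition irreducible_roots :: "'a::euclidean_space set \<Rightarrow> bool" where
  "irreducible_roots \<Phi> \<longleftrightarrow> \<Phi> \<noteq> {} \<and>
     \<not> (\<exists>\<Phi>1 \<Phi>2. \<Phi> = \<Phi>1 \<union> \<Phi>2 \<and> \<Phi>1 \<noteq> {} \<and> \<Phi>2 \<noteq> {} \<and>
          (\<forall>\<alpha>\<in>\<Phi>1. \<forall>\<beta>\<in>\<Phi>2. orthogonal \<alpha> \<beta>))"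

definition simple_system :: "'a::euclidean_space set \<Rightarrow> 'a set \<Rightarrow> bool" where
  "simple_system \<Phi> \<Delta> \<longleftrightarrow>
     \<Delta> \<subseteq> \<Phi> \<and> independent \<Delta> \<and> \<Phi> \<subseteq> span \<Delta> \<and>
     (\<forall>\<alpha>\<in>\<Phi>. (\<forall>\<beta>\<in>\<Delta>. 0 \<le> representation \<Delta> \<alpha> \<beta>) \<or>
             (\<forall>\<beta>\<in>\<Delta>. representation \<Delta> \<alpha> \<beta> \<le> 0))"

text \<open>An isomorphism is a linear isomorphism between the spans of the two systems (here given
  by a linear map of the ambient spaces that is injective on the span of the first) which maps
  roots onto roots and preserves the Cartan numbers. It need not be an isometry.\<close>

definition root_iso :: "'a::euclidean_space set \<Rightarrow> 'b::euclidean_space set \<Rightarrow> bool" where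
  "root_iso \<Phi> \<Psi> \<longleftrightarrow>
     (\<exists>f. linear f \<and> inj_on f (span \<Phi>) \<and> f ` \<Phi> = \<Psi> \<and>
        (\<forall>\<alpha>\<in>\<Phi>. \<forall>\<beta>\<in>\<Phi>. cartan_number (f \<alpha>) (f \<beta>) = cartan_number \<alpha> \<beta>))"

text \<open>The system of type \<open>D\<^sub>n\<close> in \<open>\<real>\<^sup>n\<close>, where \<open>n = CARD('n)\<close>: as \<open>i\<close>, \<open>j\<close> and both signs
  vary independently, these are the vectors \<open>\<plusminus>(e\<^sub>i \<plusminus> e\<^sub>j)\<close> for all pairs of distinct indices.\<close>

definition D_roots :: "(real ^ 'n) set" where
  "D_roots = {axis i a + axis j b | i j a b. i \<noteq> j \<and> a \<in> {1, - 1} \<and> b \<in> {1, - 1}}"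

definition A1_roots :: "real set" where
  "A1_roots = {1, - 1}"

definition is_A1_sum :: "nat \<Rightarrow> 'a::euclidean_space set \<Rightarrow> bool" where
  "is_A1_sum k \<Psi> \<longleftrightarrow>
     (\<exists>C :: nat \<Rightarrow> 'a set. \<Psi> = (\<Union>i<k. C i) \<and> (\<forall>i<k. root_iso (C i) A1_roots) \<and>
        (\<forall>i<k. \<forall>j<k. i \<noteq> j \<longrightarrow> (\<forall>\<alpha>\<in>C i. \<forall>\<beta>\<in>C j. orthogonal \<alpha> \<beta>)))"

definition parabolic_roots :: "'a::euclidean_space set \<Rightarrow> 'a set \<Rightarrow> 'a set" where
  "parabolic_roots \<Phi> K = \<Phi> \<inter> span K"

section \<open>Weyl groups, length and odd length\<close>

text \<open>Reflections are involutions, so closure under composition already yields the group they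
  generate.\<close>

inductive_set weyl_group :: "'a::euclidean_space set \<Rightarrow> ('a \<Rightarrow> 'a) set"
  for \<Phi> :: "'a set" where
  one: "id \<in> weyl_group \<Phi>"
| refl: "\<alpha> \<in> \<Phi> \<Longrightarrow> w \<in> weyl_group \<Phi> \<Longrightarrow> reflection \<alpha> \<circ> w \<in> weyl_group \<Phi>"

definition pos_roots :: "'a::euclidean_space set \<Rightarrow> 'a set \<Rightarrow> 'a set" where
  "pos_roots \<Phi> \<Delta> = {\<alpha>\<in>\<Phi>. \<forall>\<beta>\<in>\<Delta>. 0 \<le> representation \<Delta> \<alpha> \<beta>}"

definition neg_roots :: "'a::euclidean_space set \<Rightarrow> 'a set \<Rightarrow> 'a set" where
  "neg_roots \<Phi> \<Delta> = uminus ` pos_roots \<Phi> \<Delta>"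

definition height :: "'a::euclidean_space set \<Rightarrow> 'a \<Rightarrow> real" where
  "height \<Delta> \<alpha> = (\<Sum>\<beta>\<in>\<Delta>. representation \<Delta> \<alpha> \<beta>)"

definition odd_height :: "'a::euclidean_space set \<Rightarrow> 'a \<Rightarrow> bool" where
  "odd_height \<Delta> \<alpha> \<longleftrightarrow> (\<exists>k::int. odd k \<and> height \<Delta> \<alpha> = of_int k)"

definition coxeter_length :: "'a::euclidean_space set \<Rightarrow> 'a set \<Rightarrow> ('a \<Rightarrow> 'a) \<Rightarrow> nat" where
  "coxeter_length \<Phi> \<Delta> w = card {\<alpha> \<in> pos_roots \<Phi> \<Delta>. w \<alpha> \<in> neg_roots \<Phi> \<Delta>}"

definition odd_length :: "'a::euclidean_space set \<Rightarrow> 'a set \<Rightarrow> ('a \<Rightarrow> 'a) \<Rightarrow> nat" where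
  "odd_length \<Phi> \<Delta> w =
     card {\<alpha> \<in> pos_roots \<Phi> \<Delta>. odd_height \<Delta> \<alpha> \<and> w \<alpha> \<in> neg_roots \<Phi> \<Delta>}"

definition min_coset_reps :: "'a::euclidean_space set \<Rightarrow> 'a set \<Rightarrow> 'a set \<Rightarrow> ('a \<Rightarrow> 'a) set" where
  "min_coset_reps \<Phi> \<Delta> I =
     {w \<in> weyl_group \<Phi>. \<forall>\<alpha>\<in>I. coxeter_length \<Phi> \<Delta> (w \<circ> reflection \<alpha>) > coxeter_length \<Phi> \<Delta> w}"

definition signed_odd_poly :: "'a::euclidean_space set \<Rightarrow> 'a set \<Rightarrow> 'a set \<Rightarrow> int poly" where
  "signed_odd_poly \<Phi> \<Delta> I =
     (\<Sum>w\<in>min_coset_reps \<Phi> \<Delta> I. monom ((- 1) ^ coxeter_length \<Phi> \<Delta> w) (odd_length \<Phi> \<Delta> w))"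

section \<open>Products of cyclotomic polynomials\<close>

definition primitive_root_of_unity :: "nat \<Rightarrow> complex \<Rightarrow> bool" where
  "primitive_root_of_unity k \<omega> \<longleftrightarrow> \<omega> ^ k = 1 \<and> (\<forall>j. 0 < j \<and> j < k \<longrightarrow> \<omega> ^ j \<noteq> 1)"

definition cyclotomic :: "nat \<Rightarrow> complex poly" where
  "cyclotomic k = (\<Prod>\<omega> | primitive_root_of_unity k \<omega>. [:- \<omega>, 1:])"

text \<open>A product of cyclotomic polynomials is understood up to a global sign. The sign cannot be
  dropped: the constant term of \<open>W\<^sup>I(x)\<close> is 1, and for instance in type \<open>D\<^sub>3\<close> with \<open>I\<close>
  consisting of one simple root \<open>W\<^sup>I(x)\<close> is \<open>1 - x\<^sup>2\<close>, whereas a product of the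
  (monic) cyclotomic polynomials is monic.\<close>

definition is_cyclotomic_product :: "int poly \<Rightarrow> bool" where
  "is_cyclotomic_product p \<longleftrightarrow>
     (\<exists>ks. (\<forall>k\<in>set ks. 0 < k) \<and>
        (map_poly of_int p = (\<Prod>k\<leftarrow>ks. cyclotomic k) \<or>
         map_poly of_int p = - (\<Prod>k\<leftarrow>ks. cyclotomic k)))"

end

theory Submission
  imports Defs "HOL-Computational_Algebra.Fundamental_Theorem_Algebra"
begin

text \<open>In coordinates, with the simple roots \<open>c\<^sub>0 + c\<^sub>1\<close> and \<open>c\<^bsub>k+1\<^esub> - c\<^sub>k\<close>, an element of the
  Weyl group is an arrangement \<open>v\<^sub>0, \<dots>, v\<^bsub>n-1\<^esub>\<close> of \<open>\<plusminus>1, \<dots>, \<plusminus>n\<close>, the roots are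
  tested by \<open>v\<^sub>j < v\<^sub>i\<close> and \<open>v\<^sub>i + v\<^sub>j < 0\<close>, and a root has odd height iff the two positions have
  different parity. Minimal coset representatives are the arrangements that increase along blocks
  of consecutive positions. Removing the entry of largest absolute value leaves a word of
  parities with blocks, and deleting from the interior of an alternating word creates two adjacent
  equal letters, which makes the signed sum vanish. Hence adding a single letter to a block of
  alternating letters gives a combination of at most two longer alternating blocks. Solving
  these relations reduces any block to single letters, up to factors \<open>1 - x\<^bsup>2i\<^esup>\<close>, and sums over
  single letters are products of factors \<open>1 \<plusminus> x\<^bsup>k\<^esup>\<close>. The only case in which two terms
  that do not combine into such a product survive is that the first block contains both end nodes of the
  fork and all blocks have even length; then \<open>n\<close> is even and \<open>I\<close> contains every other simple
  root, that is, a subsystem \<open>A\<^sub>1\<^bsup>m+1\<^esup>\<close>.\<close>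

section \<open>Signed arrangements\<close>

text \<open>The largest entry is the one to remove because its share of the weight depends only on
  its place and sign: each cell to its right gives one inversion, each cell to its left none or two.
  Weight and constraints therefore factor, and identities between signed sums can be proved by
  induction on the length. This forces the relation for one more letter to be stated in an arbitrary
  context, where letters need not alternate, and with coefficients that depend on the block and the
  letter alone. The squares in the final product arise as follows. Let d be the odd length of an
  initial run of positive increasing entries and y = x^((d+1)/2). One further letter contributes (1
  + y^2) - 2y, two further letters (1 + y^2)^2 - (2y)^2. The factors 1 - x^(2i) stand on the side of
  the quotient, so what is computed first is a multiple of W^I(x). Dividing is harmless because
  different cyclotomic polynomials have no common root, so that factors can be cancelled one by
  one.\<close>

definition signed_perms :: "nat \<Rightarrow> int list set" where
  "signed_perms n = {v. length v = n \<and> abs ` set v = {1..int n}}"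

lemma finite_signed_perms [simp]: "finite (signed_perms n)"
proof (rule finite_subset)
  show "signed_perms n \<subseteq> {v. set v \<subseteq> {- int n..int n} \<and> length v = n}"
  proof (clarsimp simp: signed_perms_def)
    fix v x assume "abs ` set v = {1..int (length v)}" "x \<in> set v"
    then have "\<bar>x\<bar> \<in> {1..int (length v)}" by blast
    then show "- int (length v) \<le> x \<and> x \<le> int (length v)" by auto
  qed
qed (simp add: finite_lists_length_eq)

lemma signed_perms_0 [simp]: "signed_perms 0 = {[]}"
  by (auto simp: signed_perms_def)

lemma signed_perms_abs:
  "v \<in> signed_perms n \<Longrightarrow> y \<in> set v \<Longrightarrow> 1 \<le> \<bar>y\<bar> \<and> \<bar>y\<bar> \<le> int n"
  unfolding signed_perms_def by (metis (mono_tags, lifting) atLeastAtMost_iff image_eqI mem_Collect_eq)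

lemma signed_perms_distinct:
  assumes "v \<in> signed_perms n"
  shows "distinct (map abs v)"
proof (rule card_distinct)
  show "card (set (map abs v)) = length (map abs v)"
    using assms by (simp add: signed_perms_def)
qed

text \<open>Place and sign of the entry of largest absolute value can be chosen freely, and deleting
  it leaves an arrangement of the smaller values. Summing over this bijection gives the recursion
  behind the later inductions.\<close>

lemma bij_betw_insert_max:
  fixes n :: nat
  defines "M \<equiv> int (Suc n)"
  shows "bij_betw (\<lambda>(v, p, y). take p v @ y # drop p v)
           (signed_perms n \<times> {..n} \<times> {M, - M}) (signed_perms (Suc n))"
  unfolding bij_betw_def
proof (intro conjI inj_onI set_eqI iffI)
  fix s t
  assume s: "s \<in> signed_perms n \<times> {..n} \<times> {M, - M}" and t: "t \<in> signed_perms n \<times> {..n} \<times> {M, - M}"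
    and eq: "(case s of (v, p, y) \<Rightarrow> take p v @ y # drop p v)
      = (case t of (v, p, y) \<Rightarrow> take p v @ y # drop p v)"
  obtain v p y where s': "s = (v, p, y)" "v \<in> signed_perms n" "p \<le> n" "y \<in> {M, -M}"
    using s by (cases s) auto
  obtain v' p' y' where t': "t = (v', p', y')" "v' \<in> signed_perms n" "p' \<le> n" "y' \<in> {M, -M}"
    using t by (cases t) auto
  have eq': "take p v @ y # drop p v = take p' v' @ y' # drop p' v'" using eq s' t' by simp
  \<comment> \<open>The inserted entry is the only one of absolute value n + 1, so it marks where
    the list was cut.\<close>
  have ny: "y \<notin> set v" "y \<notin> set v'"
    using signed_perms_abs[OF s'(2), of y] signed_perms_abs[OF t'(2), of y] s'(4) by (auto simp: M_def)
  have "y \<in> set (take p' v' @ y' # drop p' v')" by (subst eq'[symmetric]) simp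
  then have yy: "y' = y" using ny by (auto dest: in_set_takeD in_set_dropD)
  have "take p v = take p' v' \<and> drop p v = drop p' v'"
    using eq' ny unfolding yy by (subst (asm) append_Cons_eq_iff) (auto dest: in_set_takeD in_set_dropD)
  moreover have "length v = n" "length v' = n" using s' t' by (auto simp: signed_perms_def)
  ultimately show "s = t" using s' t' yy
    by (metis append_take_drop_id length_take min.absorb2)
next
  fix u assume "u \<in> (\<lambda>(v, p, y). take p v @ y # drop p v) ` (signed_perms n \<times> {..n} \<times> {M, - M})"
  then obtain v p y where *: "u = take p v @ y # drop p v" "v \<in> signed_perms n" "p \<le> n" "y \<in> {M, -M}"
    by auto
  have "set (take p v) \<union> set (drop p v) = set v" by (metis append_take_drop_id set_append)
  then have "set u = insert y (set v)" using * by auto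
  moreover have "insert (int (Suc n)) {1..int n} = {1..int (Suc n)}" by auto
  ultimately show "u \<in> signed_perms (Suc n)"
    using * by (auto simp: signed_perms_def M_def)
next
  fix u assume u: "u \<in> signed_perms (Suc n)"
  then have "M \<in> abs ` set u" by (auto simp: signed_perms_def M_def)
  then obtain y where y: "y \<in> set u" "\<bar>y\<bar> = M" by auto
  then obtain A B where AB: "u = A @ y # B" by (meson split_list)
  have d: "distinct (map abs u)" by (rule signed_perms_distinct[OF u])
  have "abs ` set (A @ B) = abs ` set u - {M}" using d y AB by (auto; metis image_eqI)
  also have "\<dots> = {1..int n}" using u by (auto simp: signed_perms_def M_def)
  finally have "A @ B \<in> signed_perms n" using u AB by (auto simp: signed_perms_def)
  moreover have "length A \<le> n" using u AB by (auto simp: signed_perms_def)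
  moreover have "y \<in> {M, -M}" using y by auto
  ultimately show "u \<in> (\<lambda>(v, p, y). take p v @ y # drop p v) ` (signed_perms n \<times> {..n} \<times> {M, - M})"
    using AB by (intro image_eqI[of _ _ "(A @ B, length A, y)"]) auto
qed

lemma sum_signed_perms_Suc:
  "(\<Sum>v\<in>signed_perms (Suc n). g v)
    = (\<Sum>p\<le>n. \<Sum>v\<in>signed_perms n. g (take p v @ int (Suc n) # drop p v) + g (take p v @ (- int (Suc n)) # drop p v))"
proof -
  have "(\<Sum>v\<in>signed_perms (Suc n). g v) =
    (\<Sum>(v, p, y)\<in>signed_perms n \<times> {..n} \<times> {int (Suc n), - int (Suc n)}. g (take p v @ y # drop p v))"
    by (subst sum.reindex_bij_betw[OF bij_betw_insert_max, symmetric]) (simp add: case_prod_beta)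
  also have "\<dots> = (\<Sum>v\<in>signed_perms n. \<Sum>p\<le>n. g (take p v @ int (Suc n) # drop p v) + g (take p v @ (- int (Suc n)) # drop p v))"
    by (simp add: sum.cartesian_product[symmetric])
  finally show ?thesis by (subst (asm) sum.swap)
qed

text \<open>For entries y, z at places i < j, the two summands tell whether the positive roots c_j -
  c_i and c_j + c_i are inverted.\<close>

definition pair_inv :: "int \<Rightarrow> int \<Rightarrow> nat" where
  "pair_inv y z = of_bool (z < y) + of_bool (y + z < 0)"

text \<open>Every inverted root contributes a sign; it contributes a factor x as well iff its height
  is odd, that is, iff the parities of the two places differ.\<close>

definition pair_weight :: "'r::comm_ring_1 \<Rightarrow> bool \<times> int \<Rightarrow> bool \<times> int \<Rightarrow> 'r" where
  "pair_weight x a b = (if fst a = fst b then - 1 else - x) ^ pair_inv (snd a) (snd b)"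

fun weight :: "'r::comm_ring_1 \<Rightarrow> (bool \<times> int) list \<Rightarrow> 'r" where
  "weight x [] = 1"
| "weight x (a # as) = (\<Prod>b\<leftarrow>as. pair_weight x a b) * weight x as"

lemma weight_insert:
  "weight x (A @ m # B) = weight x (A @ B) * (\<Prod>a\<leftarrow>A. pair_weight x a m) * (\<Prod>b\<leftarrow>B. pair_weight x m b)"
  by (induction A) (simp_all add: ac_simps)

definition opp :: "bool \<Rightarrow> bool list \<Rightarrow> nat" where
  "opp c cs = length (filter (\<lambda>d. d \<noteq> c) cs)"

lemma opp_simps [simp]:
  "opp c [] = 0" "opp c (d # cs) = of_bool (d \<noteq> c) + opp c cs" "opp c (as @ bs) = opp c as + opp c bs"
  by (auto simp: opp_def)

text \<open>A dominant y exceeds b if it is positive and makes y + b negative if it is negative: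
  exactly one inversion with each later cell, whatever the sign of y.\<close>

lemma prod_weight_right:
  assumes "length cs = length B" "\<forall>b\<in>set B. \<bar>b\<bar> < \<bar>y\<bar>"
  shows "(\<Prod>b\<leftarrow>zip cs B. pair_weight x (c, y) b) = (- 1) ^ length cs * x ^ opp c cs"
  using assms
proof (induction cs B rule: list_induct2)
  case (Cons d cs b B)
  then have "pair_inv y b = 1" by (auto simp: pair_inv_def)
  then show ?case using Cons by (auto simp: pair_weight_def)
qed simp

lemma prod_weight_left_pos:
  assumes "length cs = length A" "\<forall>a\<in>set A. \<bar>a\<bar> < y"
  shows "(\<Prod>a\<leftarrow>zip cs A. pair_weight x a (c, y)) = 1"
  using assms
proof (induction cs A rule: list_induct2)
  case (Cons d cs b B)
  then have "pair_inv b y = 0" by (auto simp: pair_inv_def)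
  then show ?case using Cons by (auto simp: pair_weight_def)
qed simp

text \<open>Each earlier cell is inverted twice. The two signs cancel, and only letters different
  from \<open>c\<close> leave a trace.\<close>

lemma prod_weight_left_neg:
  assumes "length cs = length A" "\<forall>a\<in>set A. \<bar>a\<bar> < y"
  shows "(\<Prod>a\<leftarrow>zip cs A. pair_weight x a (c, - y)) = x ^ (2 * opp c cs)"
  using assms
proof (induction cs A rule: list_induct2)
  case (Cons d cs b B)
  then have "pair_inv b (- y) = 2" by (auto simp: pair_inv_def)
  then show ?case using Cons by (auto simp: pair_weight_def power2_eq_square)
qed simp

section \<open>Words with prescribed ascents\<close>

fun chain :: "int \<Rightarrow> bool list \<Rightarrow> int list \<Rightarrow> bool" where
  "chain y0 (f # fs) (y # ys) \<longleftrightarrow> (f \<longrightarrow> y0 < y) \<and> chain y fs ys"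
| "chain y0 _ _ \<longleftrightarrow> True"

lemma chain_append:
  "length fs = length ys \<Longrightarrow> chain y0 (fs @ gs) (ys @ zs) \<longleftrightarrow> chain y0 fs ys \<and> chain (last (y0 # ys)) gs zs"
  by (induction fs ys arbitrary: y0 rule: list_induct2) auto

text \<open>A cell is a pair of a flag and a parity. The flag demands that the entry of the cell exceeds
  the preceding entry, where \<open>0\<close> precedes the first one (see \<open>chain\<close>). A set flag in the
  first cell thus encodes \<open>\<bar>v\<^sub>0\<bar> < v\<^sub>1\<close> in a form that fixes the sign of \<open>v\<^sub>0\<close>.\<close>

type_synonym cells = "(bool \<times> bool) list"

definition flags :: "cells \<Rightarrow> bool list" where "flags \<equiv> map fst"
definition letters :: "cells \<Rightarrow> bool list" where "letters \<equiv> map snd"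

definition free_start :: "cells \<Rightarrow> bool" where
  "free_start C \<longleftrightarrow> C = [] \<or> \<not> fst (hd C)"

fun release :: "cells \<Rightarrow> cells" where
  "release [] = []"
| "release ((f, c) # C) = (False, c) # C"

lemma release_simps [simp]: "length (release C) = length C" "letters (release C) = letters C"
  "free_start (release C)"
  by (cases C rule: release.cases; simp add: letters_def free_start_def)+

lemma flags_letters_simps [simp]:
  "flags [] = []" "flags (p # C) = fst p # flags C" "flags (A @ C) = flags A @ flags C" "length (flags C) = length C"
  "letters [] = []" "letters (p # C) = snd p # letters C" "letters (A @ C) = letters A @ letters C" "length (letters C) = length C"
  by (auto simp: flags_def letters_def)

lemma chain_release:
  "chain y0 (flags (release C)) v = chain y1 (flags (release C)) v"
  by (cases C rule: release.cases; cases v) auto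

text \<open>Nothing that follows exceeds M, so a flag right after M cannot be met, while right after
  -M it is met automatically. In both cases the remaining condition is the one with that flag
  cleared.\<close>

lemma chain_large:
  assumes "\<forall>b\<in>set B. \<bar>b\<bar> < M" "length C = length B"
  shows "chain M (flags C) B \<longleftrightarrow> free_start C \<and> chain y (flags (release C)) B"
    "chain (- M) (flags C) B \<longleftrightarrow> chain y (flags (release C)) B"
  using assms by (cases C rule: release.cases; cases B; force simp: free_start_def)+

text \<open>Letters are arbitrary here, since deleting a cell destroys alternation and the recursion
  leaves the words that come from the root system.\<close>

definition signed_sum :: "'r::comm_ring_1 \<Rightarrow> cells \<Rightarrow> 'r" where
  "signed_sum x C = (\<Sum>v\<in>signed_perms (length C). of_bool (chain 0 (flags C) v) * weight x (zip (letters C) v))"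

lemma signed_sum_Nil [simp]: "signed_sum x [] = 1"
  by (simp add: signed_sum_def)

text \<open>Contribution of the arrangements whose entry of largest absolute value sits in the cell
  between \<open>A\<close> and \<open>C\<close>; the two summands correspond to its sign.\<close>

definition removal :: "'r::comm_ring_1 \<Rightarrow> cells \<Rightarrow> bool \<times> bool \<Rightarrow> cells \<Rightarrow> 'r" where
  "removal x A p C = (- 1) ^ length C * x ^ opp (snd p) (letters C) *
     (of_bool (free_start C) + of_bool (\<not> fst p) * x ^ (2 * opp (snd p) (letters A))) *
     signed_sum x (A @ release C)"

fun removals :: "'r::comm_ring_1 \<Rightarrow> cells \<Rightarrow> cells \<Rightarrow> cells \<Rightarrow> 'r" where
  "removals x A [] C = 0"
| "removals x A (p # B) C = removal x A p (B @ C) + removals x (A @ [p]) B C"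

lemma removals_append:
  "removals x A (B @ B') C = removals x A B (B' @ C) + removals x (A @ B) B' C"
  by (induction B arbitrary: A) (simp_all add: ac_simps)

lemma removals_conv_sum:
  "removals x A B C = (\<Sum>p<length B. removal x (A @ take p B) (B ! p) (drop (Suc p) B @ C))"
proof (induction B arbitrary: A)
  case (Cons b B)
  show ?case by (simp add: Cons.IH sum.lessThan_Suc_shift del: sum.lessThan_Suc)
qed simp

lemma removal_conv_sum:
  assumes "length A + length C = n"
  defines "M \<equiv> int (Suc n)"
  shows "(\<Sum>v\<in>signed_perms n.
       of_bool (chain 0 (flags (A @ p # C)) (take (length A) v @ M # drop (length A) v)) *
         weight x (zip (letters (A @ p # C)) (take (length A) v @ M # drop (length A) v)) +
       of_bool (chain 0 (flags (A @ p # C)) (take (length A) v @ (- M) # drop (length A) v)) *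
         weight x (zip (letters (A @ p # C)) (take (length A) v @ (- M) # drop (length A) v)))
    = removal x A p C"
proof -
  have "of_bool (chain 0 (flags (A @ p # C)) (take (length A) v @ M # drop (length A) v)) *
         weight x (zip (letters (A @ p # C)) (take (length A) v @ M # drop (length A) v)) +
       of_bool (chain 0 (flags (A @ p # C)) (take (length A) v @ (- M) # drop (length A) v)) *
         weight x (zip (letters (A @ p # C)) (take (length A) v @ (- M) # drop (length A) v))
    = (- 1) ^ length C * x ^ opp (snd p) (letters C) *
     (of_bool (free_start C) + of_bool (\<not> fst p) * x ^ (2 * opp (snd p) (letters A))) *
     (of_bool (chain 0 (flags (A @ release C)) v) * weight x (zip (letters (A @ release C)) v))"
    if v: "v \<in> signed_perms n" for v
  proof -
    define V1 V2 where "V1 = take (length A) v" and "V2 = drop (length A) v"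
    have vV: "v = V1 @ V2" by (simp add: V1_def V2_def)
    have len: "length V1 = length A" "length V2 = length C"
      using v assms(1) by (auto simp: signed_perms_def V1_def V2_def)
    have ab: "\<forall>y\<in>set v. \<bar>y\<bar> < M" using signed_perms_abs[OF v] by (fastforce simp: M_def)
    then have ab1: "\<forall>y\<in>set V1. \<bar>y\<bar> < M" and ab2: "\<forall>y\<in>set V2. \<bar>y\<bar> < M" by (auto simp: vV)
    \<comment> \<open>The initial 0 is covered as well, so a flag in the very first cell acts like
      any other: it admits M and rejects -M.\<close>
    have "last (0 # V1) \<in> set (0 # V1)" by (rule last_in_set) simp
    then have l: "\<bar>last (0 # V1)\<bar> < M" using ab1 by (auto simp: M_def)
    have w: "weight x (zip (letters (A @ p # C)) (V1 @ y # V2))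
      = weight x (zip (letters (A @ release C)) v) * (\<Prod>a\<leftarrow>zip (letters A) V1. pair_weight x a (snd p, y))
        * (\<Prod>b\<leftarrow>zip (letters C) V2. pair_weight x (snd p, y) b)" for y
      using weight_insert[of x "zip (letters A) V1" "(snd p, y)" "zip (letters C) V2"] len
      by (simp add: vV zip_append)
    have M: "M > 0" by (simp add: M_def)
    have w1: "weight x (zip (letters (A @ p # C)) (V1 @ M # V2))
      = weight x (zip (letters (A @ release C)) v) * ((- 1) ^ length C * x ^ opp (snd p) (letters C))"
      unfolding w using ab1 ab2 len M by (subst prod_weight_left_pos prod_weight_right; simp)+
    have w2: "weight x (zip (letters (A @ p # C)) (V1 @ (- M) # V2))
      = weight x (zip (letters (A @ release C)) v) * x ^ (2 * opp (snd p) (letters A))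
         * ((- 1) ^ length C * x ^ opp (snd p) (letters C))"
      unfolding w using ab1 ab2 len M by (subst prod_weight_left_neg prod_weight_right; simp)+
    have c: "chain 0 (flags (A @ release C)) v \<longleftrightarrow> chain 0 (flags A) V1 \<and> chain 0 (flags (release C)) V2"
      using chain_release[of "last (0 # V1)" C V2 0] by (simp add: vV chain_append len)
    have c1: "chain 0 (flags (A @ p # C)) (V1 @ M # V2) \<longleftrightarrow> free_start C \<and> chain 0 (flags (A @ release C)) v"
      unfolding c using l len chain_large(1)[OF ab2, of C 0] by (auto simp: chain_append)
    have c2: "chain 0 (flags (A @ p # C)) (V1 @ (-M) # V2) \<longleftrightarrow> \<not> fst p \<and> chain 0 (flags (A @ release C)) v"
      unfolding c using l len chain_large(2)[OF ab2, of C 0] by (auto simp: chain_append)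
    show ?thesis
      unfolding V1_def[symmetric] V2_def[symmetric] w1 w2 c1 c2
      by (simp add: algebra_simps)
  qed
  then show ?thesis
    using assms(1) unfolding removal_def signed_sum_def sum_distrib_left by (intro sum.cong) auto
qed

lemma signed_sum_removals:
  assumes "C \<noteq> []"
  shows "signed_sum x C = removals x [] C []"
proof -
  obtain n where n: "length C = Suc n" using assms by (cases C) auto
  have "signed_sum x C = (\<Sum>p\<le>n. removal x (take p C) (C ! p) (drop (Suc p) C))"
    unfolding signed_sum_def n sum_signed_perms_Suc
  proof (rule sum.cong)
    fix p assume p: "p \<in> {..n}"
    then have eq: "C = take p C @ C ! p # drop (Suc p) C" using n by (simp add: id_take_nth_drop)
    have len: "length (take p C) = p" "length (drop (Suc p) C) = n - p" using p n by auto
    show "(\<Sum>v\<in>signed_perms n.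
       of_bool (chain 0 (flags C) (take p v @ int (Suc n) # drop p v)) *
         weight x (zip (letters C) (take p v @ int (Suc n) # drop p v)) +
       of_bool (chain 0 (flags C) (take p v @ - int (Suc n) # drop p v)) *
         weight x (zip (letters C) (take p v @ - int (Suc n) # drop p v)))
      = removal x (take p C) (C ! p) (drop (Suc p) C)"
      using removal_conv_sum[of "take p C" "drop (Suc p) C" n "C ! p" x, folded eq] len p by simp
  qed simp
  then show ?thesis using n by (simp add: removals_conv_sum lessThan_Suc_atMost)
qed

section \<open>Adding a letter to a block\<close>

fun block :: "bool list \<Rightarrow> cells" where
  "block [] = []"
| "block (a # w) = (False, a) # map (Pair True) w"

lemma block_simps [simp]: "length (block w) = length w" "letters (block w) = w" "free_start (block w)"
  by (cases w; simp add: letters_def comp_def free_start_def)+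

lemma letters_map_Pair [simp]: "letters (map (Pair f) w) = w"
  by (simp add: letters_def comp_def)

lemma free_start_simps [simp]: "free_start []" "free_start (p # C) \<longleftrightarrow> \<not> fst p"
  "free_start (A @ C) \<longleftrightarrow> (if A = [] then free_start C else free_start A)"
  by (auto simp: free_start_def)

lemma release_free: "free_start C \<Longrightarrow> release C = C"
  by (cases C rule: release.cases) auto

lemma release_append: "A \<noteq> [] \<Longrightarrow> release (A @ C) = release A @ C"
  by (cases A rule: release.cases) auto

lemma release_map_Pair: "release (map (Pair True) w) = block w"
  by (cases w) auto

lemma block_eq_Nil [simp]: "block w = [] \<longleftrightarrow> w = []"
  by (cases w) auto

text \<open>In a run of set flags an inner cell cannot hold the largest entry: its own flag excludes
  the negative sign, the flag after it the positive one. Only the last cell remains, with the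
  positive sign.\<close>

lemma removals_forced:
  assumes "free_start C" "w \<noteq> []"
  shows "removals x A (map (Pair True) w) C = (- 1) ^ length C * x ^ opp (last w) (letters C) *
    signed_sum x (A @ map (Pair True) (butlast w) @ C)"
  using assms(2)
proof (induction w arbitrary: A)
  case (Cons a w)
  show ?case
  proof (cases "w = []")
    case True
    then show ?thesis using assms(1) by (simp add: removal_def release_free)
  next
    case False
    then show ?thesis using Cons.IH[of "A @ [(True, a)]"] by (cases w) (simp_all add: removal_def)
  qed
qed simp

text \<open>Within a block the largest entry is either positive in the last cell or negative in the
  first. In a block of one cell both signs are possible in the same place.\<close>

lemma removals_block:
  assumes "free_start C" "w \<noteq> []"
  shows "removals x A (block w) C = (- 1) ^ length C *
    (x ^ opp (last w) (letters C) * signed_sum x (A @ block (butlast w) @ C)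
     - (- 1) ^ length w * x ^ (opp (hd w) (tl w) + opp (hd w) (letters C) + 2 * opp (hd w) (letters A)) * signed_sum x (A @ block (tl w) @ C))"
proof (cases w)
  case (Cons a u)
  \<comment> \<open>Deleting the first cell clears the flag of the second, so what is left of a
    block is again a block.\<close>
  have r: "release (map (Pair True) u @ C) = block u @ C"
    using assms(1) by (cases "u = []") (simp_all add: release_append release_map_Pair release_free)
  show ?thesis
  proof (cases "u = []")
    case True
    then show ?thesis using Cons assms r by (simp add: removal_def algebra_simps power_add)
  next
    case False
    then show ?thesis using Cons assms r removals_forced[OF assms(1) False, of x "A @ [(False, a)]"]
      by (cases u) (simp_all add: removal_def algebra_simps power_add)
  qed
qed (use assms in simp)

text \<open>The factor of a deletion from the left context sees \<open>X\<close> only through its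
  length, its letter counts and its first flag, which \<open>X1\<close> and \<open>X2\<close> share.
  So a relation for shorter left contexts passes to the sum of these deletions.\<close>

lemma removals_context_left:
  fixes \<alpha> \<beta> :: "'r::comm_ring_1"
  assumes "\<And>L'. Suc (length L') = length A + length L \<Longrightarrow>
      signed_sum x (L' @ X) = \<alpha> * signed_sum x (L' @ X1) + \<beta> * signed_sum x (L' @ X2)"
    and "free_start X" "free_start X1" "free_start X2"
    and "length X1 = length X" "length X2 = length X"
    and "\<And>c. opp c (letters X1) = opp c (letters X)" "\<And>c. opp c (letters X2) = opp c (letters X)"
  shows "removals x A L X = \<alpha> * removals x A L X1 + \<beta> * removals x A L X2"
  using assms(1)
proof (induction L arbitrary: A)
  case (Cons p L)
  have "removal x A p (L @ X) = \<alpha> * removal x A p (L @ X1) + \<beta> * removal x A p (L @ X2)"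
  proof (cases "L = []")
    case True
    then show ?thesis using Cons.prems[of A] assms(2-)
      by (simp add: removal_def release_free algebra_simps)
  next
    case False
    then show ?thesis using Cons.prems[of "A @ release L"] assms(2-)
      by (simp add: removal_def release_append algebra_simps)
  qed
  moreover have "removals x (A @ [p]) L X = \<alpha> * removals x (A @ [p]) L X1 + \<beta> * removals x (A @ [p]) L X2"
    using Cons.prems by (intro Cons.IH) auto
  ultimately show ?case by (simp add: algebra_simps)
qed simp

text \<open>The factor of a deletion from the right context sees \<open>X\<close> only through
  letter counts. After the deletion the right context still starts freely, as the relation
  requires.\<close>

lemma removals_context_right:
  fixes \<alpha> \<beta> :: "'r::comm_ring_1"
  assumes "\<And>R'. free_start R' \<Longrightarrow> Suc (length R') = length B + length R \<Longrightarrow>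
      signed_sum x (X @ R') = \<alpha> * signed_sum x (X1 @ R') + \<beta> * signed_sum x (X2 @ R')"
    and "free_start (B @ R)"
    and "\<And>c. opp c (letters X1) = opp c (letters X)" "\<And>c. opp c (letters X2) = opp c (letters X)"
  shows "removals x (X @ B) R [] = \<alpha> * removals x (X1 @ B) R [] + \<beta> * removals x (X2 @ B) R []"
  using assms(1,2)
proof (induction R arbitrary: B)
  case (Cons p R)
  have "removal x (X @ B) p R = \<alpha> * removal x (X1 @ B) p R + \<beta> * removal x (X2 @ B) p R"
    using Cons.prems(1)[of "B @ release R"] Cons.prems(2) assms(3,4)
    by (auto simp: removal_def algebra_simps)
  moreover have "removals x (X @ B @ [p]) R [] = \<alpha> * removals x (X1 @ B @ [p]) R [] + \<beta> * removals x (X2 @ B @ [p]) R []"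
    using Cons.prems by (intro Cons.IH) (auto split: if_splits)
  ultimately show ?case by (simp add: algebra_simps)
qed simp

section \<open>Alternating words and the relation for one more letter\<close>

abbreviation alternating :: "bool list \<Rightarrow> bool" where
  "alternating \<equiv> successively (\<noteq>)"

lemma opp_alternating:
  assumes "alternating w" "w \<noteq> []"
  shows "hd w \<noteq> c \<Longrightarrow> opp c w = (length w + 1) div 2" "hd w = c \<Longrightarrow> opp c w = length w div 2"
proof -
  have "opp c w = (length w + of_bool (hd w \<noteq> c)) div 2"
    using assms
  proof (induction w)
    case (Cons a w)
    then show ?case by (cases "w = []") (auto simp: successively_Cons split: if_splits)
  qed simp
  then show "hd w \<noteq> c \<Longrightarrow> opp c w = (length w + 1) div 2" "hd w = c \<Longrightarrow> opp c w = length w div 2" by auto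
qed

lemma alternating_last:
  "alternating w \<Longrightarrow> w \<noteq> [] \<Longrightarrow> last w = hd w \<longleftrightarrow> odd (length w)"
  by (induction w) (auto simp: successively_Cons)

lemma alternating_butlast: "alternating w \<Longrightarrow> alternating (butlast w)"
  by (cases w rule: rev_cases) (auto simp: successively_append_iff)

lemma alternating_tl: "alternating w \<Longrightarrow> alternating (tl w)"
  by (cases w) (auto simp: successively_Cons)

lemma power_double: "x ^ (2 * n) = x ^ n * x ^ n" for x :: "'r::comm_ring_1"
  by (simp add: mult_2 power_add)

text \<open>Induction on the total length, expanding both sides by the place of the largest entry.
  The coefficients do not involve \<open>L\<close> and \<open>R\<close>, so deletions from there are
  covered by the context lemmas. Deletions from the block leave \<open>butlast w\<close> or
  \<open>tl w\<close> next to the free letter, where the induction hypothesis applies; deletion of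
  the free letter leaves the block itself.\<close>

lemma signed_sum_insert:
  fixes x :: "'r::comm_ring_1"
  assumes "alternating w" "w \<noteq> []" "free_start R"
  shows "signed_sum x (L @ block w @ (False, c) # R) =
    of_bool (last w \<noteq> c) * signed_sum x (L @ block (w @ [c]) @ R) +
    of_bool (hd w \<noteq> c) * (- 1) ^ length w * x ^ opp c w * signed_sum x (L @ block (c # w) @ R)"
  using assms
proof (induction "length L + length w + length R" arbitrary: L w R rule: less_induct)
  case less
  define \<alpha> \<beta> :: 'r where "\<alpha> = of_bool (last w \<noteq> c)" and "\<beta> = of_bool (hd w \<noteq> c) * (- 1) ^ length w * x ^ opp c w"
  define X X1 X2 where "X = block w @ [(False, c)]" and "X1 = block (w @ [c])" and "X2 = block (c # w)"
  have IH: "signed_sum x (L' @ X @ R') = \<alpha> * signed_sum x (L' @ X1 @ R') + \<beta> * signed_sum x (L' @ X2 @ R')"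
    if "length L' + length R' < length L + length R" "free_start R'" for L' R'
    using less.hyps[of L' w R'] that less.prems by (simp add: \<alpha>_def \<beta>_def X_def X1_def X2_def)
  note ss = signed_sum_removals
  \<comment> \<open>All terms of the comparison below are multiples of \<open>Y w\<close>,
    \<open>Y (c # butlast w)\<close> or \<open>Y (tl w @ [c])\<close>.\<close>
  define Y where "Y = (\<lambda>u. signed_sum x (L @ block u @ R))"
  define l where "l = length w"
  have l: "l > 0" using less.prems by (simp add: l_def)
  have mid: "removals x L X R = \<alpha> * removals x L X1 R + \<beta> * removals x L X2 R"
  proof -
    have lb: "last (butlast w) \<noteq> last w" "hd (butlast w) = hd w" if "butlast w \<noteq> []"
      using that less.prems(1) by (cases w rule: rev_cases; auto simp: successively_append_iff)+
    have ht: "hd (tl w) \<noteq> hd w" "last (tl w) = last w" if "tl w \<noteq> []"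
      using that less.prems(1) by (cases w; auto simp: successively_Cons)+
    \<comment> \<open>As there are only two letters, \<open>c\<close> differs from the last letter
      of \<open>butlast w\<close> iff it equals \<open>last w\<close>, and then appending it
      restores \<open>w\<close>. The same argument at the other end gives \<open>h2\<close>.\<close>
    have h1: "signed_sum x (L @ block (butlast w) @ (False, c) # R) =
      of_bool (last w = c) * Y w + of_bool (hd w \<noteq> c) * (- 1) ^ (l - 1) * x ^ opp c (butlast w) * Y (c # butlast w)"
    proof (cases "butlast w = []")
      case True
      then obtain a where "w = [a]" using less.prems(2) by (cases w rule: rev_cases) auto
      then show ?thesis by (auto simp: Y_def l_def)
    next
      case False
      have "butlast w @ [c] = w" if "last w = c" using that append_butlast_last_id[OF less.prems(2)] by simp
      moreover have "last (butlast w) \<noteq> c \<longleftrightarrow> last w = c" using lb[OF False] by auto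
      ultimately show ?thesis
        using less.hyps[of L "butlast w" R] less.prems alternating_butlast[of w] False lb l
        by (auto simp: Y_def l_def simp del: block.simps)
    qed
    have h2: "signed_sum x (L @ block (tl w) @ (False, c) # R) =
      of_bool (last w \<noteq> c) * Y (tl w @ [c]) + of_bool (hd w = c) * (- 1) ^ (l - 1) * x ^ opp c (tl w) * Y w"
    proof (cases "tl w = []")
      case True
      then obtain a where "w = [a]" using less.prems(2) by (cases w) auto
      then show ?thesis by (auto simp: Y_def l_def)
    next
      case False
      have "c # tl w = w" if "hd w = c" using that less.prems(2) by (cases w) simp_all
      moreover have "hd (tl w) \<noteq> c \<longleftrightarrow> hd w = c" using ht[OF False] by auto
      ultimately show ?thesis
        using less.hyps[of L "tl w" R] less.prems alternating_tl[of w] False ht l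
        by (auto simp: Y_def l_def simp del: block.simps)
    qed
    define a where "a = hd w"
    have w: "w = a # tl w" "w = butlast w @ [last w]" using less.prems by (auto simp: a_def)
    have o1: "opp a w = l div 2" "opp (\<not> a) w = (l + 1) div 2"
      using opp_alternating[OF less.prems(1,2)] by (auto simp: a_def l_def)
    have o2: "opp d w = of_bool (d \<noteq> a) + opp d (tl w)" for d by (subst w(1)) auto
    have o3: "opp d w = of_bool (d \<noteq> last w) + opp d (butlast w)" for d by (subst w(2)) auto
    have la: "last w = (if odd l then a else \<not> a)"
      using alternating_last[OF less.prems(1,2)] by (auto simp: a_def l_def)
    have L1: "removals x L X R = (- 1) ^ Suc (length R) *
      (x ^ (of_bool (c \<noteq> last w) + opp (last w) (letters R)) * (of_bool (last w = c) * Y w + of_bool (a \<noteq> c) * (- 1) ^ (l - 1) * x ^ opp c (butlast w) * Y (c # butlast w))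
       - (- 1) ^ l * x ^ (opp a (tl w) + (of_bool (c \<noteq> a) + opp a (letters R)) + 2 * opp a (letters L)) *
          (of_bool (last w \<noteq> c) * Y (tl w @ [c]) + of_bool (a = c) * (- 1) ^ (l - 1) * x ^ opp c (tl w) * Y w))
      + (- 1) ^ length R * x ^ opp c (letters R) * (1 + x ^ (2 * (opp c (letters L) + opp c w))) * Y w"
    proof -
      have "removals x L X R = removals x L (block w) ((False, c) # R) + removal x (L @ block w) (False, c) R"
        by (simp add: X_def removals_append)
      also have "removal x (L @ block w) (False, c) R
        = (- 1) ^ length R * x ^ opp c (letters R) * (1 + x ^ (2 * (opp c (letters L) + opp c w))) * Y w"
        using less.prems by (simp add: removal_def release_free Y_def)
      finally show ?thesis
        using removals_block[of "(False, c) # R" w x L, unfolded h1 h2, folded l_def a_def] less.prems by simp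
    qed
    have L2: "removals x L X1 R = (- 1) ^ length R *
      (x ^ opp c (letters R) * Y w - (- 1) ^ Suc l * x ^ (opp a (tl w) + of_bool (c \<noteq> a) + opp a (letters R) + 2 * opp a (letters L)) * Y (tl w @ [c]))"
      using less.prems removals_block[of R "w @ [c]" x L] by (simp add: X1_def Y_def a_def l_def)
    have L3: "removals x L X2 R = (- 1) ^ length R *
      (x ^ opp (last w) (letters R) * Y (c # butlast w) - (- 1) ^ Suc l * x ^ (opp c w + opp c (letters R) + 2 * opp c (letters L)) * Y w)"
      using less.prems removals_block[of R "c # w" x L] by (simp add: X2_def Y_def a_def l_def del: block.simps)
    \<comment> \<open>The parity of \<open>l\<close> decides whether the first and last letters
      agree; writing \<open>l\<close> as 2k + 2 or 2k + 1 makes the halves in the exponents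
      explicit.\<close>
    show ?thesis
    proof (cases "even l")
      case True
      then have "l = 2 * Suc ((l - 2) div 2)" using l by presburger
      then obtain k where k: "l = 2 * Suc k" by blast
      show ?thesis
        unfolding L1 L2 L3 \<alpha>_def \<beta>_def a_def[symmetric] l_def[symmetric]
        using o1 o2[of a] o2[of "\<not> a"] o3[of a] o3[of "\<not> a"] la k
        by (cases "c = a") (auto simp: algebra_simps power_add power_double)
    next
      case False
      then obtain k where k: "l = 2 * k + 1" by (metis oddE)
      show ?thesis
        unfolding L1 L2 L3 \<alpha>_def \<beta>_def a_def[symmetric] l_def[symmetric]
        using o1 o2[of a] o2[of "\<not> a"] o3[of a] o3[of "\<not> a"] la k
        by (cases "c = a") (auto simp: algebra_simps power_add power_double)
    qed
  qed
  have lft: "removals x [] L (X @ R) = \<alpha> * removals x [] L (X1 @ R) + \<beta> * removals x [] L (X2 @ R)"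
    using less.prems by (intro removals_context_left IH) (auto simp: X_def X1_def X2_def)
  have rgt: "removals x ((L @ X) @ []) R [] = \<alpha> * removals x ((L @ X1) @ []) R [] + \<beta> * removals x ((L @ X2) @ []) R []"
    using less.prems IH by (intro removals_context_right) (auto simp: X_def X1_def X2_def)
  have "signed_sum x (L @ X @ R) = \<alpha> * signed_sum x (L @ X1 @ R) + \<beta> * signed_sum x (L @ X2 @ R)"
    using lft mid rgt less.prems
    by (simp add: signed_sum_removals removals_append X_def[THEN arg_cong, of "\<lambda>X. X = []"]
        X1_def[THEN arg_cong, of "\<lambda>X. X = []"] X2_def[THEN arg_cong, of "\<lambda>X. X = []"] algebra_simps)
  then show ?case by (simp add: \<alpha>_def \<beta>_def X_def X1_def X2_def)
qed


text \<open>The weight is even in the first entry, because negating it exchanges the two tests of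
  \<open>pair_inv\<close>. As \<open>R\<close> starts freely, nothing else restricts its sign. In
  the expansion this appears as 1 + x^0.\<close>

lemma signed_sum_forced_single:
  fixes x :: "'r::comm_ring_1"
  assumes "free_start R"
  shows "signed_sum x ((False, c) # R) = 2 * signed_sum x ((True, c) # R)"
  using assms
proof (induction "length R" arbitrary: R rule: less_induct)
  case less
  have "removals x ([(False, c)] @ []) R [] = 2 * removals x ([(True, c)] @ []) R [] + 0 * removals x ([(True, c)] @ []) R []"
    using less by (intro removals_context_right) auto
  then show ?case
    using less.prems by (simp add: signed_sum_removals removal_def algebra_simps)
qed

text \<open>The expansion is that of \<open>signed_sum_insert\<close>, for an initial run of
  positive entries without left context. Among the run and the new letter, only the letter can hold
  a negative largest entry, whence 1 + x^(2 * opp c w). The coefficient 2 enters through a run of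
  length one: its deletion leaves the letter free at the very start.\<close>

lemma signed_sum_forced_insert:
  fixes x :: "'r::comm_ring_1"
  assumes "alternating w" "w \<noteq> []" "free_start R"
  shows "signed_sum x (map (Pair True) w @ (False, c) # R) =
    of_bool (last w \<noteq> c) * (1 + x ^ (2 * opp c w)) * signed_sum x (map (Pair True) (w @ [c]) @ R) +
    of_bool (hd w \<noteq> c) * (- 1) ^ length w * (2 * x ^ opp c w) * signed_sum x (map (Pair True) (c # w) @ R)"
  using assms
proof (induction "length w + length R" arbitrary: w R rule: less_induct)
  case less
  define \<alpha> \<beta> :: 'r where "\<alpha> = of_bool (last w \<noteq> c) * (1 + x ^ (2 * opp c w))"
    and "\<beta> = of_bool (hd w \<noteq> c) * (- 1) ^ length w * (2 * x ^ opp c w)"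
  define X X1 X2 where "X = map (Pair True) w @ [(False, c)]" and "X1 = map (Pair True) (w @ [c])"
    and "X2 = map (Pair True) (c # w)"
  have IH: "signed_sum x (X @ R') = \<alpha> * signed_sum x (X1 @ R') + \<beta> * signed_sum x (X2 @ R')"
    if "length R' < length R" "free_start R'" for R'
    using less.hyps[of w R'] that less.prems by (simp add: \<alpha>_def \<beta>_def X_def X1_def X2_def)
  define Y where "Y = (\<lambda>u. signed_sum x (map (Pair True) u @ R))"
  define l where "l = length w"
  have l: "l > 0" using less.prems by (simp add: l_def)
  have mid: "removals x [] X R = \<alpha> * removals x [] X1 R + \<beta> * removals x [] X2 R"
  proof -
    define a where "a = hd w"
    have w: "w = a # tl w" "w = butlast w @ [last w]" using less.prems by (auto simp: a_def)
    \<comment> \<open>For \<open>l = 1\<close> nothing of the run is left and the induction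
      hypothesis does not apply; this case is kept as a separate term and settled by
      \<open>signed_sum_forced_single\<close>.\<close>
    have h1: "signed_sum x (map (Pair True) (butlast w) @ (False, c) # R) =
      of_bool (last w = c \<and> l > 1) * (1 + x ^ (2 * opp c (butlast w))) * Y w
      + of_bool (a \<noteq> c \<and> l > 1) * (- 1) ^ (l - 1) * (2 * x ^ opp c (butlast w)) * Y (c # butlast w)
      + of_bool (l = 1) * signed_sum x ((False, c) # R)"
    proof (cases "butlast w = []")
      case True
      then have "l = 1" using w(2) by (metis l_def One_nat_def append_Nil length_Cons list.size(3))
      then show ?thesis using True by simp
    next
      case False
      have "signed_sum x (map (Pair True) (butlast w) @ (True, c) # R) = Y w" if "last w = c"
      proof -
        have "map (Pair True) w = map (Pair True) (butlast w) @ [(True, c)]"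
          by (subst append_butlast_last_id[OF less.prems(2), symmetric]) (simp add: that)
        then show ?thesis by (simp add: Y_def)
      qed
      moreover have "last (butlast w) \<noteq> c \<longleftrightarrow> last w = c" "hd (butlast w) = a"
        using False less.prems(1) by (cases w rule: rev_cases; auto simp: successively_append_iff a_def)+
      moreover have "l > 1" using False by (cases w; cases "tl w") (auto simp: l_def)
      ultimately show ?thesis
        using less.hyps[of "butlast w" R] less.prems alternating_butlast[of w] False l
        by (auto simp: Y_def l_def)
    qed
    have o1: "opp a w = l div 2" "opp (\<not> a) w = (l + 1) div 2"
      using opp_alternating[OF less.prems(1,2)] by (auto simp: a_def l_def)
    have o3: "opp d w = of_bool (d \<noteq> last w) + opp d (butlast w)" for d by (subst w(2)) auto
    have la: "last w = (if odd l then a else \<not> a)"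
      using alternating_last[OF less.prems(1,2)] by (auto simp: a_def l_def)
    have L1: "removals x [] X R = (- 1) ^ Suc (length R) * x ^ (of_bool (c \<noteq> last w) + opp (last w) (letters R)) *
        signed_sum x (map (Pair True) (butlast w) @ (False, c) # R)
      + (- 1) ^ length R * x ^ opp c (letters R) * (1 + x ^ (2 * opp c w)) * Y w"
      using less.prems removals_forced[of "(False, c) # R" w x "[]"]
      by (simp add: X_def removals_append removal_def release_free Y_def)
    have L2: "removals x [] X1 R = (- 1) ^ length R * x ^ opp c (letters R) * Y w"
      using less.prems removals_forced[of R "w @ [c]" x "[]"] by (simp add: X1_def Y_def)
    have L3: "removals x [] X2 R = (- 1) ^ length R * x ^ opp (last w) (letters R) * Y (c # butlast w)"
      using less.prems removals_forced[of R "c # w" x "[]"] by (simp add: X2_def Y_def)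
    show ?thesis
    proof (cases "l = 1")
      case True
      then have "w = [a]" "butlast w = []" "last w = a" using w by (auto simp: l_def length_Suc_conv)
      then show ?thesis
        unfolding L1 L2 L3 \<alpha>_def \<beta>_def h1 using True signed_sum_forced_single[OF less.prems(3), of x c]
        by (auto simp: Y_def algebra_simps)
    next
      case l1: False
      show ?thesis
      proof (cases "even l")
        case True
        then have "l = 2 * Suc ((l - 2) div 2)" using l by presburger
      then obtain k where k: "l = 2 * Suc k" by blast
        show ?thesis
          unfolding L1 L2 L3 \<alpha>_def \<beta>_def h1 a_def[symmetric] l_def[symmetric]
          using o1 o3[of a] o3[of "\<not> a"] la k
          by (cases "c = a") (auto simp: algebra_simps power_add power_double)
      next
        case False
        then have "l = 2 * Suc ((l - 3) div 2) + 1" using l1 by presburger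
        then obtain k where k: "l = 2 * Suc k + 1" by blast
        show ?thesis
          unfolding L1 L2 L3 \<alpha>_def \<beta>_def h1 a_def[symmetric] l_def[symmetric]
          using o1 o3[of a] o3[of "\<not> a"] la k
          by (cases "c = a") (auto simp: algebra_simps power_add power_double)
      qed
    qed
  qed
  have rgt: "removals x (X @ []) R [] = \<alpha> * removals x (X1 @ []) R [] + \<beta> * removals x (X2 @ []) R []"
    using less.prems IH by (intro removals_context_right) (auto simp: X_def X1_def X2_def)
  have "signed_sum x (X @ R) = \<alpha> * signed_sum x (X1 @ R) + \<beta> * signed_sum x (X2 @ R)"
    using mid rgt less.prems
    by (simp add: signed_sum_removals removals_append X_def[THEN arg_cong, of "\<lambda>X. X = []"]
        X1_def[THEN arg_cong, of "\<lambda>X. X = []"] X2_def[THEN arg_cong, of "\<lambda>X. X = []"] algebra_simps)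
  then show ?case by (simp add: \<alpha>_def \<beta>_def X_def X1_def X2_def)
qed

section \<open>Evaluation for alternating letters\<close>

fun alt :: "bool \<Rightarrow> nat \<Rightarrow> bool list" where
  "alt s 0 = []"
| "alt s (Suc l) = s # alt (\<not> s) l"

lemma length_alt [simp]: "length (alt s l) = l"
  by (induction l arbitrary: s) auto

lemma alt_eq_Nil [simp]: "alt s l = [] \<longleftrightarrow> l = 0"
  by (cases l) auto

lemma hd_alt [simp]: "l > 0 \<Longrightarrow> hd (alt s l) = s"
  by (cases l) auto

lemma alternating_alt [simp]: "successively (\<lambda>x y. x = (\<not> y)) (alt s l)"
  by (induction l arbitrary: s) (auto simp: successively_Cons)

lemma alt_add: "alt s (k + l) = alt s k @ alt (s \<noteq> odd k) l"
proof (induction k arbitrary: s)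
  case (Suc k)
  have "((\<not> s) \<noteq> odd k) = (s \<noteq> odd (Suc k))" by auto
  then show ?case using Suc[of "\<not> s"] by simp
qed simp

lemma alt_Suc_snoc: "alt s (Suc l) = alt s l @ [s \<noteq> odd l]"
  using alt_add[of s l 1] by simp

lemma last_alt: "l > 0 \<Longrightarrow> last (alt s l) = (s = odd l)"
  by (cases l) (auto simp: alt_Suc_snoc simp del: alt.simps)

lemma opp_alt: "opp c (alt s l) = (if c = s then l div 2 else Suc l div 2)"
  by (cases "l = 0") (use opp_alternating[of "alt s l" c] in auto)

section \<open>Reduction of blocks to single letters\<close>

abbreviation forced :: "bool list \<Rightarrow> cells" where "forced \<equiv> map (Pair True)"
abbreviation singles :: "bool list \<Rightarrow> cells" where "singles \<equiv> map (Pair False)"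

lemma free_start_singles [simp]: "free_start (singles w)"
  by (cases w) simp_all

text \<open>The q-Pochhammer symbol (q; q)_k at q = x^2.\<close>

definition qfac :: "'r::comm_ring_1 \<Rightarrow> nat \<Rightarrow> 'r" where
  "qfac x k = (\<Prod>i = 1..k. 1 - x ^ (2 * i))"

text \<open>The new letter equals both ends of a block of one cell, so both coefficients of the
  relation vanish.\<close>

lemma signed_sum_repeated: "free_start R \<Longrightarrow> signed_sum x (L @ (False, c) # (False, c) # R) = 0"
  using signed_sum_insert[of "[c]" R x L c] by simp

text \<open>Appending the opposite letter to an odd block relates the two even blocks of the next
  length, one for each starting letter. The two instances form a linear system of determinant 1 -
  x^(2k+2). Growing from an even block to an odd one produces a single term and no new
  factor.\<close>

lemma signed_sum_block_reduce:
  fixes x :: "'r::comm_ring_1"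
  assumes "free_start R"
  shows "qfac x k * signed_sum x (L @ block (alt s (2 * k + 1)) @ R) = signed_sum x (L @ singles (alt s (2 * k + 1)) @ R)"
    and "k > 0 \<Longrightarrow> qfac x k * signed_sum x (L @ block (alt s (2 * k)) @ R) =
      signed_sum x (L @ singles (alt s (2 * k)) @ R) + x ^ k * signed_sum x (L @ singles (alt (\<not> s) (2 * k)) @ R)"
  using assms
proof (induction k arbitrary: s R)
  case 0
  {
    case 1 then show ?case by (simp add: qfac_def)
  next
    case 2 then show ?case by simp
  }
next
  case (Suc k)
  have q: "qfac x (Suc k) = (1 - x ^ Suc k * x ^ Suc k) * qfac x k"
    unfolding qfac_def power_double[symmetric, of x "Suc k"]
    by (simp add: mult.commute del: power_Suc mult_Suc_right)
  have even: "qfac x (Suc k) * signed_sum x (L @ block (alt s (2 * Suc k)) @ R) =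
      signed_sum x (L @ singles (alt s (2 * Suc k)) @ R) + x ^ Suc k * signed_sum x (L @ singles (alt (\<not> s) (2 * Suc k)) @ R)"
    if R: "free_start R" for s R
  proof -
    define U V where "U = signed_sum x (L @ block (alt s (2 * Suc k)) @ R)"
      and "V = signed_sum x (L @ block (alt (\<not> s) (2 * Suc k)) @ R)"
    have ins: "signed_sum x (L @ block (alt t (2 * k + 1)) @ (False, \<not> t) # R)
      = signed_sum x (L @ block (alt t (2 * Suc k)) @ R) - x ^ Suc k * signed_sum x (L @ block (alt (\<not> t) (2 * Suc k)) @ R)"
      for t
    proof -
      have a: "alt t (2 * Suc k) = alt t (2 * k + 1) @ [\<not> t]"
        using alt_Suc_snoc[of t "2 * k + 1"] by (simp del: alt.simps)
      have b: "alt (\<not> t) (2 * Suc k) = (\<not> t) # alt t (2 * k + 1)" by simp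
      show ?thesis unfolding a b
        using signed_sum_insert[of "alt t (2 * k + 1)" R x L "\<not> t"] R
        by (simp add: opp_alt last_alt del: alt.simps block.simps)
    qed
    have red: "qfac x k * signed_sum x (L @ block (alt t (2 * k + 1)) @ (False, \<not> t) # R)
      = signed_sum x (L @ singles (alt t (2 * Suc k)) @ R)" for t
    proof -
      have a: "alt t (2 * Suc k) = alt t (2 * k + 1) @ [\<not> t]"
        using alt_Suc_snoc[of t "2 * k + 1"] by (simp del: alt.simps)
      show ?thesis unfolding a using Suc(1)[of "(False, \<not> t) # R" t] by (simp del: alt.simps)
    qed
    \<comment> \<open>Elimination of \<open>V\<close>: with y = x^(k+1), (1 - y^2) U = (U - y V) + y
      (V - y U).\<close>
    have "qfac x (Suc k) * U = qfac x k * (U - x ^ Suc k * V) + x ^ Suc k * (qfac x k * (V - x ^ Suc k * U))"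
      unfolding q by (simp add: algebra_simps)
    also have "\<dots> = signed_sum x (L @ singles (alt s (2 * Suc k)) @ R) + x ^ Suc k * signed_sum x (L @ singles (alt (\<not> s) (2 * Suc k)) @ R)"
      using red[of s] red[of "\<not> s"] ins[of s] ins[of "\<not> s"] by (simp only: U_def V_def not_not)
    finally show ?thesis by (simp only: U_def)
  qed
  {
    case 1
    have a: "alt s (2 * Suc k + 1) = alt s (2 * Suc k) @ [s]"
      using alt_Suc_snoc[of s "2 * Suc k"] by (simp del: alt.simps)
    have b: "alt (\<not> s) (2 * Suc k) = alt (\<not> s) (2 * k + 1) @ [s]"
      using alt_Suc_snoc[of "\<not> s" "2 * k + 1"] by (simp del: alt.simps)
    have "signed_sum x (L @ block (alt s (2 * Suc k + 1)) @ R) = signed_sum x (L @ block (alt s (2 * Suc k)) @ (False, s) # R)"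
      unfolding a using signed_sum_insert[of "alt s (2 * Suc k)" R x L s] 1
      by (simp add: last_alt del: alt.simps block.simps mult_Suc_right)
    \<comment> \<open>The even word with the wrong start ends in \<open>s\<close> and now meets a
      second \<open>s\<close>, so its term drops out.\<close>
    moreover have "signed_sum x (L @ singles (alt (\<not> s) (2 * Suc k)) @ (False, s) # R) = 0"
      unfolding b using signed_sum_repeated[of R x "L @ singles (alt (\<not> s) (2 * k + 1))" s] 1
      by (simp del: alt.simps)
    ultimately show ?case
      using even[of "(False, s) # R" s] unfolding a by (simp del: alt.simps mult_Suc_right)
  next
    case 2
    then show ?case using even by simp
  }
qed

fun blocks :: "bool \<Rightarrow> nat list \<Rightarrow> cells" where
  "blocks s [] = []"
| "blocks s (l # ls) = block (alt s l) @ blocks (s \<noteq> odd l) ls"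

lemma free_start_blocks [simp]: "free_start (blocks s ls)"
  by (induction ls arbitrary: s) auto

lemma length_blocks [simp]: "length (blocks s ls) = sum_list ls"
  by (induction ls arbitrary: s) auto

lemma even_sum_list: "\<forall>l\<in>set ls. even l \<Longrightarrow> even (sum_list ls)" for ls :: "nat list"
  by (induction ls) auto

text \<open>An even block reduces to words with either starting letter, an odd one only to the right
  start. Neighbouring words that do not continue each other meet in equal letters and contribute
  nothing. So a wrong start survives only if it runs through all blocks, that is, if all lengths are
  even.\<close>

lemma signed_sum_blocks:
  fixes x :: "'r::comm_ring_1"
  assumes "ls \<noteq> []" "0 \<notin> set ls"
  shows "(\<Prod>l\<leftarrow>ls. qfac x (l div 2)) * signed_sum x (P @ blocks s ls) =
    signed_sum x (P @ singles (alt s (sum_list ls))) +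
    of_bool (\<forall>l\<in>set ls. even l) * x ^ (sum_list ls div 2) * signed_sum x (P @ singles (alt (\<not> s) (sum_list ls)))"
  using assms
proof (induction ls arbitrary: P s rule: list_nonempty_induct)
  case (single l)
  show ?case
  proof (cases "even l")
    case True
    then obtain k where "l = 2 * k" by (elim evenE)
    then show ?thesis using signed_sum_block_reduce(2)[of "[]" k x P s] single by simp
  next
    case False
    then obtain k where "l = 2 * k + 1" by (elim oddE)
    then show ?thesis using signed_sum_block_reduce(1)[of "[]" x k P s] by (simp del: alt.simps)
  qed
next
  case (cons l ls)
  define t where "t = sum_list ls"
  define E :: 'r where "E = of_bool (\<forall>l\<in>set ls. even l)"
  define N where "N = (\<Prod>l\<leftarrow>ls. qfac x (l div 2))"
  have l: "l > 0" and z: "0 \<notin> set ls" using cons.prems by auto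
  have t: "t > 0" using z cons.hyps by (cases ls) (auto simp: t_def)
  have Eeven: "E = 0" if "odd t"
    using that by (auto simp: E_def t_def intro: even_sum_list)
  have IH: "N * signed_sum x (Q @ blocks s' ls) = signed_sum x (Q @ singles (alt s' t)) +
    E * x ^ (t div 2) * signed_sum x (Q @ singles (alt (\<not> s') t))" for Q s'
    using cons.IH[OF z, of Q s'] by (simp add: t_def E_def N_def)
  have zero: "signed_sum x (P @ singles (alt s1 l) @ singles (alt s2 t)) = 0" if "s2 \<noteq> (s1 \<noteq> odd l)" for s1 s2
  proof -
    obtain l' where l': "l = Suc l'" using l by (cases l) auto
    obtain t' where t': "t = Suc t'" using t by (cases t) auto
    have s2: "s2 = (s1 \<noteq> odd l')" using that l' by auto
    show ?thesis
      using signed_sum_repeated[of "singles (alt (\<not> s2) t')" x "P @ singles (alt s1 l')" s2]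
      by (subst l', subst alt_Suc_snoc, subst t') (simp add: s2)
  qed
  show ?case
  proof (cases "even l")
    case True
    then obtain k where k: "l = 2 * k" by (elim evenE)
    have "qfac x k * signed_sum x (P @ block (alt s l) @ blocks s ls) = signed_sum x (P @ singles (alt s l) @ blocks s ls)
       + x ^ k * signed_sum x (P @ singles (alt (\<not> s) l) @ blocks s ls)"
      using signed_sum_block_reduce(2)[of "blocks s ls" k x P s] l k by simp
    moreover have al: "alt r (l + t) = alt r l @ alt r t" for r using alt_add[of r l t] True by simp
    ultimately have "N * (qfac x k * signed_sum x (P @ block (alt s l) @ blocks s ls)) = N * signed_sum x ((P @ singles (alt s l)) @ blocks s ls)
       + x ^ k * (N * signed_sum x ((P @ singles (alt (\<not> s) l)) @ blocks s ls))"
      by (simp add: algebra_simps)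
    also have "\<dots> = signed_sum x (P @ singles (alt s (l + t))) + E * x ^ ((l + t) div 2) * signed_sum x (P @ singles (alt (\<not> s) (l + t)))"
      unfolding IH al using True zero[of "\<not> s" s] zero[of s "\<not> s"] k
      by (simp add: power_add algebra_simps)
    finally show ?thesis using True k by (simp add: t_def E_def N_def algebra_simps)
  next
    case False
    then obtain k where k: "l = 2 * k + 1" by (elim oddE)
    have "qfac x k * signed_sum x (P @ block (alt s l) @ blocks (\<not> s) ls) = signed_sum x (P @ singles (alt s l) @ blocks (\<not> s) ls)"
      using signed_sum_block_reduce(1)[of "blocks (\<not> s) ls" x k P s] l k by (simp del: alt.simps)
    then have "N * (qfac x k * signed_sum x (P @ block (alt s l) @ blocks (\<not> s) ls)) = N * signed_sum x ((P @ singles (alt s l)) @ blocks (\<not> s) ls)"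
      by simp
    also have "\<dots> = signed_sum x (P @ singles (alt s (l + t)))"
      unfolding IH using False zero[of s s] by (simp add: alt_add)
    finally show ?thesis using False k by (simp add: t_def N_def algebra_simps del: alt.simps)
  qed
qed

section \<open>Initial runs followed by single letters\<close>

lemma signed_sum_forced: "signed_sum x (forced w) = 1"
proof (induction w rule: rev_induct)
  case (snoc a w)
  then show ?case
    using removals_forced[of "[]" "w @ [a]" x "[]"] by (simp add: signed_sum_removals)
qed simp

text \<open>Letters are peeled off in pairs so that the length \<open>d\<close> of the initial run
  stays odd; a last single letter gets its own clause.\<close>

fun odd_value :: "'r::comm_ring_1 \<Rightarrow> nat \<Rightarrow> nat \<Rightarrow> 'r" where
  "odd_value x d 0 = 1"
| "odd_value x d (Suc 0) = (1 - x ^ (Suc d div 2)) ^ 2"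
| "odd_value x d (Suc (Suc r)) = (1 - x ^ Suc d) ^ 2 * odd_value x (Suc (Suc d)) r"

lemma signed_sum_odd_start:
  fixes x :: "'r::comm_ring_1"
  assumes "odd d"
  shows "signed_sum x (forced (alt s d) @ singles (alt (\<not> s) r)) = odd_value x d r"
  using assms
proof (induction x d r arbitrary: s rule: odd_value.induct)
  case (1 x d)
  then show ?case by (simp add: signed_sum_forced)
next
  case (2 x d)
  then have d: "d > 0" "Suc d = Suc d div 2 + Suc d div 2" by (auto elim!: oddE)
  define y where "y = x ^ (Suc d div 2)"
  have y: "x * x ^ (d div 2) = y" using 2 by (simp add: y_def)
  have p: "x * x ^ d = y * y"
    unfolding y_def power_Suc[symmetric] by (subst d(2)) (simp only: power_add)
  \<comment> \<open>Both ways of absorbing the letter give a fully forced word, of value 1, so the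
    result is 1 + y^2 - 2y.\<close>
  have "signed_sum x (forced (alt s d) @ [(False, \<not> s)]) =
    (1 + y * y) * signed_sum x (forced (alt s d @ [\<not> s])) - 2 * y * signed_sum x (forced ((\<not> s) # alt s d))"
    using signed_sum_forced_insert[of "alt s d" "[]" x "\<not> s"] 2 d(1) p y
    by (simp add: last_alt opp_alt power_double)
  then show ?case
    unfolding signed_sum_forced by (simp add: y_def[symmetric] power2_eq_square algebra_simps)
next
  case (3 x d r)
  then have d: "d > 0" "Suc d = Suc d div 2 + Suc d div 2" by (auto elim!: oddE)
  define y where "y = x ^ (Suc d div 2)"
  have y: "x * x ^ (d div 2) = y" using 3 by (simp add: y_def)
  have p: "x ^ Suc d = y * y" unfolding y_def by (subst d(2)) (simp add: power_add)
  then have p': "x * x ^ d = y * y" by simp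
  define R where "R = singles (alt (\<not> s) r)"
  have fr: "free_start R" by (simp add: R_def)
  have a1: "alt s (Suc d) = alt s d @ [\<not> s]" using 3 by (simp add: alt_Suc_snoc del: alt.simps)
  have a2: "alt s (Suc (Suc d)) = alt s (Suc d) @ [s]" using 3 by (simp add: alt_Suc_snoc del: alt.simps)
  \<comment> \<open>The first letter can join either end of the run. The second letter leads both
    results back to the same run of length d + 2, with coefficients 1 + y^2 and 2y.\<close>
  have e1: "signed_sum x (forced (alt s d) @ (False, \<not> s) # (False, s) # R) =
    (1 + y * y) * signed_sum x (forced (alt s (Suc d)) @ (False, s) # R)
    - 2 * y * signed_sum x (forced (alt (\<not> s) (Suc d)) @ (False, s) # R)"
    using signed_sum_forced_insert[of "alt s d" "(False, s) # R" x "\<not> s"] 3 d(1) fr p' y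
    unfolding a1 by (simp add: last_alt opp_alt power_double)
  have e2: "signed_sum x (forced (alt s (Suc d)) @ (False, s) # R) = (1 + y * y) * signed_sum x (forced (alt s (Suc (Suc d))) @ R)"
    using signed_sum_forced_insert[of "alt s (Suc d)" R x s] 3 d(1) fr p' y
    unfolding a2 by (simp add: last_alt opp_alt power_double del: alt.simps)
  have e3: "signed_sum x (forced (alt (\<not> s) (Suc d)) @ (False, s) # R) = 2 * y * signed_sum x (forced (alt s (Suc (Suc d))) @ R)"
    using signed_sum_forced_insert[of "alt (\<not> s) (Suc d)" R x s] 3 d(1) fr p' y
    unfolding alt.simps(2)[of s "Suc d"] by (simp add: last_alt opp_alt power_double del: alt.simps(2))
  have "signed_sum x (forced (alt s d) @ singles (alt (\<not> s) (Suc (Suc r))))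
    = (1 - y * y) ^ 2 * signed_sum x (forced (alt s (Suc (Suc d))) @ R)"
    using e1 unfolding e2 e3 by (simp add: R_def power2_eq_square algebra_simps)
  also have "signed_sum x (forced (alt s (Suc (Suc d))) @ R) = odd_value x (Suc (Suc d)) r"
    unfolding R_def using 3 by simp
  finally show ?case by (simp only: odd_value.simps p)
qed

text \<open>The normal form of all cases: a run of \<open>d\<close> positive increasing entries,
  empty if the first flag is clear, and then the blocks. The starting letter \<open>even d\<close>
  continues the alternation.\<close>

definition cells_of :: "nat \<Rightarrow> nat list \<Rightarrow> cells" where
  "cells_of d ls = forced (alt True d) @ blocks (even d) ls"

lemma signed_sum_cells_of_no_blocks: "signed_sum x (cells_of d []) = 1"
  by (simp add: cells_of_def signed_sum_forced)

text \<open>Without an initial run the starting letter does not matter, so both words of single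
  letters have the same value and the two terms combine.\<close>

lemma signed_sum_cells_of_0:
  assumes "ls \<noteq> []" "0 \<notin> set ls"
  shows "(\<Prod>l\<leftarrow>ls. qfac x (l div 2)) * signed_sum x (cells_of 0 ls) =
    2 * (1 + of_bool (\<forall>l\<in>set ls. even l) * x ^ (sum_list ls div 2)) * odd_value x 1 (sum_list ls - 1)"
proof -
  obtain t where t: "sum_list ls = Suc t" using assms by (cases ls; cases "hd ls") auto
  have s: "signed_sum x (singles (alt s (Suc t))) = 2 * odd_value x 1 t" for s
    using signed_sum_forced_single[of "singles (alt (\<not> s) t)" x s] signed_sum_odd_start[of 1 x s t] by simp
  show ?thesis using signed_sum_blocks[OF assms, of x "[]" True]
    by (simp add: cells_of_def t s algebra_simps del: alt.simps(2))
qed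

text \<open>An odd run begins and ends with the same letter. A wrong start repeats it, and its term
  vanishes even if all blocks are even.\<close>

lemma signed_sum_cells_of_odd:
  assumes "ls \<noteq> []" "0 \<notin> set ls" "odd d"
  shows "(\<Prod>l\<leftarrow>ls. qfac x (l div 2)) * signed_sum x (cells_of d ls) = odd_value x d (sum_list ls)"
proof -
  obtain t where t: "sum_list ls = Suc t" using assms by (cases ls; cases "hd ls") auto
  have "signed_sum x (forced (alt True d) @ singles (alt True (Suc t))) = 0"
    using signed_sum_forced_insert[of "alt True d" "singles (alt False t)" x True] assms(3)
    by (simp add: last_alt odd_pos)
  then show ?thesis using signed_sum_blocks[OF assms(1,2), of x "forced (alt True d)" False]
      signed_sum_odd_start[OF assms(3), of x True "Suc t"] assms(3)
    by (simp add: cells_of_def t del: alt.simps odd_value.simps)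
qed

text \<open>An odd block leaves only the right start, and the first single letter makes the run odd
  at the cost of 1 + x^d. With even blocks only, the other start would survive too, since it differs
  from the first letter of the run; this is the exceptional case.\<close>

lemma signed_sum_cells_of_even:
  assumes "0 \<notin> set ls" "even d" "d > 0" "\<not> (\<forall>l\<in>set ls. even l)"
  shows "(\<Prod>l\<leftarrow>ls. qfac x (l div 2)) * signed_sum x (cells_of d ls)
    = (1 + x ^ d) * odd_value x (Suc d) (sum_list ls - 1)"
proof -
  have ne: "ls \<noteq> []" using assms by auto
  then obtain t where t: "sum_list ls = Suc t" using assms by (cases ls; cases "hd ls") auto
  have "signed_sum x (forced (alt True d) @ singles (alt True (Suc t)))
    = (1 + x ^ d) * signed_sum x (forced (alt True (Suc d)) @ singles (alt False t))"
    using signed_sum_forced_insert[of "alt True d" "singles (alt False t)" x True] assms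
    unfolding alt_Suc_snoc[of True d] by (simp add: last_alt opp_alt)
  then show ?thesis using signed_sum_blocks[OF ne assms(1), of x "forced (alt True d)" True]
      signed_sum_odd_start[of "Suc d" x True t] assms(2,4)
    by (simp add: cells_of_def t del: alt.simps odd_value.simps)
qed

section \<open>Quotients of products of cyclotomic polynomials\<close>

lemma finite_primitive_roots: "0 < k \<Longrightarrow> finite {\<omega>. primitive_root_of_unity k \<omega>}"
  by (rule finite_subset[of _ "{z. z ^ k = 1}"]) (auto simp: primitive_root_of_unity_def finite_roots_unity)

lemma primitive_root_unique:
  assumes "primitive_root_of_unity k z" "primitive_root_of_unity l z" "0 < k" "0 < l"
  shows "k = l"
  using assms unfolding primitive_root_of_unity_def by (meson linorder_neqE_nat)

lemma primitive_root_exists: "0 < k \<Longrightarrow> \<exists>z. primitive_root_of_unity k z"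
proof (intro exI[of _ "cis (2 * pi / k)"])
  assume k: "0 < k"
  have *: "cis (2 * pi / k) ^ j = 1 \<longleftrightarrow> k dvd j" for j
    using complex_root_unity_eq_1[of k j] k
    by (simp add: cis_conv_exp DeMoivre exp_of_nat_mult[symmetric] mult_ac)
  show "primitive_root_of_unity k (cis (2 * pi / k))"
    unfolding primitive_root_of_unity_def * by (auto dest: dvd_imp_le)
qed

lemma poly_cyclotomic_eq_0_iff:
  "0 < k \<Longrightarrow> poly (cyclotomic k) z = 0 \<longleftrightarrow> primitive_root_of_unity k z"
  by (auto simp: cyclotomic_def poly_prod finite_primitive_roots)

lemma cyclotomic_neq_0 [simp]: "0 < k \<Longrightarrow> cyclotomic k \<noteq> 0"
  by (auto simp: cyclotomic_def finite_primitive_roots)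

lemma power_eq_1_iff_primitive_root:
  assumes "0 < m"
  shows "z ^ m = 1 \<longleftrightarrow> (\<exists>k. k dvd m \<and> primitive_root_of_unity k z)"
proof
  assume zm: "z ^ m = 1"
  define k where "k = (LEAST k. 0 < k \<and> z ^ k = 1)"
  have k: "0 < k \<and> z ^ k = 1" unfolding k_def by (rule LeastI[of _ m]) (use assms zm in auto)
  have least: "\<not> (0 < j \<and> z ^ j = 1)" if "j < k" for j
    using that not_less_Least unfolding k_def by blast
  have "z ^ m = (z ^ k) ^ (m div k) * z ^ (m mod k)" by (simp add: power_mult[symmetric] power_add[symmetric])
  then have "z ^ (m mod k) = 1" using k zm by simp
  then have "m mod k = 0" using least[of "m mod k"] k by auto
  then show "\<exists>k. k dvd m \<and> primitive_root_of_unity k z"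
    using k least unfolding primitive_root_of_unity_def by blast
qed (auto simp: primitive_root_of_unity_def power_mult)

text \<open>The polynomial x^m - 1 has no repeated root; its linear factors are grouped by the order
  of the root.\<close>

lemma one_minus_monom_cyclotomic:
  assumes "0 < m"
  shows "1 - monom 1 m = - (\<Prod>k | k dvd m. cyclotomic k)"
proof -
  define p :: "complex poly" where "p = monom 1 m - 1"
  have root: "poly p z = 0 \<longleftrightarrow> z ^ m = 1" for z by (simp add: p_def poly_monom)
  have "degree p = m"
    using degree_add_eq_left[of "- 1" "monom 1 m :: complex poly"] assms by (simp add: p_def degree_monom_eq)
  then have lc: "lead_coeff p = 1" using assms by (simp add: p_def)
  have "rsquarefree p"
    unfolding rsquarefree_roots root
    using assms by (auto simp: p_def pderiv_diff pderiv_monom poly_monom power_eq_0_iff zero_power)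
  then have "p = (\<Prod>z | z ^ m = 1. [:- z, 1:])"
    using complex_poly_decompose_rsquarefree[of p] by (simp add: lc root)
  also have "{z. z ^ m = 1} = (\<Union>k\<in>{k. k dvd m}. {z. primitive_root_of_unity k z})"
    using power_eq_1_iff_primitive_root[OF assms] by auto
  also have "(\<Prod>z\<in>\<dots>. [:- z, 1:]) = (\<Prod>k | k dvd m. cyclotomic k)"
    unfolding cyclotomic_def
  proof (rule prod.UNION_disjoint)
    have pos: "0 < k" if "k dvd m" for k using that assms by (cases k) auto
    show "\<forall>i\<in>{k. k dvd m}. finite {z. primitive_root_of_unity i z}"
      using pos finite_primitive_roots by auto
    show "\<forall>i\<in>{k. k dvd m}. \<forall>j\<in>{k. k dvd m}. i \<noteq> j \<longrightarrow>
      {z. primitive_root_of_unity i z} \<inter> {z. primitive_root_of_unity j z} = {}"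
      using primitive_root_unique pos by blast
  qed (use assms in simp)
  finally show ?thesis by (simp add: p_def algebra_simps)
qed

text \<open>The sign is left open because the factors 1 - x^m have leading coefficient -1.\<close>

definition cyclo_prod :: "complex poly \<Rightarrow> bool" where
  "cyclo_prod p \<longleftrightarrow> (\<exists>ks. 0 \<notin> set ks \<and> (p = (\<Prod>k\<leftarrow>ks. cyclotomic k) \<or> p = - (\<Prod>k\<leftarrow>ks. cyclotomic k)))"

lemma cyclo_prod_1 [simp]: "cyclo_prod 1"
  unfolding cyclo_prod_def by (rule exI[of _ "[]"]) simp

lemma cyclo_prod_mult [intro]:
  assumes "cyclo_prod p" "cyclo_prod q"
  shows "cyclo_prod (p * q)"
proof -
  obtain ks ls where "0 \<notin> set ks" "0 \<notin> set ls"
    "p = (\<Prod>k\<leftarrow>ks. cyclotomic k) \<or> p = - (\<Prod>k\<leftarrow>ks. cyclotomic k)"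
    "q = (\<Prod>k\<leftarrow>ls. cyclotomic k) \<or> q = - (\<Prod>k\<leftarrow>ls. cyclotomic k)"
    using assms by (auto simp: cyclo_prod_def)
  then show ?thesis unfolding cyclo_prod_def by (intro exI[of _ "ks @ ls"]) auto
qed

lemma cyclo_prod_power [intro]: "cyclo_prod p \<Longrightarrow> cyclo_prod (p ^ n)"
  by (induction n) auto

lemma cyclo_prod_prod_list: "(\<And>p. p \<in> set ps \<Longrightarrow> cyclo_prod p) \<Longrightarrow> cyclo_prod (prod_list ps)"
  by (induction ps) auto

lemma cyclo_prod_prod: "(\<And>i. i \<in> A \<Longrightarrow> cyclo_prod (f i)) \<Longrightarrow> cyclo_prod (prod f A)"
  by (induction A rule: infinite_finite_induct) auto

lemma cyclo_prod_one_minus: "0 < m \<Longrightarrow> cyclo_prod (1 - monom 1 m)"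
proof -
  assume m: "0 < m"
  obtain ks where ks: "set ks = {k. k dvd m}" "distinct ks"
    using finite_distinct_list[of "{k. k dvd m}"] m by auto
  then have "1 - monom 1 m = - (\<Prod>k\<leftarrow>ks. cyclotomic k)"
    using one_minus_monom_cyclotomic[OF m] by (metis prod.distinct_set_conv_list)
  moreover have "0 \<notin> set ks" using ks m by auto
  ultimately show ?thesis unfolding cyclo_prod_def by blast
qed

lemma prod_list_remove1:
  "k \<in> set ks \<Longrightarrow> (\<Prod>k\<leftarrow>ks. f k) = f k * (\<Prod>k\<leftarrow>remove1 k ks. f k :: 'b::comm_monoid_mult)"
  by (induction ks) (auto simp: ac_simps)

text \<open>One factor is cancelled at a time: a primitive k-th root of unity is a root of the other
  side, hence of some factor there, and the order of the root identifies that factor as the k-th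
  cyclotomic polynomial.\<close>

lemma cyclo_prod_cancel:
  assumes "cyclo_prod (q * p)" "cyclo_prod q"
  shows "cyclo_prod p"
proof -
  have *: "cyclo_prod p" if "cyclo_prod ((\<Prod>k\<leftarrow>ks. cyclotomic k) * p)" "0 \<notin> set ks" for ks
    using that
  proof (induction ks)
    case (Cons k ks)
    define Q where "Q = (\<Prod>k\<leftarrow>ks. cyclotomic k) * p"
    have k: "0 < k" using Cons.prems by auto
    obtain ls and s :: "complex poly" where ls: "0 \<notin> set ls" and s: "s = 1 \<or> s = -1"
      and eq: "cyclotomic k * Q = s * (\<Prod>k\<leftarrow>ls. cyclotomic k)"
      using Cons.prems(1) unfolding cyclo_prod_def Q_def
      by (auto simp: mult.assoc) (metis mult_1 mult_minus1)+
    obtain z where z: "primitive_root_of_unity k z" using primitive_root_exists[OF k] by auto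
    have "poly (s * (\<Prod>k\<leftarrow>ls. cyclotomic k)) z = 0"
      unfolding eq[symmetric] using z k by (simp add: poly_cyclotomic_eq_0_iff)
    then have "poly (\<Prod>k\<leftarrow>ls. cyclotomic k) z = 0" using s by auto
    then obtain l where l: "l \<in> set ls" "poly (cyclotomic l) z = 0"
      by (induction ls) auto
    then have "k = l" using primitive_root_unique[OF z, of l] ls k poly_cyclotomic_eq_0_iff[of l z]
      by (metis gr0I)
    then have "(\<Prod>k\<leftarrow>ls. cyclotomic k) = cyclotomic k * (\<Prod>k\<leftarrow>remove1 k ls. cyclotomic k)"
      using l by (intro prod_list_remove1) simp
    then have "cyclotomic k * Q = cyclotomic k * (s * (\<Prod>k\<leftarrow>remove1 k ls. cyclotomic k))"
      using eq by (simp add: ac_simps)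
    then have "Q = s * (\<Prod>k\<leftarrow>remove1 k ls. cyclotomic k)" using k by simp
    moreover have "0 \<notin> set (remove1 k ls)" using ls by (meson notin_set_remove1)
    ultimately have "cyclo_prod Q" unfolding cyclo_prod_def using s by auto
    then show ?case using Cons.IH Cons.prems by (simp add: Q_def)
  qed simp
  obtain ks where ks: "0 \<notin> set ks" "q = (\<Prod>k\<leftarrow>ks. cyclotomic k) \<or> q = - (\<Prod>k\<leftarrow>ks. cyclotomic k)"
    using assms(2) by (auto simp: cyclo_prod_def)
  have neg: "cyclo_prod r" if "cyclo_prod (- r)" for r
    using that unfolding cyclo_prod_def by (metis minus_minus)
  then have "cyclo_prod ((\<Prod>k\<leftarrow>ks. cyclotomic k) * p)" using ks assms(1) by auto
  then show ?thesis using * ks by blast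
qed

lemma cyclo_prod_one_plus: assumes "0 < m" shows "cyclo_prod (1 + monom 1 m)"
proof (rule cyclo_prod_cancel)
  have "(1 - monom 1 m) * (1 + monom 1 m) = (1 - monom 1 (2 * m) :: complex poly)"
    by (simp add: algebra_simps mult_monom mult_2_right)
  then show "cyclo_prod ((1 - monom 1 m) * (1 + monom 1 m))"
    using cyclo_prod_one_minus[of "2 * m"] assms by simp
qed (use assms cyclo_prod_one_minus in auto)

lemma is_cyclotomic_product_iff: "is_cyclotomic_product p \<longleftrightarrow> cyclo_prod (map_poly of_int p)"
  unfolding is_cyclotomic_product_def cyclo_prod_def by (metis gr0I less_not_refl)

section \<open>Simple systems\<close>

lemma linear_reflection: "linear (reflection \<alpha>)"
  by (rule linearI) (simp_all add: reflection_def algebra_simps inner_add_left add_divide_distrib)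

lemma reflection_uminus [simp]: "reflection (- \<alpha>) = reflection \<alpha>"
  by (simp add: fun_eq_iff reflection_def)

lemma reflection_self: "\<alpha> \<noteq> 0 \<Longrightarrow> reflection \<alpha> \<alpha> = - \<alpha>"
  by (simp add: reflection_def scaleR_2)

lemma reflection_involutive [simp]: "reflection \<alpha> (reflection \<alpha> v) = v"
  by (cases "\<alpha> = 0") (simp_all add: reflection_def algebra_simps inner_diff_left)

lemma root_system_uminus: "root_system \<Phi> \<Longrightarrow> \<alpha> \<in> \<Phi> \<Longrightarrow> - \<alpha> \<in> \<Phi>"
  unfolding root_system_def by (metis Int_iff insertCI)

lemma root_system_reflection: "root_system \<Phi> \<Longrightarrow> \<alpha> \<in> \<Phi> \<Longrightarrow> \<beta> \<in> \<Phi> \<Longrightarrow> reflection \<alpha> \<beta> \<in> \<Phi>"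
  unfolding root_system_def by blast

lemma root_neq_0: "root_system \<Phi> \<Longrightarrow> \<alpha> \<in> \<Phi> \<Longrightarrow> \<alpha> \<noteq> 0"
  unfolding root_system_def by blast

lemma linear_weyl: "w \<in> weyl_group \<Phi> \<Longrightarrow> linear w"
proof (induction rule: weyl_group.induct)
  case one
  show ?case by (rule linear_id)
next
  case (refl \<alpha> w)
  show ?case by (rule linear_compose[OF refl.IH linear_reflection])
qed

lemma weyl_root: "w \<in> weyl_group \<Phi> \<Longrightarrow> root_system \<Phi> \<Longrightarrow> \<beta> \<in> \<Phi> \<Longrightarrow> w \<beta> \<in> \<Phi>"
  by (induction rule: weyl_group.induct) (auto intro: root_system_reflection)

lemma weyl_fixes_orthogonal:
  "w \<in> weyl_group \<Phi> \<Longrightarrow> (\<And>\<alpha>. \<alpha> \<in> \<Phi> \<Longrightarrow> orthogonal v \<alpha>) \<Longrightarrow> w v = v"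
  by (induction rule: weyl_group.induct) (auto simp: reflection_def orthogonal_def)

lemma weyl_comp_reflection:
  "w \<in> weyl_group \<Phi> \<Longrightarrow> \<alpha> \<in> \<Phi> \<Longrightarrow> w \<circ> reflection \<alpha> \<in> weyl_group \<Phi>"
proof (induction rule: weyl_group.induct)
  case one
  then show ?case using weyl_group.refl[OF one weyl_group.one] by simp
next
  case (refl \<beta> w)
  then show ?case using weyl_group.refl[of \<beta> \<Phi> "w \<circ> reflection \<alpha>"] by (metis comp_assoc)
qed

text \<open>The roots may span a proper subspace. The group acts trivially on its orthogonal
  complement, so values on the span decide.\<close>

lemma weyl_eqI:
  assumes "w \<in> weyl_group \<Phi>" "w' \<in> weyl_group \<Phi>" "\<And>v. v \<in> span \<Phi> \<Longrightarrow> w v = w' v"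
  shows "w = w'"
proof
  fix v
  obtain y z where y: "y \<in> span \<Phi>" and z: "\<And>u. u \<in> span \<Phi> \<Longrightarrow> orthogonal z u" and v: "v = y + z"
    using orthogonal_subspace_decomp_exists[of \<Phi> v] by metis
  have "w z = z" "w' z = z"
    using assms(1,2) z by (auto intro!: weyl_fixes_orthogonal span_base)
  then show "w v = w' v"
    using assms y unfolding v by (simp add: linear_weyl linear_add)
qed

section \<open>Heights, positive roots and descents\<close>

lemma simple_system_finite: "simple_system \<Phi> \<Delta> \<Longrightarrow> finite \<Delta>"
  unfolding simple_system_def using independent_imp_finite by blast

lemma simple_system_expand:
  assumes "simple_system \<Phi> \<Delta>" "\<gamma> \<in> \<Phi>"
  shows "\<gamma> = (\<Sum>\<beta>\<in>\<Delta>. representation \<Delta> \<gamma> \<beta> *\<^sub>R \<beta>)"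
proof -
  have "independent \<Delta>" "\<gamma> \<in> span \<Delta>" using assms by (auto simp: simple_system_def)
  from sum_representation_eq[OF this simple_system_finite[OF assms(1)] order_refl] show ?thesis by simp
qed

lemma height_eq_linear:
  assumes "simple_system \<Phi> \<Delta>" "\<gamma> \<in> \<Phi>" "linear h" "\<And>\<beta>. \<beta> \<in> \<Delta> \<Longrightarrow> h \<beta> = 1"
  shows "height \<Delta> \<gamma> = h \<gamma>"
proof -
  have "h \<gamma> = (\<Sum>\<beta>\<in>\<Delta>. representation \<Delta> \<gamma> \<beta> * h \<beta>)"
    by (subst simple_system_expand[OF assms(1,2)]) (simp add: linear_sum[OF assms(3)] linear_scale[OF assms(3)])
  also have "\<dots> = height \<Delta> \<gamma>" unfolding height_def using assms(4) by (intro sum.cong) auto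
  finally show ?thesis by simp
qed

text \<open>The coefficients of a root have a common sign and are not all zero, so their sum shows
  that sign.\<close>

lemma pos_roots_iff_height:
  assumes "simple_system \<Phi> \<Delta>" "root_system \<Phi>" "\<gamma> \<in> \<Phi>"
  shows "\<gamma> \<in> pos_roots \<Phi> \<Delta> \<longleftrightarrow> 0 < height \<Delta> \<gamma>" "height \<Delta> \<gamma> \<noteq> 0"
proof -
  have fin: "finite \<Delta>" by (rule simple_system_finite[OF assms(1)])
  have ne: "\<gamma> \<noteq> 0" using assms root_neq_0 by blast
  have nz: "\<exists>\<beta>\<in>\<Delta>. representation \<Delta> \<gamma> \<beta> \<noteq> 0"
  proof (rule ccontr)
    assume "\<not> ?thesis"
    then have "(\<Sum>\<beta>\<in>\<Delta>. representation \<Delta> \<gamma> \<beta> *\<^sub>R \<beta>) = 0" by (intro sum.neutral) auto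
    then show False using simple_system_expand[OF assms(1,3)] ne by simp
  qed
  consider "\<forall>\<beta>\<in>\<Delta>. 0 \<le> representation \<Delta> \<gamma> \<beta>" | "\<forall>\<beta>\<in>\<Delta>. representation \<Delta> \<gamma> \<beta> \<le> 0"
    using assms unfolding simple_system_def by blast
  then have "(\<gamma> \<in> pos_roots \<Phi> \<Delta> \<longleftrightarrow> 0 < height \<Delta> \<gamma>) \<and> height \<Delta> \<gamma> \<noteq> 0"
  proof cases
    case 1
    then have "\<gamma> \<in> pos_roots \<Phi> \<Delta>" using assms by (simp add: pos_roots_def)
    moreover have "0 < height \<Delta> \<gamma>"
      unfolding height_def using 1 nz fin by (metis less_eq_real_def sum_pos2)
    ultimately show ?thesis by simp
  next
    case 2
    obtain \<beta> where b: "\<beta> \<in> \<Delta>" "representation \<Delta> \<gamma> \<beta> < 0" using 2 nz by force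
    then have "\<gamma> \<notin> pos_roots \<Phi> \<Delta>" by (force simp: pos_roots_def)
    moreover have "0 < (\<Sum>\<beta>\<in>\<Delta>. - representation \<Delta> \<gamma> \<beta>)"
      using 2 b fin by (intro sum_pos2[of _ \<beta>]) auto
    ultimately show ?thesis by (simp add: height_def sum_negf)
  qed
  then show "\<gamma> \<in> pos_roots \<Phi> \<Delta> \<longleftrightarrow> 0 < height \<Delta> \<gamma>" "height \<Delta> \<gamma> \<noteq> 0" by auto
qed

lemma height_functional_exists:
  assumes "simple_system \<Phi> \<Delta>"
  obtains h :: "'a::euclidean_space \<Rightarrow> real" where "linear h" "\<And>\<beta>. \<beta> \<in> \<Delta> \<Longrightarrow> h \<beta> = 1"
  using linear_independent_extend[of \<Delta> "\<lambda>_. 1 :: real"] assms unfolding simple_system_def by metis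

lemma neg_roots_iff:
  assumes "simple_system \<Phi> \<Delta>" "root_system \<Phi>" "\<gamma> \<in> \<Phi>"
  shows "\<gamma> \<in> neg_roots \<Phi> \<Delta> \<longleftrightarrow> \<gamma> \<notin> pos_roots \<Phi> \<Delta>"
proof -
  obtain h :: "'a \<Rightarrow> real" where h: "linear h" "\<And>\<beta>. \<beta> \<in> \<Delta> \<Longrightarrow> h \<beta> = 1"
    using height_functional_exists[OF assms(1)] by metis
  have *: "\<gamma> \<in> pos_roots \<Phi> \<Delta> \<longleftrightarrow> 0 < h \<gamma>" "h \<gamma> \<noteq> 0" if "\<gamma> \<in> \<Phi>" for \<gamma>
    using pos_roots_iff_height[OF assms(1,2) that] height_eq_linear[OF assms(1) that h] by auto
  have "\<gamma> \<in> neg_roots \<Phi> \<Delta> \<longleftrightarrow> - \<gamma> \<in> pos_roots \<Phi> \<Delta>"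
    unfolding neg_roots_def by (metis (no_types, lifting) image_iff minus_minus)
  also have "\<dots> \<longleftrightarrow> h \<gamma> < 0"
    using *(1)[of "- \<gamma>"] root_system_uminus[OF assms(2,3)] linear_neg[OF h(1)] by simp
  finally show ?thesis using *[OF assms(3)] by auto
qed

lemma uminus_pos_roots:
  assumes "simple_system \<Phi> \<Delta>" "root_system \<Phi>" "\<gamma> \<in> \<Phi>"
  shows "- \<gamma> \<in> pos_roots \<Phi> \<Delta> \<longleftrightarrow> \<gamma> \<notin> pos_roots \<Phi> \<Delta>"
  using neg_roots_iff[OF assms] unfolding neg_roots_def by (metis (no_types, lifting) image_iff minus_minus)

text \<open>The reflection changes only the coefficient at \<alpha>, and a positive root other than
  \<alpha> has a positive coefficient elsewhere.\<close>

lemma reflection_simple_pos: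
  assumes ss: "simple_system \<Phi> \<Delta>" and rs: "root_system \<Phi>" and \<alpha>: "\<alpha> \<in> \<Delta>"
    and \<gamma>: "\<gamma> \<in> pos_roots \<Phi> \<Delta>" "\<gamma> \<noteq> \<alpha>"
  shows "reflection \<alpha> \<gamma> \<in> pos_roots \<Phi> \<Delta>"
proof -
  have \<Delta>: "\<Delta> \<subseteq> \<Phi>" "independent \<Delta>" "\<Phi> \<subseteq> span \<Delta>" using ss by (auto simp: simple_system_def)
  have \<gamma>': "\<gamma> \<in> \<Phi>" "\<And>\<beta>. \<beta> \<in> \<Delta> \<Longrightarrow> 0 \<le> representation \<Delta> \<gamma> \<beta>" using \<gamma> by (auto simp: pos_roots_def)
  have fin: "finite \<Delta>" by (rule simple_system_finite[OF ss])
  have "\<exists>\<beta>\<in>\<Delta>. \<beta> \<noteq> \<alpha> \<and> representation \<Delta> \<gamma> \<beta> \<noteq> 0"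
  proof (rule ccontr)
    assume "\<not> ?thesis"
    then have "(\<Sum>\<beta>\<in>\<Delta>. representation \<Delta> \<gamma> \<beta> *\<^sub>R \<beta>) = representation \<Delta> \<gamma> \<alpha> *\<^sub>R \<alpha>"
      using fin \<alpha> by (subst sum.remove[of _ \<alpha>]) (auto intro!: sum.neutral)
    then have eq: "\<gamma> = representation \<Delta> \<gamma> \<alpha> *\<^sub>R \<alpha>" using simple_system_expand[OF ss \<gamma>'(1)] by simp
    then have "\<gamma> \<in> span {\<alpha>}" by (metis insertI1 span_base span_scale)
    then have "\<gamma> \<in> {\<alpha>, - \<alpha>}" using rs \<alpha> \<Delta> \<gamma>' unfolding root_system_def by blast
    then have "\<gamma> = - \<alpha>" using \<gamma> by auto
    moreover have "\<alpha> \<in> pos_roots \<Phi> \<Delta>"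
      using \<alpha> \<Delta> by (auto simp: pos_roots_def representation_basis)
    ultimately show False using uminus_pos_roots[OF ss rs, of \<alpha>] \<gamma> \<alpha> \<Delta> by auto
  qed
  then obtain \<beta> where \<beta>: "\<beta> \<in> \<Delta>" "\<beta> \<noteq> \<alpha>" "0 < representation \<Delta> \<gamma> \<beta>" using \<gamma>'(2) by force
  define t where "t = 2 * (\<gamma> \<bullet> \<alpha>) / (\<alpha> \<bullet> \<alpha>)"
  have r: "reflection \<alpha> \<gamma> \<in> \<Phi>" using \<alpha> \<Delta> \<gamma>' rs root_system_reflection by blast
  have "representation \<Delta> (\<gamma> - t *\<^sub>R \<alpha>) \<beta> = representation \<Delta> \<gamma> \<beta>"
    using \<Delta> \<alpha> \<beta> \<gamma>' by (simp add: representation_diff representation_scale span_scale span_base representation_basis subsetD)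
  then have "0 < representation \<Delta> (reflection \<alpha> \<gamma>) \<beta>" using \<beta> by (simp add: reflection_def t_def)
  then have "\<not> (\<forall>\<beta>\<in>\<Delta>. representation \<Delta> (reflection \<alpha> \<gamma>) \<beta> \<le> 0)" using \<beta> by force
  then show ?thesis using r ss unfolding pos_roots_def simple_system_def by blast
qed

text \<open>The reflection matches the inversions of the two elements other than \<alpha>. So the
  lengths differ only by whether \<alpha> itself is inverted, and it is inverted by exactly one of
  the two.\<close>

lemma coxeter_length_reflection:
  assumes ss: "simple_system \<Phi> \<Delta>" and rs: "root_system \<Phi>" and \<alpha>: "\<alpha> \<in> \<Delta>" and w: "w \<in> weyl_group \<Phi>"
  shows "coxeter_length \<Phi> \<Delta> w < coxeter_length \<Phi> \<Delta> (w \<circ> reflection \<alpha>) \<longleftrightarrow> w \<alpha> \<in> pos_roots \<Phi> \<Delta>"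
proof -
  have \<Delta>: "\<Delta> \<subseteq> \<Phi>" "independent \<Delta>" using ss by (auto simp: simple_system_def)
  have \<alpha>\<Phi>: "\<alpha> \<in> \<Phi>" using \<alpha> \<Delta> by auto
  have \<alpha>0: "\<alpha> \<noteq> 0" using root_neq_0[OF rs \<alpha>\<Phi>] .
  have \<alpha>p: "\<alpha> \<in> pos_roots \<Phi> \<Delta>" using \<alpha> \<Delta> by (auto simp: pos_roots_def representation_basis)
  define N where "N = (\<lambda>w. {\<gamma> \<in> pos_roots \<Phi> \<Delta>. w \<gamma> \<in> neg_roots \<Phi> \<Delta>})"
  have fin: "finite (N w)" for w
    using rs by (auto simp: N_def pos_roots_def root_system_def)
  have bij: "N (w \<circ> reflection \<alpha>) - {\<alpha>} = reflection \<alpha> ` (N w - {\<alpha>})"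
  proof (intro set_eqI iffI)
    fix \<gamma> assume g: "\<gamma> \<in> N (w \<circ> reflection \<alpha>) - {\<alpha>}"
    have "reflection \<alpha> \<gamma> \<noteq> \<alpha>"
    proof
      assume "reflection \<alpha> \<gamma> = \<alpha>"
      then have "\<gamma> = reflection \<alpha> \<alpha>" by (metis reflection_involutive)
      then show False using g reflection_self[OF \<alpha>0] uminus_pos_roots[OF ss rs \<alpha>\<Phi>] \<alpha>p by (auto simp: N_def)
    qed
    then have "reflection \<alpha> \<gamma> \<in> N w - {\<alpha>}"
      using g reflection_simple_pos[OF ss rs \<alpha>] by (auto simp: N_def)
    then show "\<gamma> \<in> reflection \<alpha> ` (N w - {\<alpha>})" by (metis imageI reflection_involutive)
  next
    fix \<gamma> assume "\<gamma> \<in> reflection \<alpha> ` (N w - {\<alpha>})"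
    then obtain \<delta> where d: "\<gamma> = reflection \<alpha> \<delta>" "\<delta> \<in> N w" "\<delta> \<noteq> \<alpha>" by auto
    then have "\<gamma> \<in> pos_roots \<Phi> \<Delta>" using reflection_simple_pos[OF ss rs \<alpha>] by (auto simp: N_def)
    moreover have "\<gamma> \<noteq> \<alpha>"
    proof
      assume "\<gamma> = \<alpha>"
      then have "\<delta> = reflection \<alpha> \<alpha>" using d by (metis reflection_involutive)
      then show False using d reflection_self[OF \<alpha>0] uminus_pos_roots[OF ss rs \<alpha>\<Phi>] \<alpha>p by (auto simp: N_def)
    qed
    ultimately show "\<gamma> \<in> N (w \<circ> reflection \<alpha>) - {\<alpha>}" using d by (auto simp: N_def)
  qed
  have "inj (reflection \<alpha>)" by (metis injI reflection_involutive)
  then have c: "card (N (w \<circ> reflection \<alpha>) - {\<alpha>}) = card (N w - {\<alpha>})"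
    unfolding bij by (intro card_image) (auto intro: inj_on_subset)
  have w\<alpha>: "w \<alpha> \<in> \<Phi>" using weyl_root[OF w rs \<alpha>\<Phi>] .
  have in1: "\<alpha> \<in> N w \<longleftrightarrow> w \<alpha> \<notin> pos_roots \<Phi> \<Delta>"
    using \<alpha>p neg_roots_iff[OF ss rs w\<alpha>] by (auto simp: N_def)
  have "w (- \<alpha>) = - w \<alpha>" using linear_weyl[OF w] by (rule linear_neg)
  then have in2: "\<alpha> \<in> N (w \<circ> reflection \<alpha>) \<longleftrightarrow> w \<alpha> \<in> pos_roots \<Phi> \<Delta>"
    using \<alpha>p neg_roots_iff[OF ss rs, of "- w \<alpha>"] uminus_pos_roots[OF ss rs w\<alpha>] root_system_uminus[OF rs w\<alpha>]
      reflection_self[OF \<alpha>0] by (auto simp: N_def)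
  have cl: "coxeter_length \<Phi> \<Delta> u = card (N u)" for u by (simp add: coxeter_length_def N_def)
  show ?thesis
    unfolding cl using c in1 in2 fin[of w] fin[of "w \<circ> reflection \<alpha>"] card_gt_0_iff[of "N w"]
      card_gt_0_iff[of "N (w \<circ> reflection \<alpha>)"]
    by (cases "w \<alpha> \<in> pos_roots \<Phi> \<Delta>") (auto simp: card_Diff_singleton_if split: if_splits)
qed

section \<open>Coordinates for root systems of type D\<close>

abbreviation signs :: "real set" where "signs \<equiv> {1, - 1}"

text \<open>An isomorphism with D_n need not be an isometry, so no inner products of the
  \<open>c k\<close> are prescribed; dual coordinates and the action of the reflections replace
  them. Order and signs of the \<open>c k\<close> are adapted to \<Delta>: the positive roots are
  c_j \<plusminus> c_i with i < j.\<close>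

locale root_frame =
  fixes n :: nat and \<Phi> \<Delta> :: "'a::euclidean_space set" and c :: "nat \<Rightarrow> 'a" and \<phi> :: "nat \<Rightarrow> 'a \<Rightarrow> real"
  assumes n2: "2 \<le> n"
    and linear_coord: "k < n \<Longrightarrow> linear (\<phi> k)"
    and dual: "i < n \<Longrightarrow> k < n \<Longrightarrow> \<phi> i (c k) = of_bool (i = k)"
    and roots: "\<Phi> = {a *\<^sub>R c i + b *\<^sub>R c j | i j a b. i < n \<and> j < n \<and> i \<noteq> j \<and> a \<in> signs \<and> b \<in> signs}"
    and reflection_c: "\<lbrakk>i < n; j < n; i \<noteq> j; s \<in> signs; k < n\<rbrakk> \<Longrightarrow>
      reflection (c j - s *\<^sub>R c i) (c k) = (if k = j then s *\<^sub>R c i else if k = i then s *\<^sub>R c j else c k)"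
    and pos: "pos_roots \<Phi> \<Delta> = {c j - s *\<^sub>R c i | i j s. i < j \<and> j < n \<and> s \<in> signs}"
    and ss: "simple_system \<Phi> \<Delta>" and rs: "root_system \<Phi>"
begin

text \<open>The diagram automorphism that exchanges the end nodes c_0 + c_1 and c_1 - c_0 of the
  fork, as a change of frame.\<close>

lemma flip: "root_frame n \<Phi> \<Delta> (c(0 := - c 0)) (\<phi>(0 := \<lambda>v. - \<phi> 0 v))"
proof (rule root_frame.intro)
  show "2 \<le> n" by (rule n2)
  show "simple_system \<Phi> \<Delta>" "root_system \<Phi>" by (rule ss rs)+
next
  fix k assume k: "k < n"
  show "linear ((\<phi>(0 := \<lambda>v. - \<phi> 0 v)) k)"
    using linear_coord[OF k] linear_coord[of 0] n2 by (auto intro: linear_compose_neg)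
next
  fix i k assume i: "i < n" and k: "k < n"
  show "(\<phi>(0 := \<lambda>v. - \<phi> 0 v)) i ((c(0 := - c 0)) k) = of_bool (i = k)"
  proof -
    have "\<phi> j (- v) = - \<phi> j v" if "j < n" for j v using linear_neg[OF linear_coord[OF that]] .
    then show ?thesis using dual k i by auto
  qed
next
  let ?e = "\<lambda>i. if i = 0 then - 1 else 1 :: real"
  have e: "(c(0 := - c 0)) i = ?e i *\<^sub>R c i" "?e i \<in> signs" "?e i * ?e i = 1" for i by auto
  have mult: "a * ?e i \<in> signs" if "a \<in> signs" for a i using that by auto
  show "\<Phi> = {a *\<^sub>R (c(0 := - c 0)) i + b *\<^sub>R (c(0 := - c 0)) j | i j a b. i < n \<and> j < n \<and> i \<noteq> j \<and> a \<in> signs \<and> b \<in> signs}"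
    (is "_ = ?R")
  proof (intro set_eqI iffI)
    fix \<gamma> assume "\<gamma> \<in> \<Phi>"
    then obtain a b i j where g: "\<gamma> = a *\<^sub>R c i + b *\<^sub>R c j" "i < n" "j < n" "i \<noteq> j" "a \<in> signs" "b \<in> signs"
      unfolding roots by blast
    have "\<gamma> = (a * ?e i) *\<^sub>R (c(0 := - c 0)) i + (b * ?e j) *\<^sub>R (c(0 := - c 0)) j" using g(1) by auto
    then show "\<gamma> \<in> ?R" using g mult[of a i] mult[of b j] by blast
  next
    fix \<gamma> assume "\<gamma> \<in> ?R"
    then obtain a b i j where g: "\<gamma> = a *\<^sub>R (c(0 := - c 0)) i + b *\<^sub>R (c(0 := - c 0)) j" "i < n" "j < n" "i \<noteq> j" "a \<in> signs" "b \<in> signs"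
      by blast
    have "\<gamma> = (a * ?e i) *\<^sub>R c i + (b * ?e j) *\<^sub>R c j" using g(1) by auto
    then show "\<gamma> \<in> \<Phi>" unfolding roots using g mult[of a i] mult[of b j] by blast
  qed
  show "pos_roots \<Phi> \<Delta> = {(c(0 := - c 0)) j - s *\<^sub>R (c(0 := - c 0)) i | i j s. i < j \<and> j < n \<and> s \<in> signs}"
    (is "_ = ?R")
  proof (intro set_eqI iffI)
    fix \<gamma> assume "\<gamma> \<in> pos_roots \<Phi> \<Delta>"
    then obtain i j s where g: "\<gamma> = c j - s *\<^sub>R c i" "i < j" "j < n" "s \<in> signs" unfolding pos by blast
    have "\<gamma> = (c(0 := - c 0)) j - (s * ?e i) *\<^sub>R (c(0 := - c 0)) i" using g(1,2) by auto
    then show "\<gamma> \<in> ?R" using g mult[of s i] by blast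
  next
    fix \<gamma> assume "\<gamma> \<in> ?R"
    then obtain i j s where g: "\<gamma> = (c(0 := - c 0)) j - s *\<^sub>R (c(0 := - c 0)) i" "i < j" "j < n" "s \<in> signs" by blast
    have "\<gamma> = c j - (s * ?e i) *\<^sub>R c i" using g(1,2) by auto
    then show "\<gamma> \<in> pos_roots \<Phi> \<Delta>" unfolding pos using g mult[of s i] by blast
  qed
next
  let ?e = "\<lambda>i. if i = 0 then - 1 else 1 :: real"
  have e: "(c(0 := - c 0)) i = ?e i *\<^sub>R c i" for i by auto
  fix i j k and s :: real assume *: "i < n" "j < n" "i \<noteq> j" "s \<in> signs" "k < n"
  \<comment> \<open>For j = 0 the root itself changes its sign, which its reflection does not
    notice.\<close>
  have r: "reflection ((c(0 := - c 0)) j - s *\<^sub>R (c(0 := - c 0)) i) = reflection (c j - (s * ?e i * ?e j) *\<^sub>R c i)"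
  proof (cases "j = 0")
    case True
    then have "(c(0 := - c 0)) j - s *\<^sub>R (c(0 := - c 0)) i = - (c j - (s * ?e i * ?e j) *\<^sub>R c i)"
      using * by auto
    then show ?thesis by (simp only: reflection_uminus)
  next
    case False
    then have "(c(0 := - c 0)) j - s *\<^sub>R (c(0 := - c 0)) i = c j - (s * ?e i * ?e j) *\<^sub>R c i" by auto
    then show ?thesis by simp
  qed
  have lin: "reflection v ((c(0 := - c 0)) k) = ?e k *\<^sub>R reflection v (c k)" for v
    using linear_scale[OF linear_reflection, of v "?e k" "c k"] e(1)[of k] by simp
  have sg: "s * ?e i * ?e j \<in> signs" using *(4) by auto
  show "reflection ((c(0 := - c 0)) j - s *\<^sub>R (c(0 := - c 0)) i) ((c(0 := - c 0)) k) =
      (if k = j then s *\<^sub>R (c(0 := - c 0)) i else if k = i then s *\<^sub>R (c(0 := - c 0)) j else (c(0 := - c 0)) k)"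
    unfolding r lin reflection_c[OF *(1-3) sg *(5)] using *(3) by auto
qed

lemma root_simps:
  "i < n \<Longrightarrow> j < n \<Longrightarrow> i \<noteq> j \<Longrightarrow> s \<in> signs \<Longrightarrow> c j - s *\<^sub>R c i \<in> \<Phi>"
  unfolding roots by (intro CollectI exI[of _ j] exI[of _ i] exI[of _ 1] exI[of _ "- s"]) auto

text \<open>Tail sums of coordinates are nonnegative on positive roots. All but the tail from k + 1
  vanish at c_(k+1) - c_k, hence at each simple root occurring in its expansion, and this leaves
  only the root itself.\<close>

lemma difference_simple:
  assumes k: "Suc k < n"
  shows "c (Suc k) - c k \<in> \<Delta>"
proof -
  define \<delta> where "\<delta> = c (Suc k) - 1 *\<^sub>R c k"
  define \<psi> where "\<psi> = (\<lambda>t v. \<Sum>i\<in>{t..<n}. \<phi> i v)"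
  have lin: "linear (\<psi> t)" for t
    unfolding \<psi>_def by (intro linear_compose_sum) (auto intro: linear_coord)
  have val: "\<psi> t (c j - s *\<^sub>R c i) = of_bool (t \<le> j) - s * of_bool (t \<le> i)" if "i < n" "j < n" for t s i j
  proof -
    have "\<psi> t (c m) = of_bool (t \<le> m)" if "m < n" for m
    proof -
      have "\<psi> t (c m) = (\<Sum>i\<in>{t..<n}. if i = m then 1 else 0)"
        unfolding \<psi>_def using that by (intro sum.cong) (auto simp: dual)
      then show ?thesis using that by (simp add: sum.delta')
    qed
    then show ?thesis using that by (simp add: linear_diff[OF lin] linear_scale[OF lin])
  qed
  have \<delta>pos: "\<delta> \<in> pos_roots \<Phi> \<Delta>"
    unfolding pos \<delta>_def using k by (intro CollectI exI[of _ k] exI[of _ "Suc k"] exI[of _ 1]) auto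
  then have \<delta>: "\<delta> \<in> \<Phi>" "\<And>\<beta>. \<beta> \<in> \<Delta> \<Longrightarrow> 0 \<le> representation \<Delta> \<delta> \<beta>" by (auto simp: pos_roots_def)
  have ex: "\<delta> = (\<Sum>\<beta>\<in>\<Delta>. representation \<Delta> \<delta> \<beta> *\<^sub>R \<beta>)" by (rule simple_system_expand[OF ss \<delta>(1)])
  have "\<delta> \<noteq> 0" using root_neq_0[OF rs \<delta>(1)] .
  then obtain \<beta> where \<beta>: "\<beta> \<in> \<Delta>" "representation \<Delta> \<delta> \<beta> \<noteq> 0"
    using ex by (metis (no_types, lifting) scaleR_eq_0_iff sum.neutral)
  have simple_pos: "\<gamma> \<in> pos_roots \<Phi> \<Delta>" if "\<gamma> \<in> \<Delta>" for \<gamma>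
    using that ss by (auto simp: pos_roots_def simple_system_def representation_basis)
  have nonneg: "0 \<le> \<psi> t \<gamma>" if g: "\<gamma> \<in> \<Delta>" for t \<gamma>
  proof -
    obtain i j s where "\<gamma> = c j - s *\<^sub>R c i" "i < j" "j < n" "s \<in> signs"
      using simple_pos[OF g] unfolding pos by blast
    then show ?thesis by (auto simp: val)
  qed
  have zero: "\<psi> t \<beta> = 0" if "t \<noteq> Suc k" for t
  proof -
    have "(\<Sum>\<gamma>\<in>\<Delta>. representation \<Delta> \<delta> \<gamma> * \<psi> t \<gamma>) = \<psi> t \<delta>"
      by (subst (2) ex) (simp add: linear_sum[OF lin] linear_scale[OF lin])
    also have "\<dots> = 0" unfolding \<delta>_def using that k by (subst val) (auto simp: le_Suc_eq)
    finally have "\<forall>\<gamma>\<in>\<Delta>. representation \<Delta> \<delta> \<gamma> * \<psi> t \<gamma> = 0"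
      using nonneg \<delta>(2) simple_system_finite[OF ss] by (subst (asm) sum_nonneg_eq_0_iff) auto
    then show ?thesis using \<beta> by auto
  qed
  obtain i j s where b: "\<beta> = c j - s *\<^sub>R c i" "i < j" "j < n" "s \<in> signs"
    using simple_pos[OF \<beta>(1)] unfolding pos by blast
  \<comment> \<open>For \<beta> = c_j - s c_i the tails from j, 0 and i + 1 have the values 1, 1 - s
    and 1. Vanishing of all tails but one determines j, s and i in turn.\<close>
  have j: "j = Suc k" using zero[of j] b by (auto simp: val)
  have s: "s = 1" using zero[of 0] b by (auto simp: val)
  have "i = k" using zero[of "Suc i"] b j by (auto simp: val)
  then show ?thesis using b j s \<beta> by simp
qed

lemma sum_simple: "c 0 + c 1 \<in> \<Delta>"
proof -
  interpret F: root_frame n \<Phi> \<Delta> "c(0 := - c 0)" "\<phi>(0 := \<lambda>v. - \<phi> 0 v)" by (rule flip)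
  show ?thesis using F.difference_simple[of 0] n2 by (simp add: add.commute)
qed

definition adjacent_roots where "adjacent_roots = insert (c 0 + c 1) {c (Suc k) - c k | k. Suc k < n}"

lemma c_in_span: assumes "k < n" shows "c k \<in> span adjacent_roots"
  using assms
proof (induction k)
  case 0
  have "c 0 + c 1 \<in> span adjacent_roots" "c 1 - c 0 \<in> span adjacent_roots"
    using n2 by (auto simp: adjacent_roots_def intro!: span_base exI[of _ 0])
  then have "(1/2) *\<^sub>R ((c 0 + c 1) - (c 1 - c 0)) \<in> span adjacent_roots" by (rule span_scale[OF span_diff])
  also have "(1/2) *\<^sub>R ((c 0 + c 1) - (c 1 - c 0)) = c 0" by (simp add: scaleR_2[symmetric])
  finally show ?case .
next
  case (Suc k)
  have "c (Suc k) - c k \<in> span adjacent_roots" using Suc by (auto simp: adjacent_roots_def intro!: span_base)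
  then have "(c (Suc k) - c k) + c k \<in> span adjacent_roots" using Suc by (intro span_add) auto
  then show ?case by simp
qed

text \<open>The simple roots found so far span all roots, so independence of \<Delta> leaves no room
  for another one.\<close>

lemma simple_roots: "\<Delta> = insert (c 0 + c 1) {c (Suc k) - c k | k. Suc k < n}"
proof -
  have sub: "adjacent_roots \<subseteq> \<Delta>" using difference_simple sum_simple by (auto simp: adjacent_roots_def)
  moreover have "\<Delta> \<subseteq> adjacent_roots"
  proof
    fix \<beta> assume \<beta>: "\<beta> \<in> \<Delta>"
    show "\<beta> \<in> adjacent_roots"
    proof (rule ccontr)
      assume "\<beta> \<notin> adjacent_roots"
      then have "span adjacent_roots \<subseteq> span (\<Delta> - {\<beta>})" using sub by (intro span_mono) auto
      moreover have "\<beta> \<in> \<Phi>" using \<beta> ss by (auto simp: simple_system_def)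
      then have "\<beta> \<in> span adjacent_roots" unfolding roots using c_in_span by (auto intro!: span_add span_scale span_diff)
      ultimately show False using \<beta> ss by (auto simp: simple_system_def dependent_def)
    qed
  qed
  ultimately show ?thesis by (auto simp: adjacent_roots_def)
qed

lemma span_roots: "span \<Phi> = span (c ` {..<n})"
proof
  show "span \<Phi> \<subseteq> span (c ` {..<n})"
  proof (intro span_minimal subspace_span)
    have "c i \<in> span (c ` {..<n})" if "i < n" for i using that by (intro span_base) auto
    then show "\<Phi> \<subseteq> span (c ` {..<n})" unfolding roots by (auto intro!: span_add span_diff span_neg)
  qed
  have "adjacent_roots \<subseteq> \<Phi>" using ss unfolding adjacent_roots_def simple_roots[symmetric] by (simp add: simple_system_def)
  then have "c ` {..<n} \<subseteq> span \<Phi>" using c_in_span span_mono[of adjacent_roots \<Phi>] by auto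
  then show "span (c ` {..<n}) \<subseteq> span \<Phi>" by (intro span_minimal subspace_span)
qed

end

section \<open>Existence of adapted coordinates\<close>

lemma cartan_number_linear:
  "cartan_number (r *\<^sub>R u + v) \<beta> = r * cartan_number u \<beta> + cartan_number v \<beta>"
  by (simp add: cartan_number_def inner_add_left add_divide_distrib distrib_left)

text \<open>The preimages of the unit vectors are sorted by the absolute value of their height and
  signed so that the height is nonnegative. Then c_j \<plusminus> c_i has positive height whenever i
  < j.\<close>

lemma root_frame_exists:
  fixes \<Phi> \<Delta> :: "'a::euclidean_space set"
  assumes rs: "root_system \<Phi>" and ne: "\<Phi> \<noteq> {}"
    and iso: "root_iso \<Phi> (D_roots :: (real ^ 'n) set)" and ss: "simple_system \<Phi> \<Delta>"
  obtains c \<phi> where "root_frame CARD('n) \<Phi> \<Delta> c \<phi>"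
proof -
  define n where "n = CARD('n)"
  obtain f :: "'a \<Rightarrow> real ^ 'n" where f: "linear f" "inj_on f (span \<Phi>)" "f ` \<Phi> = D_roots"
    and cn: "\<And>\<alpha> \<beta>. \<alpha> \<in> \<Phi> \<Longrightarrow> \<beta> \<in> \<Phi> \<Longrightarrow> cartan_number (f \<alpha>) (f \<beta>) = cartan_number \<alpha> \<beta>"
    using iso unfolding root_iso_def by blast
  have "(D_roots :: (real ^ 'n) set) \<noteq> {}" using ne f(3) by auto
  then obtain i0 j0 :: 'n where ij0: "i0 \<noteq> j0" unfolding D_roots_def by blast
  have n2: "2 \<le> n" unfolding n_def using ij0 card_mono[of UNIV "{i0, j0}"] by auto
  have ax_span: "axis i 1 \<in> span (D_roots :: (real ^ 'n) set)" for i :: 'n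
  proof -
    obtain j :: 'n where j: "i \<noteq> j" using ij0 by metis
    have "axis i 1 + axis j 1 \<in> (D_roots :: (real ^ 'n) set)" "axis i 1 + axis j (-1) \<in> (D_roots :: (real ^ 'n) set)"
      unfolding D_roots_def using j by blast+
    then have "(1/2) *\<^sub>R ((axis i 1 + axis j 1) + (axis i 1 + axis j (-1))) \<in> span (D_roots :: (real ^ 'n) set)"
      by (intro span_scale[OF span_add] span_base)
    also have "(1/2) *\<^sub>R ((axis i 1 + axis j 1) + (axis i 1 + axis j (-1))) = (axis i 1 :: real ^ 'n)"
      by (simp add: vec_eq_iff axis_def)
    finally show ?thesis .
  qed
  have "\<exists>v. v \<in> span \<Phi> \<and> f v = axis i 1" for i :: 'n
    using ax_span[of i] f(3) linear_span_image[OF f(1), of \<Phi>] by (metis imageE)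
  then obtain e where e: "\<And>i. e i \<in> span \<Phi>" "\<And>i. f (e i) = axis i 1" by metis
  obtain h :: "'a \<Rightarrow> real" where h: "linear h" "\<And>\<beta>. \<beta> \<in> \<Delta> \<Longrightarrow> h \<beta> = 1"
    using height_functional_exists[OF ss] by metis
  have hpos: "\<gamma> \<in> pos_roots \<Phi> \<Delta> \<longleftrightarrow> 0 < h \<gamma>" "h \<gamma> \<noteq> 0" if "\<gamma> \<in> \<Phi>" for \<gamma>
    using pos_roots_iff_height[OF ss rs that] height_eq_linear[OF ss that h] by auto
  have f_eq: "v = u \<longleftrightarrow> f v = f u" if "v \<in> span \<Phi>" "u \<in> span \<Phi>" for v u
    using f(2) that by (auto dest: inj_onD)
  have axis_scale: "axis i a = a *\<^sub>R (axis i 1 :: real ^ 'n)" for i a by (simp add: vec_eq_iff axis_def)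
  have root_iff: "v \<in> \<Phi> \<longleftrightarrow> f v \<in> D_roots" if "v \<in> span \<Phi>" for v
  proof
    assume "f v \<in> D_roots"
    then obtain u where "u \<in> \<Phi>" "f u = f v" using f(3) by (metis imageE)
    then show "v \<in> \<Phi>" using f_eq[OF that, of u] by (simp add: span_base)
  qed (use f(3) in auto)
  have e_root: "a *\<^sub>R e i + b *\<^sub>R e j \<in> \<Phi>" if "i \<noteq> j" "a \<in> signs" "b \<in> signs" for i j a b
  proof -
    have "f (a *\<^sub>R e i + b *\<^sub>R e j) = axis i a + axis j b"
      by (simp add: linear_add[OF f(1)] linear_scale[OF f(1)] e axis_scale[of i a] axis_scale[of j b])
    also have "\<dots> \<in> D_roots" unfolding D_roots_def using that by blast
    finally show ?thesis by (subst root_iff) (auto intro!: span_add span_scale e)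
  qed
  \<comment> \<open>Equal absolute values would give e_i + e_j or e_i - e_j height 0, which no root
    has.\<close>
  have "inj (\<lambda>i. \<bar>h (e i)\<bar>)"
  proof (rule injI, rule ccontr)
    fix i j assume *: "\<bar>h (e i)\<bar> = \<bar>h (e j)\<bar>" "i \<noteq> j"
    have "h (1 *\<^sub>R e i + 1 *\<^sub>R e j) \<noteq> 0" "h (1 *\<^sub>R e i + (- 1) *\<^sub>R e j) \<noteq> 0"
      using *(2) by (intro hpos(2) e_root; simp)+
    then show False using *(1) by (simp add: linear_add[OF h(1)] linear_neg[OF h(1)] linear_diff[OF h(1)] abs_if split: if_splits)
  qed
  then have bij1: "bij_betw (\<lambda>i. \<bar>h (e i)\<bar>) UNIV (range (\<lambda>i. \<bar>h (e i)\<bar>))" by (simp add: bij_betw_def)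
  then have card: "card (range (\<lambda>i. \<bar>h (e i)\<bar>)) = n" unfolding n_def by (metis bij_betw_same_card)
  define \<rho> where "\<rho> = (\<lambda>k. sorted_list_of_set (range (\<lambda>i. \<bar>h (e i)\<bar>)) ! k)"
  have \<rho>_less: "\<rho> i < \<rho> j" if "i < j" "j < n" for i j
    unfolding \<rho>_def using that card
    by (intro sorted_wrt_nth_less[of "(<)"]) auto
  have \<rho>_in: "\<rho> k \<in> range (\<lambda>i. \<bar>h (e i)\<bar>)" if "k < n" for k
    unfolding \<rho>_def using that card nth_mem[of k "sorted_list_of_set (range (\<lambda>i. \<bar>h (e i)\<bar>))"] by simp
  define \<sigma> where "\<sigma> = (\<lambda>k. SOME i. \<bar>h (e i)\<bar> = \<rho> k)"
  have \<sigma>: "\<bar>h (e (\<sigma> k))\<bar> = \<rho> k" if k: "k < n" for k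
  proof -
    obtain i where "\<bar>h (e i)\<bar> = \<rho> k" using \<rho>_in[OF k] by (metis rangeE)
    then show ?thesis unfolding \<sigma>_def by (rule someI)
  qed
  have \<sigma>_inj: "inj_on \<sigma> {..<n}"
  proof (rule inj_onI)
    fix i j assume "i \<in> {..<n}" "j \<in> {..<n}" "\<sigma> i = \<sigma> j"
    then show "i = j" using \<sigma>[of i] \<sigma>[of j] \<rho>_less[of i j] \<rho>_less[of j i] by (cases i j rule: linorder_cases) auto
  qed
  have \<sigma>_eq: "\<sigma> i = \<sigma> j \<longleftrightarrow> i = j" if "i < n" "j < n" for i j
    using \<sigma>_inj that by (auto dest: inj_onD)
  have \<sigma>_surj: "\<sigma> ` {..<n} = UNIV"
    using \<sigma>_inj by (intro card_subset_eq) (auto simp: card_image n_def)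
  \<comment> \<open>A vector of height 0 may take either sign; the choice is 1, and
    \<open>flip\<close> yields the other one.\<close>
  define \<epsilon> where "\<epsilon> = (\<lambda>k. if h (e (\<sigma> k)) < 0 then - 1 else 1 :: real)"
  have \<epsilon>: "\<epsilon> k \<in> signs" "\<epsilon> k * \<epsilon> k = 1" "\<epsilon> k * (\<epsilon> k * r) = r" for k r by (auto simp: \<epsilon>_def)
  have sg: "a * \<epsilon> k \<in> signs" if "a \<in> signs" for a k using that by (auto simp: \<epsilon>_def)
  define c where "c = (\<lambda>k. \<epsilon> k *\<^sub>R e (\<sigma> k))"
  define \<phi> where "\<phi> = (\<lambda>k v. f v \<bullet> axis (\<sigma> k) (\<epsilon> k))"
  have c_span: "c k \<in> span \<Phi>" for k by (simp add: c_def e span_scale)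
  have fc: "f (c k) = axis (\<sigma> k) (\<epsilon> k)" for k by (simp add: c_def linear_scale[OF f(1)] e axis_scale[of "\<sigma> k" "\<epsilon> k"])
  have ip: "f (c i) \<bullet> f (c j) = of_bool (i = j)" if "i < n" "j < n" for i j
    unfolding fc using that \<epsilon> by (simp add: inner_axis_axis \<sigma>_eq)
  have roots: "\<Phi> = {a *\<^sub>R c i + b *\<^sub>R c j | i j a b. i < n \<and> j < n \<and> i \<noteq> j \<and> a \<in> signs \<and> b \<in> signs}" (is "_ = ?R")
  proof (intro set_eqI iffI)
    fix \<gamma> assume \<gamma>: "\<gamma> \<in> \<Phi>"
    then have "f \<gamma> \<in> D_roots" using f(3) by auto
    then obtain i j a b where 1: "f \<gamma> = axis i a + axis j b" "i \<noteq> j" "a \<in> signs" "b \<in> signs"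
      unfolding D_roots_def by blast
    obtain i' j' where 2: "i = \<sigma> i'" "i' < n" "j = \<sigma> j'" "j' < n" using \<sigma>_surj by (metis UNIV_I imageE lessThan_iff)
    have "\<gamma> = (a * \<epsilon> i') *\<^sub>R c i' + (b * \<epsilon> j') *\<^sub>R c j'"
    proof (subst f_eq)
      have "f ((a * \<epsilon> i') *\<^sub>R c i' + (b * \<epsilon> j') *\<^sub>R c j')
         = (a * (\<epsilon> i' * \<epsilon> i')) *\<^sub>R axis i 1 + (b * (\<epsilon> j' * \<epsilon> j')) *\<^sub>R axis j 1"
        by (simp add: linear_add[OF f(1)] linear_scale[OF f(1)] fc 2 axis_scale[of _ "\<epsilon> _"] mult.assoc)
      then show "f \<gamma> = f ((a * \<epsilon> i') *\<^sub>R c i' + (b * \<epsilon> j') *\<^sub>R c j')"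
        unfolding 1 \<epsilon>(2) axis_scale[of i a] axis_scale[of j b] by simp
    qed (use \<gamma> in \<open>simp_all add: span_base span_add span_scale c_span\<close>)
    moreover have "i' \<noteq> j'" using 1 2 by auto
    ultimately show "\<gamma> \<in> ?R" using 1 2 sg[of a i'] sg[of b j'] by blast
  next
    fix \<gamma> assume "\<gamma> \<in> ?R"
    then obtain i j a b where 1: "\<gamma> = a *\<^sub>R c i + b *\<^sub>R c j" "i < n" "j < n" "i \<noteq> j" "a \<in> signs" "b \<in> signs" by blast
    have "\<gamma> = (a * \<epsilon> i) *\<^sub>R e (\<sigma> i) + (b * \<epsilon> j) *\<^sub>R e (\<sigma> j)" using 1(1) by (simp add: c_def)
    then show "\<gamma> \<in> \<Phi>" using e_root[of "\<sigma> i" "\<sigma> j" "a * \<epsilon> i" "b * \<epsilon> j"] 1 sg \<sigma>_eq by auto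
  qed
  have hc: "h (c k) = \<rho> k" "0 \<le> \<rho> k" if "k < n" for k
    using \<sigma>[OF that] by (auto simp: c_def \<epsilon>_def linear_scale[OF h(1)] linear_neg[OF h(1)])
  have "root_frame n \<Phi> \<Delta> c \<phi>"
  proof (rule root_frame.intro)
    show "2 \<le> n" by (rule n2)
    show "linear (\<phi> k)" for k
      unfolding \<phi>_def by (rule linearI) (simp_all add: linear_add[OF f(1)] linear_scale[OF f(1)] inner_add_left)
    show "\<phi> i (c k) = of_bool (i = k)" if "i < n" "k < n" for i k
      using ip[OF that(2,1)] unfolding \<phi>_def fc by (simp add: eq_commute)
    show "\<Phi> = {a *\<^sub>R c i + b *\<^sub>R c j | i j a b. i < n \<and> j < n \<and> i \<noteq> j \<and> a \<in> signs \<and> b \<in> signs}" by (rule roots)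
    show "simple_system \<Phi> \<Delta>" "root_system \<Phi>" by (rule ss rs)+
    show "reflection (c j - s *\<^sub>R c i) (c k) = (if k = j then s *\<^sub>R c i else if k = i then s *\<^sub>R c j else c k)"
      if *: "i < n" "j < n" "i \<noteq> j" "s \<in> signs" "k < n" for i j s k
    proof -
      define \<alpha> where "\<alpha> = c j - s *\<^sub>R c i"
      have \<alpha>: "\<alpha> \<in> \<Phi>" unfolding roots \<alpha>_def
        using * by (intro CollectI exI[of _ j] exI[of _ i] exI[of _ 1] exI[of _ "- s"]) auto
      \<comment> \<open>The \<open>c k\<close> are not roots. Linearity in the first argument
        extends the preserved Cartan numbers from the roots to their span.\<close>
      have "cartan_number v \<alpha> = cartan_number (f v) (f \<alpha>)" if "v \<in> span \<Phi>" for v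
        using that
      proof (induction rule: span_induct_alt)
        case base
        then show ?case by (simp add: cartan_number_def linear_0[OF f(1)])
      next
        case (step r u v)
        show ?case using step cn[OF _ \<alpha>] by (simp add: cartan_number_linear linear_add[OF f(1)] linear_scale[OF f(1)])
      qed
      then have "cartan_number (c k) \<alpha> = cartan_number (f (c k)) (f \<alpha>)" using c_span by blast
      also have "f \<alpha> = f (c j) - s *\<^sub>R f (c i)" by (simp add: \<alpha>_def linear_diff[OF f(1)] linear_scale[OF f(1)])
      also have "cartan_number (f (c k)) \<dots> = of_bool (k = j) - s * of_bool (k = i)"
        using * by (auto simp: cartan_number_def inner_diff_left inner_diff_right ip)
      finally have "reflection \<alpha> (c k) = c k - (of_bool (k = j) - s * of_bool (k = i)) *\<^sub>R \<alpha>"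
        by (simp add: reflection_def cartan_number_def)
      then show ?thesis unfolding \<alpha>_def[symmetric] using * by (auto simp: \<alpha>_def)
    qed
    show "pos_roots \<Phi> \<Delta> = {c j - s *\<^sub>R c i | i j s. i < j \<and> j < n \<and> s \<in> signs}" (is "_ = ?P")
    proof (intro set_eqI iffI)
      fix \<gamma> assume g: "\<gamma> \<in> pos_roots \<Phi> \<Delta>"
      then have \<gamma>: "\<gamma> \<in> \<Phi>" by (simp add: pos_roots_def)
      then have hg: "0 < h \<gamma>" using hpos g by blast
      have "\<exists>i j a b. \<gamma> = a *\<^sub>R c i + b *\<^sub>R c j \<and> i < j \<and> j < n \<and> a \<in> signs \<and> b \<in> signs"
      proof -
        obtain i j a b where 1: "\<gamma> = a *\<^sub>R c i + b *\<^sub>R c j" "i < n" "j < n" "i \<noteq> j" "a \<in> signs" "b \<in> signs"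
          using \<gamma> unfolding roots by blast
        show ?thesis
        proof (cases "i < j")
          case False
          then have "\<gamma> = b *\<^sub>R c j + a *\<^sub>R c i" "j < i" using 1 by auto
          then show ?thesis using 1 by blast
        qed (use 1 in blast)
      qed
      then obtain i j a b where 1: "\<gamma> = a *\<^sub>R c i + b *\<^sub>R c j" "i < j" "j < n" "a \<in> signs" "b \<in> signs" by blast
      have "h \<gamma> = a * \<rho> i + b * \<rho> j" using 1 hc by (simp add: linear_add[OF h(1)] linear_scale[OF h(1)])
      then have "b = 1" using hg \<rho>_less[of i j] hc(2)[of i] hc(2)[of j] 1 by auto
      then have "\<gamma> = c j - (- a) *\<^sub>R c i" using 1 by simp
      moreover have "- a \<in> signs" using 1 by auto
      ultimately show "\<gamma> \<in> ?P" using 1 by blast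
    next
      fix \<gamma> assume "\<gamma> \<in> ?P"
      then obtain i j s where 1: "\<gamma> = c j - s *\<^sub>R c i" "i < j" "j < n" "s \<in> signs" by blast
      have "\<gamma> \<in> \<Phi>" unfolding roots 1(1)
        using 1 by (intro CollectI exI[of _ j] exI[of _ i] exI[of _ 1] exI[of _ "- s"]) auto
      moreover have "h \<gamma> = \<rho> j - s * \<rho> i" using 1 hc by (simp add: linear_diff[OF h(1)] linear_scale[OF h(1)])
      then have "0 < h \<gamma>" using \<rho>_less[of i j] hc(2)[of i] 1 by auto
      ultimately show "\<gamma> \<in> pos_roots \<Phi> \<Delta>" using hpos by blast
    qed
  qed
  then show ?thesis using that unfolding n_def by blast
qed

section \<open>The Weyl group and signed arrangements\<close>

lemma weight_snoc: "weight x (as @ [a]) = weight x as * (\<Prod>b\<leftarrow>as. pair_weight x b a)"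
  using weight_insert[of x as a "[]"] by simp

lemma weight_conv_prod:
  "weight x xs = (\<Prod>j<length xs. \<Prod>i<j. pair_weight x (xs ! i) (xs ! j))"
proof (induction xs rule: rev_induct)
  case (snoc a as)
  have "(\<Prod>b\<leftarrow>as. pair_weight x b a) = (\<Prod>i<length as. pair_weight x (as ! i) a)"
    by (simp add: prod.list_conv_set_nth atLeast0LessThan)
  then show ?case by (simp add: weight_snoc snoc nth_append)
qed simp

lemma alt_nth: "i < l \<Longrightarrow> alt s l ! i = (s = even i)"
proof (induction l arbitrary: s i)
  case (Suc l)
  then show ?case by (cases i) auto
qed simp

text \<open>The Weyl group only yields arrangements with an even number of negative entries. Changing the
  sign of the entry \<open>\<plusminus>1\<close> affects no comparison, so summing over all arrangements
  doubles the sum over the group.\<close>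

definition negate_one :: "int \<Rightarrow> int" where
  "negate_one y = (if \<bar>y\<bar> = 1 then - y else y)"

lemma negate_one_simps [simp]: "negate_one (negate_one y) = y" "\<bar>negate_one y\<bar> = \<bar>y\<bar>"
  "negate_one (- y) = - negate_one y"
  by (auto simp: negate_one_def)

text \<open>Of two different absolute values the larger decides all comparisons, and that one is not
  1.\<close>

lemma negate_one_compare:
  assumes "\<bar>y\<bar> \<noteq> \<bar>z\<bar>" "y \<noteq> 0" "z \<noteq> 0"
  shows "negate_one y < negate_one z \<longleftrightarrow> y < z" "0 < negate_one y + negate_one z \<longleftrightarrow> 0 < y + z"
    "pair_inv (negate_one y) (negate_one z) = pair_inv y z"
  using assms by (auto simp: negate_one_def pair_inv_def)

lemma signed_perms_nth:
  assumes "v \<in> signed_perms n" "i < n" "j < n" "i \<noteq> j"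
  shows "\<bar>v ! i\<bar> \<noteq> \<bar>v ! j\<bar>"
  using signed_perms_distinct[OF assms(1)] assms by (auto simp: signed_perms_def distinct_conv_nth)

lemma signed_perms_nth_nonzero: "v \<in> signed_perms n \<Longrightarrow> i < n \<Longrightarrow> v ! i \<noteq> 0"
  using signed_perms_abs[of v n "v ! i"] by (auto simp: signed_perms_def)

lemma negate_one_signed_perms [simp]: "map negate_one v \<in> signed_perms n \<longleftrightarrow> v \<in> signed_perms n"
  by (simp add: signed_perms_def image_image)

lemma signed_perms_append_iff:
  "A @ y # B \<in> signed_perms n \<Longrightarrow> \<bar>y\<bar> \<notin> abs ` set A \<and> \<bar>y\<bar> \<notin> abs ` set B"
  by (drule signed_perms_distinct) auto

text \<open>Exactly one entry has absolute value 1. The sign product thus separates arrangements of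
  group elements from their images under \<open>negate_one\<close>.\<close>

lemma sgn_negate_one:
  assumes v: "v \<in> signed_perms n" and n: "0 < n"
  shows "(\<Prod>y\<leftarrow>map negate_one v. sgn y) = - (\<Prod>y\<leftarrow>v. sgn y)"
proof -
  have "1 \<in> abs ` set v" using v n by (auto simp: signed_perms_def)
  then obtain y where "y \<in> set v" "\<bar>y\<bar> = 1" by auto
  then obtain A B where AB: "v = A @ y # B" by (meson split_list)
  have *: "\<bar>y\<bar> \<notin> abs ` set A \<and> \<bar>y\<bar> \<notin> abs ` set B" using signed_perms_append_iff v AB by blast
  have "map negate_one A = A" "map negate_one B = B"
    using * \<open>\<bar>y\<bar> = 1\<close> by (auto intro!: map_idI simp: negate_one_def)
  then show ?thesis using \<open>\<bar>y\<bar> = 1\<close> by (simp add: AB) (simp add: negate_one_def sgn_minus)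
qed

lemma weight_negate_one:
  assumes v: "v \<in> signed_perms n" and cs: "length cs = n"
  shows "weight x (zip cs (map negate_one v)) = weight x (zip cs v)"
proof -
  have len: "length v = n" using v by (simp add: signed_perms_def)
  have "pair_inv (negate_one (v ! i)) (negate_one (v ! j)) = pair_inv (v ! i) (v ! j)" if "i < j" "j < n" for i j
    using that signed_perms_nth[OF v, of i j] signed_perms_nth_nonzero[OF v]
    by (intro negate_one_compare) auto
  then show ?thesis
    unfolding weight_conv_prod using len cs by (intro prod.cong) (auto simp: pair_weight_def)
qed

section \<open>Group elements as signed permutations of the coordinate vectors\<close>

context root_frame
begin

definition ht :: "'a \<Rightarrow> real" where "ht v = (\<Sum>k<n. real k * \<phi> k v)"
text \<open>\<open>ht\<close> sends \<open>c 0\<close> to 0 and would lose the sign of the image of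
  a vector that lands there. The shift by one produces the values \<plusminus>1, ..., \<plusminus>n
  and keeps the sign at every root.\<close>

definition shifted_ht :: "'a \<Rightarrow> real" where "shifted_ht v = (\<Sum>k<n. (real k + 1) * \<phi> k v)"

lemma linear_coord_mult: "k < n \<Longrightarrow> linear (\<lambda>v. a * \<phi> k v)"
  using linear_compose_scale_right[OF linear_coord, of k a] by simp

lemma linear_ht: "linear ht" and linear_shifted_ht: "linear shifted_ht"
  unfolding ht_def[abs_def] shifted_ht_def[abs_def] by (auto intro!: linear_compose_sum linear_coord_mult)

lemma ht_c: "k < n \<Longrightarrow> ht (c k) = real k"
proof -
  assume "k < n"
  then have "ht (c k) = (\<Sum>i<n. if i = k then real k else 0)"
    unfolding ht_def by (intro sum.cong) (auto simp: dual)
  then show ?thesis using \<open>k < n\<close> by simp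
qed

lemma shifted_ht_c: "k < n \<Longrightarrow> shifted_ht (c k) = real k + 1"
proof -
  assume "k < n"
  then have "shifted_ht (c k) = (\<Sum>i<n. if i = k then real k + 1 else 0)"
    unfolding shifted_ht_def by (intro sum.cong) (auto simp: dual)
  then show ?thesis using \<open>k < n\<close> by simp
qed

lemma height_root: "\<gamma> \<in> \<Phi> \<Longrightarrow> height \<Delta> \<gamma> = ht \<gamma>"
proof (rule height_eq_linear[OF ss _ linear_ht])
  fix \<beta> assume "\<beta> \<in> \<Delta>"
  then consider "\<beta> = c 0 + c 1" | k where "\<beta> = c (Suc k) - c k" "Suc k < n"
    using simple_roots by auto
  then show "ht \<beta> = 1"
    using n2 by cases (auto simp: linear_add[OF linear_ht] linear_diff[OF linear_ht] ht_c)
qed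

lemma pos_root_iff: "\<gamma> \<in> \<Phi> \<Longrightarrow> \<gamma> \<in> pos_roots \<Phi> \<Delta> \<longleftrightarrow> 0 < ht \<gamma>"
  using pos_roots_iff_height(1)[OF ss rs] height_root by simp

text \<open>The term with the larger index decides the sign, with or without the shift.\<close>

lemma two_term_root:
  assumes "i < n" "j < n" "i \<noteq> j" "a \<in> signs" "b \<in> signs"
  shows "a *\<^sub>R c j - b *\<^sub>R c i \<in> \<Phi>"
    and "a *\<^sub>R c j - b *\<^sub>R c i \<in> pos_roots \<Phi> \<Delta> \<longleftrightarrow> 0 < shifted_ht (a *\<^sub>R c j - b *\<^sub>R c i)"
    and "shifted_ht (a *\<^sub>R c j - b *\<^sub>R c i) \<noteq> 0"
proof -
  have "- b \<in> signs" using assms by auto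
  then have "a *\<^sub>R c j + (- b) *\<^sub>R c i \<in> \<Phi>" unfolding roots using assms by blast
  then show r: "a *\<^sub>R c j - b *\<^sub>R c i \<in> \<Phi>" by simp
  have h: "ht (a *\<^sub>R c j - b *\<^sub>R c i) = a * real j - b * real i"
    "shifted_ht (a *\<^sub>R c j - b *\<^sub>R c i) = a * (real j + 1) - b * (real i + 1)"
    using assms by (simp_all add: linear_diff[OF linear_ht] linear_scale[OF linear_ht]
        linear_diff[OF linear_shifted_ht] linear_scale[OF linear_shifted_ht] ht_c shifted_ht_c)
  show "a *\<^sub>R c j - b *\<^sub>R c i \<in> pos_roots \<Phi> \<Delta> \<longleftrightarrow> 0 < shifted_ht (a *\<^sub>R c j - b *\<^sub>R c i)"
    "shifted_ht (a *\<^sub>R c j - b *\<^sub>R c i) \<noteq> 0"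
    unfolding pos_root_iff[OF r] h using assms by auto
qed

lemma root_reflection:
  assumes "\<alpha> \<in> \<Phi>"
  obtains i j s where "i < n" "j < n" "i \<noteq> j" "s \<in> signs" "reflection \<alpha> = reflection (c j - s *\<^sub>R c i)"
proof -
  obtain i j a b where 1: "\<alpha> = a *\<^sub>R c i + b *\<^sub>R c j" "i < n" "j < n" "i \<noteq> j" "a \<in> signs" "b \<in> signs"
    using assms unfolding roots by blast
  have "reflection \<alpha> = reflection (c j - (- (a * b)) *\<^sub>R c i)"
  proof (cases "b = 1")
    case False
    then have "\<alpha> = - (c j - (- (a * b)) *\<^sub>R c i)" using 1 by auto
    then show ?thesis by (simp only: reflection_uminus)
  qed (use 1 in \<open>simp add: add.commute\<close>)
  moreover have "- (a * b) \<in> signs" using 1 by auto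
  ultimately show ?thesis using that 1 by blast
qed

text \<open>A reflection swaps two of the vectors and gives both the same sign, so the product of
  the signs stays 1.\<close>

lemma weyl_signed_perm:
  assumes "w \<in> weyl_group \<Phi>"
  obtains \<pi> \<sigma> where "bij_betw \<pi> {..<n} {..<n}" "\<And>k. k < n \<Longrightarrow> \<sigma> k \<in> signs"
    "\<And>k. k < n \<Longrightarrow> w (c k) = \<sigma> k *\<^sub>R c (\<pi> k)" "(\<Prod>k<n. \<sigma> k) = 1"
proof -
  have "\<exists>\<pi> \<sigma>. bij_betw \<pi> {..<n} {..<n} \<and> (\<forall>k<n. \<sigma> k \<in> signs \<and> w (c k) = \<sigma> k *\<^sub>R c (\<pi> k)) \<and> (\<Prod>k<n. \<sigma> k) = 1"
    using assms
  proof (induction rule: weyl_group.induct)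
    case one
    show ?case by (rule exI[of _ id], rule exI[of _ "\<lambda>_. 1"]) (simp add: bij_betw_def inj_on_def)
  next
    case (refl \<alpha> w)
    obtain i j s where \<alpha>: "i < n" "j < n" "i \<noteq> j" "s \<in> signs" "reflection \<alpha> = reflection (c j - s *\<^sub>R c i)"
      using root_reflection[OF refl.hyps(1)] by metis
    obtain \<pi> \<sigma> where IH: "bij_betw \<pi> {..<n} {..<n}" "\<And>k. k < n \<Longrightarrow> \<sigma> k \<in> signs"
      "\<And>k. k < n \<Longrightarrow> w (c k) = \<sigma> k *\<^sub>R c (\<pi> k)" "(\<Prod>k<n. \<sigma> k) = 1" using refl.IH by blast
    define \<tau> where "\<tau> = (\<lambda>m. if m = i \<or> m = j then s else 1)"
    have \<pi>: "\<pi> k < n" if "k < n" for k using IH(1) that by (auto simp: bij_betw_def)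
    have "bij_betw (Transposition.transpose i j) {..<n} {..<n}"
      using \<alpha> by (intro permutes_imp_bij permutes_swap_id) auto
    then have b: "bij_betw (Transposition.transpose i j \<circ> \<pi>) {..<n} {..<n}" using IH(1) bij_betw_trans by blast
    have "(\<Prod>k<n. \<sigma> k * \<tau> (\<pi> k)) = (\<Prod>k<n. \<tau> k)"
      using IH(4) prod.reindex_bij_betw[OF IH(1), of \<tau>] by (simp add: prod.distrib)
    also have "\<dots> = (\<Prod>k\<in>{i, j}. \<tau> k)"
      using \<alpha> by (intro prod.mono_neutral_right) (auto simp: \<tau>_def)
    also have "\<dots> = 1" using \<alpha> by (auto simp: \<tau>_def)
    finally have p: "(\<Prod>k<n. \<sigma> k * \<tau> (\<pi> k)) = 1" .
    have v: "(reflection \<alpha> \<circ> w) (c k) = (\<sigma> k * \<tau> (\<pi> k)) *\<^sub>R c ((Transposition.transpose i j \<circ> \<pi>) k)" if "k < n" for k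
      using IH(3)[OF that] \<alpha>(3)
      by (auto simp: \<alpha>(5) linear_scale[OF linear_reflection] reflection_c[OF \<alpha>(1-4) \<pi>[OF that]] \<tau>_def Transposition.transpose_def)
    have sg: "\<sigma> k * \<tau> (\<pi> k) \<in> signs" if "k < n" for k
      using IH(2)[OF that] \<alpha>(4) by (auto simp: \<tau>_def)
    show ?case
      by (intro exI[of _ "Transposition.transpose i j \<circ> \<pi>"] exI[of _ "\<lambda>k. \<sigma> k * \<tau> (\<pi> k)"] conjI allI impI b p v sg)
  qed
  then show ?thesis using that by blast
qed

text \<open>For group elements the value is already an integer, and the floor only changes its type;
  see \<open>real_val\<close>.\<close>

definition val :: "('a \<Rightarrow> 'a) \<Rightarrow> nat \<Rightarrow> int" where "val w k = \<lfloor>shifted_ht (w (c k))\<rfloor>"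

definition arrangement :: "('a \<Rightarrow> 'a) \<Rightarrow> int list" where "arrangement w = map (val w) [0..<n]"

lemma real_val:
  assumes "w \<in> weyl_group \<Phi>" "k < n"
  shows "real_of_int (val w k) = shifted_ht (w (c k))"
proof -
  obtain \<pi> \<sigma> where *: "bij_betw \<pi> {..<n} {..<n}" "\<And>k. k < n \<Longrightarrow> \<sigma> k \<in> signs"
    "\<And>k. k < n \<Longrightarrow> w (c k) = \<sigma> k *\<^sub>R c (\<pi> k)" using weyl_signed_perm[OF assms(1)] by metis
  have "\<pi> k < n" using *(1) assms(2) by (auto simp: bij_betw_def)
  then have "shifted_ht (w (c k)) = \<sigma> k * (real (\<pi> k) + 1)"
    using *(3)[OF assms(2)] by (simp add: linear_scale[OF linear_shifted_ht] shifted_ht_c)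
  also have "\<dots> \<in> \<int>" using *(2)[OF assms(2)] by auto
  finally show ?thesis by (simp add: val_def)
qed

lemma val_eq:
  assumes w: "w \<in> weyl_group \<Phi>"
  obtains \<pi> and \<sigma> :: "nat \<Rightarrow> int" where "bij_betw \<pi> {..<n} {..<n}" "\<And>k. k < n \<Longrightarrow> \<sigma> k \<in> {1, - 1}"
    "\<And>k. k < n \<Longrightarrow> w (c k) = of_int (\<sigma> k) *\<^sub>R c (\<pi> k)" "(\<Prod>k<n. \<sigma> k) = 1"
    "\<And>k. k < n \<Longrightarrow> val w k = \<sigma> k * int (Suc (\<pi> k))"
proof -
  obtain \<pi> \<sigma> where *: "bij_betw \<pi> {..<n} {..<n}" "\<And>k. k < n \<Longrightarrow> \<sigma> k \<in> signs"
    "\<And>k. k < n \<Longrightarrow> w (c k) = \<sigma> k *\<^sub>R c (\<pi> k)" "(\<Prod>k<n. \<sigma> k) = 1" using weyl_signed_perm[OF w] by metis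
  define \<sigma>' where "\<sigma>' = (\<lambda>k. if \<sigma> k = 1 then 1 else - 1 :: int)"
  have s: "of_int (\<sigma>' k) = \<sigma> k" "\<sigma>' k \<in> {1, - 1}" if "k < n" for k using *(2)[OF that] by (auto simp: \<sigma>'_def)
  have "real_of_int (\<Prod>k<n. \<sigma>' k) = 1" using *(4) s by simp
  then have "(\<Prod>k<n. \<sigma>' k) = 1" by linarith
  moreover have "val w k = \<sigma>' k * int (Suc (\<pi> k))" if "k < n" for k
  proof -
    have "\<pi> k < n" using *(1) that by (auto simp: bij_betw_def)
    then have "real_of_int (val w k) = \<sigma> k * (real (\<pi> k) + 1)"
      using *(3)[OF that] real_val[OF w that] by (simp add: linear_scale[OF linear_shifted_ht] shifted_ht_c)
    also have "\<dots> = real_of_int (\<sigma>' k * int (Suc (\<pi> k)))" using s[OF that] by simp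
    finally show ?thesis by linarith
  qed
  ultimately show ?thesis using that[of \<pi> \<sigma>'] * s by auto
qed

lemma arrangement_signed_perm:
  assumes w: "w \<in> weyl_group \<Phi>"
  shows "arrangement w \<in> signed_perms n" "(\<Prod>y\<leftarrow>arrangement w. sgn y) = 1"
proof -
  obtain \<pi> and \<sigma> :: "nat \<Rightarrow> int" where *: "bij_betw \<pi> {..<n} {..<n}" "\<And>k. k < n \<Longrightarrow> \<sigma> k \<in> {1, - 1}"
    "(\<Prod>k<n. \<sigma> k) = 1" "\<And>k. k < n \<Longrightarrow> val w k = \<sigma> k * int (Suc (\<pi> k))" using val_eq[OF w] by metis
  have "abs ` val w ` {..<n} = (\<lambda>k. int (Suc k)) ` \<pi> ` {..<n}"
    unfolding image_image using *(2,4) by (intro image_cong) (fastforce simp: abs_mult)+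
  also have "\<dots> = int ` Suc ` {..<n}"
    unfolding bij_betw_imp_surj_on[OF *(1)] by (simp add: image_image)
  also have "\<dots> = {1..int n}"
    unfolding image_Suc_lessThan image_int_atLeastAtMost by simp
  finally show "arrangement w \<in> signed_perms n"
    by (simp add: arrangement_def signed_perms_def atLeast0LessThan)
  have "(\<Prod>y\<leftarrow>arrangement w. sgn y) = (\<Prod>k<n. sgn (val w k))"
    unfolding arrangement_def using prod.distinct_set_conv_list[of "[0..<n]" "\<lambda>k. sgn (val w k)"]
    by (simp add: atLeast0LessThan comp_def)
  also have "\<dots> = (\<Prod>k<n. \<sigma> k)" using *(2,4) by (intro prod.cong) (force simp: sgn_mult)+
  finally show "(\<Prod>y\<leftarrow>arrangement w. sgn y) = 1" using *(3) by simp
qed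

lemma arrangement_inj: "inj_on arrangement (weyl_group \<Phi>)"
proof (rule inj_onI)
  fix w w' assume w: "w \<in> weyl_group \<Phi>" "w' \<in> weyl_group \<Phi>" and eq: "arrangement w = arrangement w'"
  have "w (c k) = w' (c k)" if k: "k < n" for k
  proof -
    have v: "val w k = val w' k" using eq k unfolding arrangement_def by (simp add: map_eq_conv)
    obtain \<pi> and \<sigma> :: "nat \<Rightarrow> int" where 1: "\<And>k. k < n \<Longrightarrow> \<sigma> k \<in> {1, - 1}"
      "\<And>k. k < n \<Longrightarrow> w (c k) = of_int (\<sigma> k) *\<^sub>R c (\<pi> k)" "\<And>k. k < n \<Longrightarrow> val w k = \<sigma> k * int (Suc (\<pi> k))"
      using val_eq[OF w(1)] by metis
    obtain \<pi>' and \<sigma>' :: "nat \<Rightarrow> int" where 2: "\<And>k. k < n \<Longrightarrow> \<sigma>' k \<in> {1, - 1}"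
      "\<And>k. k < n \<Longrightarrow> w' (c k) = of_int (\<sigma>' k) *\<^sub>R c (\<pi>' k)" "\<And>k. k < n \<Longrightarrow> val w' k = \<sigma>' k * int (Suc (\<pi>' k))"
      using val_eq[OF w(2)] by metis
    have "\<sigma> k = \<sigma>' k \<and> \<pi> k = \<pi>' k"
      using v 1(1,3)[OF k] 2(1,3)[OF k] by auto
    then show ?thesis using 1(2)[OF k] 2(2)[OF k] by simp
  qed
  then have "w v = w' v" if "v \<in> span (c ` {..<n})" for v
    using linear_eq_on_span[OF linear_weyl[OF w(1)] linear_weyl[OF w(2)] _ that] by blast
  then show "w = w'" by (intro weyl_eqI[OF w]) (simp only: span_roots)
qed

end

section \<open>Exhausting all arrangements\<close>

context root_frame
begin

text \<open>The sign of the entry \<plusminus>1 is left open, since only then can a single entry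
  change its sign without leaving this class.\<close>

definition reached :: "(nat \<Rightarrow> int) \<Rightarrow> bool" where
  "reached v \<longleftrightarrow> (\<exists>w\<in>weyl_group \<Phi>. (\<forall>k<n. val w k = v k) \<or> (\<forall>k<n. val w k = negate_one (v k)))"

definition signed_perm_fun :: "(nat \<Rightarrow> int) \<Rightarrow> bool" where
  "signed_perm_fun v \<longleftrightarrow> (\<lambda>k. \<bar>v k\<bar>) ` {..<n} = {1..int n}"

text \<open>Multiplication by a reflection on the right acts on places instead of values.\<close>

lemma reached_swap:
  assumes "reached v" "i < n" "j < n" "i \<noteq> j" "s = 1 \<or> s = - 1"
  shows "reached (v(i := s * v j, j := s * v i))"
proof -
  obtain w where w: "w \<in> weyl_group \<Phi>" "(\<forall>k<n. val w k = v k) \<or> (\<forall>k<n. val w k = negate_one (v k))"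
    using assms(1) unfolding reached_def by blast
  have s: "real_of_int s \<in> signs" using assms(5) by auto
  define w' where "w' = w \<circ> reflection (c j - real_of_int s *\<^sub>R c i)"
  have w': "w' \<in> weyl_group \<Phi>"
    unfolding w'_def by (intro weyl_comp_reflection w root_simps assms s)
  have "val w' k = (if k = j then s * val w i else if k = i then s * val w j else val w k)" if "k < n" for k
  proof -
    have "shifted_ht (w' (c k)) = real_of_int (if k = j then s * val w i else if k = i then s * val w j else val w k)"
      using assms that by (simp add: w'_def reflection_c[OF assms(2-4) s that] linear_scale[OF linear_weyl[OF w(1)]]
          linear_scale[OF linear_shifted_ht] real_val[OF w(1)])
    then show ?thesis using real_val[OF w' that] by linarith
  qed
  then show ?thesis unfolding reached_def
    using w w' assms by (intro bexI[of _ w']) auto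
qed

lemma reached_negate_one: "reached (\<lambda>k. negate_one (v k)) \<longleftrightarrow> reached v"
  unfolding reached_def by auto

lemma reached_cong: "(\<And>k. k < n \<Longrightarrow> v k = v' k) \<Longrightarrow> reached v \<longleftrightarrow> reached v'"
  unfolding reached_def by auto

lemma signed_perm_fun_ex:
  assumes "signed_perm_fun v" "m < n"
  shows "\<exists>k<n. \<bar>v k\<bar> = int (Suc m)"
proof -
  have "int (Suc m) \<in> (\<lambda>k. \<bar>v k\<bar>) ` {..<n}" using assms unfolding signed_perm_fun_def by auto
  then show ?thesis by auto
qed

lemma signed_perm_fun_inj:
  assumes "signed_perm_fun v" "i < n" "j < n" "\<bar>v i\<bar> = \<bar>v j\<bar>"
  shows "i = j"
proof -
  have "inj_on (\<lambda>k. \<bar>v k\<bar>) {..<n}"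
    using assms(1) by (intro eq_card_imp_inj_on) (auto simp: signed_perm_fun_def)
  then show ?thesis using assms by (auto dest: inj_onD)
qed

text \<open>Swapping places \<open>k\<close> and \<open>l\<close> once with s = 1 and once with s =
  - 1 negates both entries. If place \<open>l\<close> holds \<plusminus>1, the second sign change is
  absorbed by the definition of \<open>reached\<close>.\<close>

lemma reached_negate:
  assumes "reached v" "signed_perm_fun v" "k < n"
  shows "reached (v(k := - v k))"
proof -
  obtain l where l: "l < n" "\<bar>v l\<bar> = 1" using signed_perm_fun_ex[OF assms(2), of 0] n2 by auto
  have other: "\<bar>v m\<bar> \<noteq> 1" if "m < n" "m \<noteq> l" for m
    using signed_perm_fun_inj[OF assms(2) that(1) l(1)] that l by auto
  show ?thesis
  proof (cases "l = k")
    case True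
    have "reached (v(k := - v k)) \<longleftrightarrow> reached (\<lambda>m. negate_one (v m))"
      using True other l by (intro reached_cong) (auto simp: negate_one_def)
    then show ?thesis using reached_negate_one assms(1) by simp
  next
    case False
    define v1 where "v1 = v(k := 1 * v l, l := 1 * v k)"
    define v2 where "v2 = v1(k := - 1 * v1 l, l := - 1 * v1 k)"
    have "reached v2" unfolding v2_def v1_def using assms l False by (intro reached_swap) auto
    moreover have "reached (v(k := - v k)) \<longleftrightarrow> reached (\<lambda>m. negate_one (v2 m))"
      using False other[of k] assms(3) other l by (intro reached_cong) (auto simp: v2_def v1_def negate_one_def)
    ultimately show ?thesis using reached_negate_one by simp
  qed
qed

lemma signed_perm_fun_swap:
  assumes "signed_perm_fun v" "i < n" "j < n"
  shows "signed_perm_fun (v(i := v j, j := v i))"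
proof -
  have "(\<lambda>k. \<bar>(v(i := v j, j := v i)) k\<bar>) = (\<lambda>k. \<bar>v k\<bar>) \<circ> Transposition.transpose i j"
    by (auto simp: fun_eq_iff Transposition.transpose_def)
  moreover have "Transposition.transpose i j ` {..<n} = {..<n}"
    using assms by (intro permutes_image permutes_swap_id) auto
  ultimately show ?thesis using assms unfolding signed_perm_fun_def by (simp only: image_comp[symmetric])
qed

lemma signed_perm_fun_negate: "signed_perm_fun (v(k := - v k)) \<longleftrightarrow> signed_perm_fun v"
proof -
  have "(\<lambda>m. \<bar>(v(k := - v k)) m\<bar>) = (\<lambda>m. \<bar>v m\<bar>)" by auto
  then show ?thesis unfolding signed_perm_fun_def by (simp only:)
qed

text \<open>Sorting from the right: when the places from m + 1 on hold their own values, the entry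
  \<plusminus>(m + 1) is moved to place \<open>m\<close> and made positive. Both moves can be
  undone.\<close>

lemma reached_all:
  assumes "signed_perm_fun v"
  shows "reached v"
proof -
  have "reached v" if "m \<le> n" "signed_perm_fun v" "\<And>k. m \<le> k \<Longrightarrow> k < n \<Longrightarrow> v k = int (Suc k)" for m
    using that
  proof (induction m arbitrary: v)
    case 0
    have "val id k = v k" if "k < n" for k using 0(3)[OF _ that] that by (simp add: val_def shifted_ht_c)
    then show ?case unfolding reached_def using weyl_group.one[of \<Phi>] by blast
  next
    case (Suc m)
    obtain j where j: "j < n" "\<bar>v j\<bar> = int (Suc m)" using signed_perm_fun_ex[OF Suc.prems(2), of m] Suc.prems(1) by auto
    have m: "m < n" using Suc.prems(1) by simp
    have jm: "j \<le> m"
    proof (rule ccontr)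
      assume "\<not> j \<le> m"
      then have "v j = int (Suc j)" using Suc.prems(3)[of j] j by auto
      then show False using j \<open>\<not> j \<le> m\<close> by simp
    qed
    define v1 where "v1 = v(j := v m, m := v j)"
    have v1: "signed_perm_fun v1" unfolding v1_def using signed_perm_fun_swap[OF Suc.prems(2) j(1) m] .
    define v2 where "v2 = (if v1 m < 0 then v1(m := - v1 m) else v1)"
    have v2: "signed_perm_fun v2" using v1 by (simp add: v2_def signed_perm_fun_negate)
    have "reached v2"
    proof (rule Suc.IH)
      fix k assume k: "m \<le> k" "k < n"
      show "v2 k = int (Suc k)"
      proof (cases "k = m")
        case True
        then show ?thesis using j by (auto simp: v2_def v1_def)
      next
        case False
        then have "v k = int (Suc k)" using Suc.prems(3)[of k] k by auto
        then show ?thesis using False k jm by (auto simp: v2_def v1_def)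
      qed
    qed (use m v2 in auto)
    moreover have "v1 = (if v1 m < 0 then v2(m := - v2 m) else v2)" by (auto simp: v2_def)
    ultimately have r1: "reached v1" using reached_negate[OF _ v2 m] by (metis (full_types))
    show ?case
    proof (cases "j = m")
      case True
      then show ?thesis using r1 by (simp add: v1_def)
    next
      case False
      have veq: "v = v1(j := 1 * v1 m, m := 1 * v1 j)" using False by (auto simp: v1_def fun_eq_iff)
      have "reached (v1(j := 1 * v1 m, m := 1 * v1 j))" by (rule reached_swap[OF r1 j(1) m False]) simp
      then show ?thesis by (rule ssubst[where P = reached, OF veq])
    qed
  qed
  from this[of n] show ?thesis using assms by auto
qed

text \<open>The arrangements of group elements and their images under \<open>negate_one\<close>
  exhaust \<open>signed_perms n\<close>, and they are disjoint because their sign products are 1 and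
  -1.\<close>

lemma sum_signed_perms_weyl:
  fixes g :: "int list \<Rightarrow> 'r::comm_ring_1"
  assumes "\<And>v. v \<in> signed_perms n \<Longrightarrow> g (map negate_one v) = g v"
  shows "(\<Sum>v\<in>signed_perms n. g v) = 2 * (\<Sum>w\<in>weyl_group \<Phi>. g (arrangement w))"
proof -
  let ?O = "arrangement ` weyl_group \<Phi>"
  have O: "?O \<subseteq> signed_perms n" using arrangement_signed_perm(1) by auto
  have "signed_perms n \<subseteq> ?O \<union> map negate_one ` ?O"
  proof
    fix v assume v: "v \<in> signed_perms n"
    then have len: "length v = n" by (simp add: signed_perms_def)
    have "(\<lambda>k. \<bar>v ! k\<bar>) ` {..<n} = abs ` set v" using len by (auto simp: set_conv_nth)
    then have "signed_perm_fun (\<lambda>k. v ! k)" using v by (simp add: signed_perm_fun_def signed_perms_def)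
    then obtain w where w: "w \<in> weyl_group \<Phi>"
      "(\<forall>k<n. val w k = v ! k) \<or> (\<forall>k<n. val w k = negate_one (v ! k))"
      using reached_all unfolding reached_def by blast
    then have "arrangement w = v \<or> arrangement w = map negate_one v"
      unfolding arrangement_def using len by (auto simp: list_eq_iff_nth_eq)
    then show "v \<in> ?O \<union> map negate_one ` ?O"
    proof
      assume "arrangement w = map negate_one v"
      then have "v = map negate_one (arrangement w)" by (simp add: comp_def)
      then show ?thesis using w by blast
    qed (use w in blast)
  qed
  then have un: "signed_perms n = ?O \<union> map negate_one ` ?O" using O by auto
  have disj: "?O \<inter> map negate_one ` ?O = {}"
  proof (rule ccontr)
    assume "?O \<inter> map negate_one ` ?O \<noteq> {}"
    then obtain w w' where w: "w \<in> weyl_group \<Phi>" "w' \<in> weyl_group \<Phi>" "arrangement w = map negate_one (arrangement w')"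
      by blast
    show False
      using sgn_negate_one[OF arrangement_signed_perm(1)[OF w(2)]] n2
        arrangement_signed_perm(2)[OF w(1)] arrangement_signed_perm(2)[OF w(2)] w(3) by simp
  qed
  have fin: "finite ?O" using O finite_subset finite_signed_perms by blast
  have inj: "inj_on (map negate_one) ?O" by (rule inj_on_inverseI[of _ "map negate_one"]) (simp add: comp_def)
  have "(\<Sum>v\<in>signed_perms n. g v) = (\<Sum>v\<in>?O. g v) + (\<Sum>v\<in>map negate_one ` ?O. g v)"
    unfolding un using fin disj by (intro sum.union_disjoint) auto
  also have "(\<Sum>v\<in>map negate_one ` ?O. g v) = (\<Sum>v\<in>?O. g v)"
    using inj assms O by (subst sum.reindex) (auto intro!: sum.cong)
  also have "(\<Sum>v\<in>?O. g v) = (\<Sum>w\<in>weyl_group \<Phi>. g (arrangement w))"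
    by (subst sum.reindex[OF arrangement_inj]) simp
  finally show ?thesis by simp
qed

section \<open>Lengths and minimal representatives in terms of arrangements\<close>

lemma two_term_image:
  assumes w: "w \<in> weyl_group \<Phi>" and ij: "i < n" "j < n" "i \<noteq> j" and s: "s \<in> signs"
  shows "w (c j - s *\<^sub>R c i) \<in> pos_roots \<Phi> \<Delta> \<longleftrightarrow> s * real_of_int (val w i) < real_of_int (val w j)"
    and "w (c j - s *\<^sub>R c i) \<in> neg_roots \<Phi> \<Delta> \<longleftrightarrow> real_of_int (val w j) < s * real_of_int (val w i)"
proof -
  obtain \<pi> \<sigma> where *: "bij_betw \<pi> {..<n} {..<n}" "\<And>k. k < n \<Longrightarrow> \<sigma> k \<in> signs"
    "\<And>k. k < n \<Longrightarrow> w (c k) = \<sigma> k *\<^sub>R c (\<pi> k)" using weyl_signed_perm[OF w] by metis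
  have \<pi>: "\<pi> i < n" "\<pi> j < n" "\<pi> i \<noteq> \<pi> j"
    using *(1) ij by (auto simp: bij_betw_def inj_on_def)
  have eq: "w (c j - s *\<^sub>R c i) = \<sigma> j *\<^sub>R c (\<pi> j) - (s * \<sigma> i) *\<^sub>R c (\<pi> i)"
    using ij * by (simp add: linear_diff[OF linear_weyl[OF w]] linear_scale[OF linear_weyl[OF w]])
  have sg: "s * \<sigma> i \<in> signs" "\<sigma> j \<in> signs" using s *(2)[OF ij(1)] *(2)[OF ij(2)] by auto
  note t = two_term_root[OF \<pi> sg(2,1), folded eq]
  have "shifted_ht (w (c j - s *\<^sub>R c i)) = real_of_int (val w j) - s * real_of_int (val w i)"
    using real_val[OF w] ij by (simp add: linear_diff[OF linear_weyl[OF w]] linear_scale[OF linear_weyl[OF w]]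
        linear_diff[OF linear_shifted_ht] linear_scale[OF linear_shifted_ht])
  then show "w (c j - s *\<^sub>R c i) \<in> pos_roots \<Phi> \<Delta> \<longleftrightarrow> s * real_of_int (val w i) < real_of_int (val w j)"
    "w (c j - s *\<^sub>R c i) \<in> neg_roots \<Phi> \<Delta> \<longleftrightarrow> real_of_int (val w j) < s * real_of_int (val w i)"
    using t neg_roots_iff[OF ss rs t(1)] by auto
qed

text \<open>Serves both lengths: \<open>R\<close> is trivial for the Coxeter length and selects odd
  height for the odd length. Positive roots are parametrized by the triples (j, i, s).\<close>

lemma card_inversions:
  assumes w: "w \<in> weyl_group \<Phi>"
    and R: "\<And>i j s. i < j \<Longrightarrow> j < n \<Longrightarrow> s \<in> signs \<Longrightarrow> R (c j - s *\<^sub>R c i) \<longleftrightarrow> Q i j"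
  shows "card {\<gamma> \<in> pos_roots \<Phi> \<Delta>. R \<gamma> \<and> w \<gamma> \<in> neg_roots \<Phi> \<Delta>}
    = (\<Sum>j<n. \<Sum>i<j. of_bool (Q i j) * pair_inv (val w i) (val w j))"
proof -
  let ?S = "\<lambda>i j. {s \<in> signs. Q i j \<and> real_of_int (val w j) < s * real_of_int (val w i)}"
  let ?B = "SIGMA j:{..<n}. SIGMA i:{..<j}. ?S i j"
  let ?f = "\<lambda>(j, i, s). c j - s *\<^sub>R c i"
  have fin: "finite (?S i j)" for i j by simp
  have "{\<gamma> \<in> pos_roots \<Phi> \<Delta>. R \<gamma> \<and> w \<gamma> \<in> neg_roots \<Phi> \<Delta>} = ?f ` ?B" (is "?L = _")
  proof (intro set_eqI iffI)
    fix \<gamma> assume g: "\<gamma> \<in> ?L"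
    then obtain i j s where 1: "\<gamma> = c j - s *\<^sub>R c i" "i < j" "j < n" "s \<in> signs" unfolding pos by blast
    have "(j, i, s) \<in> ?B" using g 1 R[OF 1(2-4)] two_term_image(2)[OF w, of i j s] by auto
    then show "\<gamma> \<in> ?f ` ?B" using 1(1) by (intro image_eqI[of _ _ "(j, i, s)"]) auto
  next
    fix \<gamma> assume "\<gamma> \<in> ?f ` ?B"
    then obtain i j s where 1: "\<gamma> = c j - s *\<^sub>R c i" "i < j" "j < n" "s \<in> signs" "Q i j"
      "real_of_int (val w j) < s * real_of_int (val w i)" by auto
    have "\<gamma> \<in> pos_roots \<Phi> \<Delta>" unfolding pos using 1 by blast
    then show "\<gamma> \<in> ?L" using 1 R[OF 1(2-4)] two_term_image(2)[OF w, of i j s] by auto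
  qed
  moreover have "inj_on ?f ?B"
  proof (rule inj_onI)
    fix x y assume xy: "x \<in> ?B" "y \<in> ?B" "?f x = ?f y"
    obtain j i s where x: "x = (j, i, s)" "i < j" "j < n" "s \<in> signs" using xy(1) by auto
    obtain j' i' s' where y: "y = (j', i', s')" "i' < j'" "j' < n" "s' \<in> signs" using xy(2) by auto
    have eq: "c j - s *\<^sub>R c i = c j' - s' *\<^sub>R c i'" using xy(3) x y by simp
    have co: "of_bool (m = j) - s * of_bool (m = i) = (of_bool (m = j') - s' * of_bool (m = i') :: real)" if "m < n" for m
      using arg_cong[OF eq, of "\<phi> m"] x y that
      by (simp add: linear_diff[OF linear_coord] linear_scale[OF linear_coord] dual)
    have "j = j'" using co[of j] co[of j'] x y by (cases j j' rule: linorder_cases) auto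
    moreover from this have "i = i' \<and> s = s'" using co[of i] co[of i'] x y by (cases "i = i'") auto
    ultimately show "x = y" using x y by simp
  qed
  ultimately have "card ?L = card ?B" by (simp add: card_image)
  also have "\<dots> = (\<Sum>j<n. \<Sum>i<j. card (?S i j))"
    by (subst card_SigmaI) (auto intro!: finite_SigmaI sum.cong card_SigmaI simp: fin)
  also have "\<dots> = (\<Sum>j<n. \<Sum>i<j. of_bool (Q i j) * pair_inv (val w i) (val w j))"
  proof (intro sum.cong)
    fix i j
    let ?v = "real_of_int (val w i)" and ?u = "real_of_int (val w j)"
    have S: "?S i j = (if Q i j \<and> ?u < ?v then {1} else {}) \<union> (if Q i j \<and> ?u < - ?v then {- 1} else {})" by auto
    show "card (?S i j) = of_bool (Q i j) * pair_inv (val w i) (val w j)"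
      unfolding S by (auto simp: pair_inv_def)
  qed simp_all
  finally show ?thesis .
qed

lemma coxeter_length_eq:
  "w \<in> weyl_group \<Phi> \<Longrightarrow> coxeter_length \<Phi> \<Delta> w = (\<Sum>j<n. \<Sum>i<j. pair_inv (val w i) (val w j))"
  using card_inversions[of w "\<lambda>_. True" "\<lambda>_ _. True"] by (simp add: coxeter_length_def)

text \<open>The root c_j - s c_i has height j - s i, whose parity is that of i + j for either sign
  s.\<close>

lemma odd_length_eq:
  assumes "w \<in> weyl_group \<Phi>"
  shows "odd_length \<Phi> \<Delta> w = (\<Sum>j<n. \<Sum>i<j. of_bool (odd (i + j)) * pair_inv (val w i) (val w j))"
  unfolding odd_length_def
proof (rule card_inversions[OF assms])
  fix i j and s :: real assume *: "i < j" "j < n" "s \<in> signs"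
  have "height \<Delta> (c j - s *\<^sub>R c i) = ht (c j - s *\<^sub>R c i)" using * by (intro height_root root_simps) auto
  also have "\<dots> = real j - s * real i"
    using * by (simp add: linear_diff[OF linear_ht] linear_scale[OF linear_ht] ht_c)
  also have "\<dots> = of_int (int j - (if s = 1 then 1 else - 1) * int i)" using * by auto
  finally have "odd_height \<Delta> (c j - s *\<^sub>R c i) \<longleftrightarrow> odd (int j - (if s = 1 then 1 else - 1) * int i)"
    unfolding odd_height_def by (metis of_int_eq_iff)
  also have "\<dots> \<longleftrightarrow> odd (i + j)" by auto
  finally show "odd_height \<Delta> (c j - s *\<^sub>R c i) \<longleftrightarrow> odd (i + j)" .
qed

lemma weight_arrangement:
  assumes "w \<in> weyl_group \<Phi>"
  shows "weight x (zip (alt True n) (arrangement w)) = (- 1) ^ coxeter_length \<Phi> \<Delta> w * x ^ odd_length \<Phi> \<Delta> w"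
proof -
  have "weight x (zip (alt True n) (arrangement w)) = (\<Prod>j<n. \<Prod>i<j.
     (- 1) ^ pair_inv (val w i) (val w j) * x ^ (of_bool (odd (i + j)) * pair_inv (val w i) (val w j)))"
    unfolding weight_conv_prod
  proof (intro prod.cong)
    fix j i assume "j \<in> {..<n}" "i \<in> {..<j}"
    then show "pair_weight x (zip (alt True n) (arrangement w) ! i) (zip (alt True n) (arrangement w) ! j)
      = (- 1) ^ pair_inv (val w i) (val w j) * x ^ (of_bool (odd (i + j)) * pair_inv (val w i) (val w j))"
      by (auto simp: arrangement_def alt_nth pair_weight_def power_minus[of x])
  qed (auto simp: arrangement_def)
  also have "\<dots> = (- 1) ^ coxeter_length \<Phi> \<Delta> w * x ^ odd_length \<Phi> \<Delta> w"
    unfolding coxeter_length_eq[OF assms] odd_length_eq[OF assms] by (simp only: prod.distrib power_sum)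
  finally show ?thesis .
qed

definition compatible :: "'a set \<Rightarrow> int list \<Rightarrow> bool" where
  "compatible I v \<longleftrightarrow> (c 0 + c 1 \<in> I \<longrightarrow> 0 < v ! 0 + v ! 1) \<and>
    (\<forall>k. Suc k < n \<longrightarrow> c (Suc k) - c k \<in> I \<longrightarrow> v ! k < v ! Suc k)"

lemma min_coset_reps_eq:
  assumes "I \<subseteq> \<Delta>"
  shows "min_coset_reps \<Phi> \<Delta> I = {w \<in> weyl_group \<Phi>. compatible I (arrangement w)}"
proof -
  have "(\<forall>\<alpha>\<in>I. coxeter_length \<Phi> \<Delta> w < coxeter_length \<Phi> \<Delta> (w \<circ> reflection \<alpha>)) \<longleftrightarrow> compatible I (arrangement w)"
    if w: "w \<in> weyl_group \<Phi>" for w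
  proof -
    have "(\<forall>\<alpha>\<in>I. coxeter_length \<Phi> \<Delta> w < coxeter_length \<Phi> \<Delta> (w \<circ> reflection \<alpha>)) \<longleftrightarrow> (\<forall>\<alpha>\<in>I. w \<alpha> \<in> pos_roots \<Phi> \<Delta>)"
      using coxeter_length_reflection[OF ss rs _ w] assms by blast
    also have "\<dots> \<longleftrightarrow> (c 0 + c 1 \<in> I \<longrightarrow> w (c 0 + c 1) \<in> pos_roots \<Phi> \<Delta>) \<and>
      (\<forall>k. Suc k < n \<longrightarrow> c (Suc k) - c k \<in> I \<longrightarrow> w (c (Suc k) - c k) \<in> pos_roots \<Phi> \<Delta>)"
      using assms unfolding simple_roots by blast
    also have "\<dots> \<longleftrightarrow> compatible I (arrangement w)"
    proof -
      have "w (c 0 + c 1) \<in> pos_roots \<Phi> \<Delta> \<longleftrightarrow> 0 < val w 0 + val w 1"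
        using two_term_image(1)[OF w, of 0 1 "- 1"] n2 by (simp add: add.commute) linarith
      moreover have "w (c (Suc k) - c k) \<in> pos_roots \<Phi> \<Delta> \<longleftrightarrow> val w k < val w (Suc k)" if "Suc k < n" for k
        using two_term_image(1)[OF w, of k "Suc k" 1] that by simp
      ultimately show ?thesis unfolding compatible_def arrangement_def using n2 by auto
    qed
    finally show ?thesis .
  qed
  then show ?thesis unfolding min_coset_reps_def by auto
qed

lemma map_poly_signed_odd_poly:
  assumes "I \<subseteq> \<Delta>"
  shows "2 * map_poly of_int (signed_odd_poly \<Phi> \<Delta> I) =
    (\<Sum>v\<in>signed_perms n. of_bool (compatible I v) * weight (monom 1 1 :: complex poly) (zip (alt True n) v))"
proof -
  have fin: "finite (weyl_group \<Phi>)"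
  proof (rule inj_on_finite[OF arrangement_inj])
    show "arrangement ` weyl_group \<Phi> \<subseteq> signed_perms n" using arrangement_signed_perm by auto
  qed simp
  have add: "map_poly of_int (p + q) = (map_poly of_int p + map_poly of_int q :: complex poly)" for p q :: "int poly"
    by (rule poly_eqI) (simp add: coeff_map_poly)
  have sum: "map_poly of_int (\<Sum>w\<in>A. f w) = (\<Sum>w\<in>A. map_poly of_int (f w) :: complex poly)"
    for A :: "('a \<Rightarrow> 'a) set" and f :: "_ \<Rightarrow> int poly"
    by (induction A rule: infinite_finite_induct) (auto simp: add)
  have mon: "map_poly of_int (monom ((- 1) ^ l) m) = ((- 1) ^ l * monom 1 1 ^ m :: complex poly)" for l m
    by (cases "even l") (auto simp: map_poly_monom monom_power minus_monom)
  have "map_poly of_int (signed_odd_poly \<Phi> \<Delta> I) =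
    (\<Sum>w\<in>min_coset_reps \<Phi> \<Delta> I. (- 1) ^ coxeter_length \<Phi> \<Delta> w * monom 1 1 ^ odd_length \<Phi> \<Delta> w :: complex poly)"
    unfolding signed_odd_poly_def sum mon ..
  also have "\<dots> = (\<Sum>w\<in>weyl_group \<Phi>. of_bool (compatible I (arrangement w)) * weight (monom 1 1 :: complex poly) (zip (alt True n) (arrangement w)))"
    unfolding min_coset_reps_eq[OF assms] using fin
    by (auto simp: weight_arrangement intro!: sum.mono_neutral_cong_left)
  finally show ?thesis
  proof (subst sum_signed_perms_weyl)
    fix v assume v: "v \<in> signed_perms n"
    have len: "length v = n" using v by (simp add: signed_perms_def)
    have "compatible I (map negate_one v) \<longleftrightarrow> compatible I v"
      unfolding compatible_def
      using n2 len negate_one_compare[OF signed_perms_nth[OF v] signed_perms_nth_nonzero[OF v] signed_perms_nth_nonzero[OF v]]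
      by auto
    then show "of_bool (compatible I (map negate_one v)) * weight (monom 1 1 :: complex poly) (zip (alt True n) (map negate_one v))
      = of_bool (compatible I v) * weight (monom 1 1 :: complex poly) (zip (alt True n) v)"
      using weight_negate_one[OF v, of "alt True n" "monom 1 1 :: complex poly"] by simp
  qed simp
qed

end

section \<open>Quotients in type D\<close>

lemma cyclo_prod_qfac: "cyclo_prod (qfac (monom 1 1) k)"
  unfolding qfac_def monom_power by (intro cyclo_prod_prod) (auto intro: cyclo_prod_one_minus)

lemma cyclo_prod_odd_value:
  "x = monom 1 1 \<Longrightarrow> 0 < d \<Longrightarrow> cyclo_prod (odd_value x d r)" for x :: "complex poly"
proof (induction x d r rule: odd_value.induct)
  case (2 x d)
  then show ?case by (auto simp: monom_power intro!: cyclo_prod_power cyclo_prod_one_minus)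
next
  case (3 x d r)
  then have "cyclo_prod ((1 - monom 1 (Suc d)) ^ 2 * odd_value x (Suc (Suc d)) r)"
    by (intro cyclo_prod_mult cyclo_prod_power cyclo_prod_one_minus 3) auto
  then show ?case using 3 by (simp add: monom_power del: power_Suc)
qed simp

lemma cyclo_prod_qfacs: "cyclo_prod (\<Prod>l\<leftarrow>ls. qfac (monom 1 1) (l div 2))"
  by (intro cyclo_prod_prod_list) (auto simp: cyclo_prod_qfac simp del: One_nat_def)

text \<open>The 2 that comes from counting each group element twice cancels against the 2 in the
  value of a word without initial run.\<close>

lemma cyclo_prod_cells_of_0:
  assumes "ls \<noteq> []" "0 \<notin> set ls" "2 * p = signed_sum (monom 1 1) (cells_of 0 ls)"
  shows "cyclo_prod p"
proof (rule cyclo_prod_cancel[OF _ cyclo_prod_qfacs])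
  let ?x = "monom 1 1 :: complex poly"
  obtain t where t: "sum_list ls = Suc t" using assms by (cases ls; cases "hd ls") auto
  have "2 * ((\<Prod>l\<leftarrow>ls. qfac ?x (l div 2)) * p) =
    2 * ((1 + of_bool (\<forall>l\<in>set ls. even l) * ?x ^ (sum_list ls div 2)) * odd_value ?x 1 (sum_list ls - 1))"
    using signed_sum_cells_of_0[OF assms(1,2), of ?x] unfolding assms(3)[symmetric] by (simp only: ac_simps)
  then have eq: "(\<Prod>l\<leftarrow>ls. qfac ?x (l div 2)) * p =
    (1 + of_bool (\<forall>l\<in>set ls. even l) * ?x ^ (sum_list ls div 2)) * odd_value ?x 1 (sum_list ls - 1)"
    by (simp only: mult_cancel_left) simp
  have "cyclo_prod (1 + of_bool (\<forall>l\<in>set ls. even l) * ?x ^ (sum_list ls div 2))"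
  proof (cases "\<forall>l\<in>set ls. even l")
    case True
    then have "even (Suc t)" using even_sum_list t by metis
    then have "0 < Suc t div 2" by auto
    then show ?thesis using True cyclo_prod_one_plus[of "Suc t div 2"] by (simp add: t monom_power)
  next
    case False
    then have "of_bool (\<forall>l\<in>set ls. even l) = (0 :: complex poly)" by simp
    then show ?thesis by (simp only: mult_zero_left add_0_right cyclo_prod_1)
  qed
  then show "cyclo_prod ((\<Prod>l\<leftarrow>ls. qfac ?x (l div 2)) * p)"
    unfolding eq by (intro cyclo_prod_mult cyclo_prod_odd_value) auto
qed

lemma cyclo_prod_cells_of:
  assumes "0 \<notin> set ls" "0 < d" "\<not> (even d \<and> (\<forall>l\<in>set ls. even l))"
  shows "cyclo_prod (signed_sum (monom 1 1) (cells_of d ls))"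
proof (rule cyclo_prod_cancel[OF _ cyclo_prod_qfacs[of ls]])
  let ?x = "monom 1 1 :: complex poly"
  consider "ls = []" | "ls \<noteq> []" "odd d" | "even d" by blast
  then show "cyclo_prod ((\<Prod>l\<leftarrow>ls. qfac ?x (l div 2)) * signed_sum ?x (cells_of d ls))"
  proof cases
    case 1
    then show ?thesis by (simp add: signed_sum_cells_of_no_blocks)
  next
    case 2
    then show ?thesis unfolding signed_sum_cells_of_odd[OF 2(1) assms(1) 2(2)]
      using assms by (intro cyclo_prod_odd_value) auto
  next
    case 3
    then have ev: "\<not> (\<forall>l\<in>set ls. even l)" using assms by auto
    show ?thesis unfolding signed_sum_cells_of_even[OF assms(1) 3 assms(2) ev]
      using cyclo_prod_one_plus[OF assms(2)]
      by (intro cyclo_prod_mult cyclo_prod_odd_value) (auto simp: monom_power)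
  qed
qed

section \<open>From flags to runs and blocks\<close>

lemma chain_iff_nth:
  "length fs = length v \<Longrightarrow> chain y fs v \<longleftrightarrow> (\<forall>k<length v. fs ! k \<longrightarrow> (y # v) ! k < v ! k)"
proof (induction fs v arbitrary: y rule: list_induct2)
  case (Cons f fs z v)
  then show ?case by (simp add: All_less_Suc2)
qed simp

text \<open>A set flag prolongs the initial run of the tail. A clear flag turns that run, together
  with its own cell, into a new first block.\<close>

lemma zip_alt_decompose:
  "\<exists>d ls. 0 \<notin> set ls \<and> zip fs (alt s (length fs)) = forced (alt s d) @ blocks (s \<noteq> odd d) ls \<and>
    (d = 0 \<longleftrightarrow> fs = [] \<or> \<not> hd fs)"
proof (induction fs arbitrary: s)
  case Nil
  show ?case by (intro exI[of _ 0] exI[of _ "[]"]) simp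
next
  case (Cons f fs)
  obtain d ls where d: "0 \<notin> set ls" "zip fs (alt (\<not> s) (length fs)) = forced (alt (\<not> s) d) @ blocks ((\<not> s) \<noteq> odd d) ls"
    using Cons[of "\<not> s"] by metis
  have e: "((\<not> s) \<noteq> odd d) = (s \<noteq> odd (Suc d))" by auto
  show ?case
  proof (cases f)
    case True
    then show ?thesis using d unfolding e by (intro exI[of _ "Suc d"] exI[of _ ls]) simp
  next
    case False
    then show ?thesis using d unfolding e by (intro exI[of _ 0] exI[of _ "Suc d # ls"]) simp
  qed
qed

lemma flags_block: "i < length w \<Longrightarrow> flags (block w) ! i \<longleftrightarrow> i \<noteq> 0"
  by (cases w; cases i) (auto simp: flags_def)

text \<open>Clear flags occur only where a block starts, and with even lengths all starts are at
  even places.\<close>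

lemma flags_even_blocks:
  "\<forall>l\<in>set ls. even l \<Longrightarrow> i < sum_list ls \<Longrightarrow> odd i \<Longrightarrow> flags (blocks s ls) ! i"
proof (induction ls arbitrary: s i)
  case (Cons l ls)
  show ?case
  proof (cases "i < l")
    case True
    then show ?thesis using Cons.prems by (auto simp: nth_append flags_block odd_pos)
  next
    case False
    then show ?thesis using Cons.prems Cons.IH[of "i - l" "s \<noteq> odd l"] by (auto simp: nth_append)
  qed
qed simp

lemma flags_even_cells_of:
  assumes "even d" "\<forall>l\<in>set ls. even l" "i < length (cells_of d ls)" "odd i"
  shows "flags (cells_of d ls) ! i"
proof (cases "i < d")
  case True
  then show ?thesis by (simp add: cells_of_def nth_append flags_def)
next
  case False
  then show ?thesis using assms flags_even_blocks[of ls "i - d" "even d"]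
    by (simp add: cells_of_def nth_append)
qed

section \<open>The orthogonal subsystem of the exceptional case\<close>

lemma root_iso_A1:
  fixes \<alpha> :: "'a::euclidean_space"
  assumes "\<alpha> \<noteq> 0"
  shows "root_iso {\<alpha>, - \<alpha>} A1_roots"
  unfolding root_iso_def
proof (intro exI[of _ "\<lambda>v. (v \<bullet> \<alpha>) / (\<alpha> \<bullet> \<alpha>)"] conjI)
  show "linear (\<lambda>v. (v \<bullet> \<alpha>) / (\<alpha> \<bullet> \<alpha>))"
    by (rule linearI) (simp_all add: inner_add_left add_divide_distrib)
  show "inj_on (\<lambda>v. (v \<bullet> \<alpha>) / (\<alpha> \<bullet> \<alpha>)) (span {\<alpha>, - \<alpha>})"
  proof (rule inj_onI)
    fix u v assume *: "u \<in> span {\<alpha>, - \<alpha>}" "v \<in> span {\<alpha>, - \<alpha>}" "(u \<bullet> \<alpha>) / (\<alpha> \<bullet> \<alpha>) = (v \<bullet> \<alpha>) / (\<alpha> \<bullet> \<alpha>)"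
    have "span {\<alpha>, - \<alpha>} = span {\<alpha>}" by (intro span_redundant[of "- \<alpha>" "{\<alpha>}", unfolded insert_commute] span_neg span_base) simp
    then obtain a b where "u = a *\<^sub>R \<alpha>" "v = b *\<^sub>R \<alpha>" using * by (auto simp: span_singleton)
    then show "u = v" using *(3) assms by simp
  qed
  show "(\<lambda>v. (v \<bullet> \<alpha>) / (\<alpha> \<bullet> \<alpha>)) ` {\<alpha>, - \<alpha>} = A1_roots"
    using assms by (simp add: A1_roots_def)
  show "\<forall>\<beta>\<in>{\<alpha>, - \<alpha>}. \<forall>\<gamma>\<in>{\<alpha>, - \<alpha>}. cartan_number (\<beta> \<bullet> \<alpha> / (\<alpha> \<bullet> \<alpha>)) (\<gamma> \<bullet> \<alpha> / (\<alpha> \<bullet> \<alpha>)) = cartan_number \<beta> \<gamma>"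
    using assms by (auto simp: cartan_number_def)
qed

lemma orthogonal_if_reflection_fixes: "reflection \<alpha> v = v \<Longrightarrow> \<alpha> \<noteq> 0 \<Longrightarrow> orthogonal v \<alpha>"
  by (simp add: reflection_def orthogonal_def)

context root_frame
begin

text \<open>Each pair of coordinates 2t, 2t + 1 carries one root of \<open>K\<close>, and the first
  pair carries two: m + 1 mutually orthogonal lines. It remains to see that their span contains no
  other roots.\<close>

lemma alternate_A1_sum:
  assumes n: "n = 2 * m"
  defines "K \<equiv> insert (c 0 + c 1) {c (2 * t + 1) - c (2 * t) | t. t < m}"
  shows "is_A1_sum (m + 1) (parabolic_roots \<Phi> K)"
proof -
  define a where "a = (\<lambda>t. if t < m then c (2 * t + 1) - c (2 * t) else c 0 + c 1)"
  have m: "0 < m" using n n2 by simp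
  have K: "K = a ` {..<m + 1}"
  proof (intro set_eqI iffI)
    fix v assume "v \<in> K"
    then consider "v = c 0 + c 1" | t where "t < m" "v = c (2 * t + 1) - c (2 * t)" unfolding K_def by auto
    then show "v \<in> a ` {..<m + 1}"
    proof cases
      case 1
      then have "v = a m" by (simp add: a_def)
      then show ?thesis by auto
    next
      case 2
      then have "v = a t" by (simp add: a_def)
      then show ?thesis using 2 by auto
    qed
  qed (auto simp: K_def a_def)
  have a_root: "a t \<in> \<Phi>" for t
    using root_simps[of "2 * t" "2 * t + 1" 1] root_simps[of 0 1 "- 1"] n m by (auto simp: a_def add.commute)
  \<comment> \<open>Outside the first pair the two coordinates of a pair cancel on all of
    \<open>K\<close>, hence on its span. For a root c_j - s c_i with j > 1 this forces
    \<open>i\<close> into the pair of \<open>j\<close>, and s = 1.\<close>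
  have span: "\<phi> (2 * t) v + \<phi> (2 * t + 1) v = 0" if v: "v \<in> span K" and t: "0 < t" "t < m" for t v
  proof -
    have l: "linear (\<phi> (2 * t))" "linear (\<phi> (Suc (2 * t)))" using t n by (auto intro: linear_coord)
    then have lin: "linear (\<lambda>v. \<phi> (2 * t) v + \<phi> (2 * t + 1) v)" by (simp add: linear_compose_add)
    have "\<phi> (2 * t) u + \<phi> (2 * t + 1) u = 0" if u: "u \<in> K" for u
    proof -
      consider "u = c 0 + c 1" | t' where "t' < m" "u = c (2 * t' + 1) - c (2 * t')" using u unfolding K_def by auto
      then show ?thesis
      proof cases
        case 1
        then show ?thesis using t n by (simp add: linear_add[OF l(1)] linear_add[OF l(2)] dual)
      next
        case 2
        have "2 * t \<noteq> 2 * t' + 1" "2 * t + 1 \<noteq> 2 * t'" by presburger+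
        then show ?thesis using t n 2 by (simp add: linear_diff[OF l(1)] linear_diff[OF l(2)] dual)
      qed
    qed
    then show ?thesis using linear_eq_0_on_span[OF lin _ v] by blast
  qed
  have par: "parabolic_roots \<Phi> K = (\<Union>t<m + 1. {a t, - a t})"
  proof (intro set_eqI iffI)
    fix \<gamma> assume "\<gamma> \<in> parabolic_roots \<Phi> K"
    then have g: "\<gamma> \<in> \<Phi>" "\<gamma> \<in> span K" by (auto simp: parabolic_roots_def)
    have "\<exists>t<m + 1. \<gamma> = a t \<or> - \<gamma> = a t" if pr: "\<gamma> \<in> pos_roots \<Phi> \<Delta>" and sp: "\<gamma> \<in> span K" for \<gamma>
    proof -
      obtain i j s where 1: "\<gamma> = c j - s *\<^sub>R c i" "i < j" "j < n" "s \<in> signs" using pr unfolding pos by blast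
      show ?thesis
      proof (cases "j = 1")
        case True
        then have "\<gamma> = a 0 \<or> \<gamma> = a m" using 1 m by (auto simp: a_def add.commute)
        then show ?thesis using m by auto
      next
        case False
        define t where "t = j div 2"
        have t: "0 < t" "t < m" using False 1 n by (auto simp: t_def)
        have l: "linear (\<phi> (2 * t))" "linear (\<phi> (Suc (2 * t)))" using t n by (auto intro: linear_coord)
        have j: "j = 2 * t \<or> j = 2 * t + 1" by (auto simp: t_def)
        have z: "of_bool (2 * t = j) - s * of_bool (2 * t = i) + (of_bool (2 * t + 1 = j) - s * of_bool (2 * t + 1 = i)) = (0 :: real)"
          using span[OF sp t] t n 1
          by (simp add: linear_diff[OF l(1)] linear_diff[OF l(2)] linear_scale[OF l(1)] linear_scale[OF l(2)] dual)
        have "j = 2 * t + 1 \<and> i = 2 * t \<and> s = 1"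
          using z 1(2,4) j by (auto split: if_splits simp: of_bool_def)
        then have "\<gamma> = a t" using 1 t by (simp add: a_def)
        then show ?thesis using t by (intro exI[of _ t]) auto
      qed
    qed note * = this
    consider "\<gamma> \<in> pos_roots \<Phi> \<Delta>" | "- \<gamma> \<in> pos_roots \<Phi> \<Delta>" using uminus_pos_roots[OF ss rs g(1)] by blast
    then obtain t where t: "t < m + 1" "\<gamma> = a t \<or> - \<gamma> = a t"
      using *[of \<gamma>] *[of "- \<gamma>"] g(2) span_neg[OF g(2)] by cases auto
    then have "\<gamma> = a t \<or> \<gamma> = - a t" by (metis minus_minus)
    then show "\<gamma> \<in> (\<Union>t<m + 1. {a t, - a t})" using t(1) by (intro UN_I[of t]) auto
  next
    fix \<gamma> assume "\<gamma> \<in> (\<Union>t<m + 1. {a t, - a t})"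
    then obtain t where t: "t < m + 1" "\<gamma> = a t \<or> \<gamma> = - a t" by auto
    have "a t \<in> span K" using t unfolding K by (intro span_base) auto
    then show "\<gamma> \<in> parabolic_roots \<Phi> K"
      using t a_root[of t] root_system_uminus[OF rs a_root[of t]] by (auto simp: parabolic_roots_def span_neg)
  qed
  have ne: "a t \<noteq> 0" for t using root_neq_0[OF rs a_root] .
  \<comment> \<open>Orthogonality is obtained from the action of the reflections, since a frame
    fixes no inner products of the \<open>c k\<close>.\<close>
  have fixed: "reflection (a t) (a t') = a t'" if "t < t'" "t' < m + 1" for t t'
  proof -
    have r: "reflection (a t) (c k) = (if k = 2 * t + 1 then c (2 * t) else if k = 2 * t then c (2 * t + 1) else c k)"
      if "k < n" for k
      using reflection_c[of "2 * t" "2 * t + 1" 1 k] that \<open>t < t'\<close> \<open>t' < m + 1\<close> n by (simp add: a_def)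
    note lr = linear_add[OF linear_reflection] linear_diff[OF linear_reflection]
    show ?thesis
    proof (cases "t' < m")
      case True
      have "2 * t' \<noteq> 2 * t + 1" "2 * t' + 1 \<noteq> 2 * t" by presburger+
      moreover have "a t' = c (2 * t' + 1) - c (2 * t')" using True by (simp add: a_def)
      ultimately show ?thesis using True that n by (simp add: lr r)
    next
      case False
      then have "a t' = c 0 + c 1" by (simp add: a_def)
      moreover have "1 \<noteq> 2 * t" by presburger
      ultimately show ?thesis
        using r[of 0] r[of 1] n m by (cases "t = 0") (simp_all add: lr add.commute)
    qed
  qed
  have orth: "orthogonal (a t) (a t')" if "t < m + 1" "t' < m + 1" "t \<noteq> t'" for t t'
    using that
  proof (induction t t' rule: linorder_wlog)
    case (le t t')
    then have "orthogonal (a t') (a t)" by (intro orthogonal_if_reflection_fixes[OF fixed ne]) auto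
    then show ?case by (metis orthogonal_commute)
  qed (auto simp: orthogonal_commute)
  show ?thesis unfolding is_A1_sum_def par
    by (intro exI[of _ "\<lambda>t. {a t, - a t}"]) (auto simp: ne root_iso_A1 orthogonal_clauses orth)
qed

text \<open>With both fork nodes in \<open>I\<close> the condition on the first two entries is |v_0|
  < v_1. It is even in v_0, and so is the weight. For positive v_0 the condition becomes 0 < v_0 <
  v_1, which flags can express.\<close>

lemma sum_negate_first:
  fixes x :: "'r::comm_ring_1"
  assumes I: "c 0 + c 1 \<in> I" "c 1 - c 0 \<in> I"
  shows "(\<Sum>v\<in>signed_perms n. of_bool (compatible I v) * weight x (zip (alt True n) v)) =
    2 * (\<Sum>v\<in>signed_perms n. of_bool (0 < v ! 0 \<and> compatible I v) * weight x (zip (alt True n) v))"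
proof -
  define F where "F = (\<lambda>v. of_bool (compatible I v) * weight x (zip (alt True n) v))"
  define h :: "int list \<Rightarrow> int list" where "h = (\<lambda>v. v[0 := - v ! 0])"
  have len: "length v = n" if "v \<in> signed_perms n" for v using that by (simp add: signed_perms_def)
  have h: "h v \<in> signed_perms n" "h (h v) = v" "h v ! 0 = - v ! 0" "F (h v) = F v" if v: "v \<in> signed_perms n" for v
  proof -
    obtain y r where yr: "v = y # r" using len[OF v] n2 by (cases v) auto
    obtain n' where n': "n = Suc n'" using n2 by (cases n) auto
    have hv: "h v = - y # r" by (simp add: h_def yr)
    have "- y # r \<in> signed_perms n" using v by (simp add: yr signed_perms_def)
    then show "h v \<in> signed_perms n" by (simp only: hv)
    show "h (h v) = v" "h v ! 0 = - v ! 0" by (simp_all add: h_def yr)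
    have pw: "pair_weight x (True, - y) = pair_weight x (True, y)"
      by (simp add: fun_eq_iff pair_weight_def pair_inv_def add.commute)
    have w: "weight x (zip (alt True n) (h v)) = weight x (zip (alt True n) v)"
      by (simp only: hv) (simp add: yr n' pw)
    have nth: "h v ! k = (if k = 0 then - y else v ! k)" for k by (simp only: hv) (cases k; simp add: yr)
    have v0: "v ! 0 = y" by (simp add: yr)
    have "compatible I (h v) \<longleftrightarrow> compatible I v"
    proof -
      \<comment> \<open>Negating the first entry exchanges the two conditions of the fork; the
        comparisons with k > 0 do not involve it.\<close>
      have split: "(\<forall>k. Suc k < n \<longrightarrow> P k) \<longleftrightarrow> P 0 \<and> (\<forall>k. Suc k < n \<longrightarrow> k \<noteq> 0 \<longrightarrow> P k)" for P
        using n2 by auto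
      show ?thesis
        unfolding compatible_def split[where P="\<lambda>k. c (Suc k) - c k \<in> I \<longrightarrow> h v ! k < h v ! Suc k"]
          split[where P="\<lambda>k. c (Suc k) - c k \<in> I \<longrightarrow> v ! k < v ! Suc k"]
        using I by (auto simp: nth v0)
    qed
    then show "F (h v) = F v" by (simp add: F_def w)
  qed
  have nz: "v ! 0 \<noteq> 0" if "v \<in> signed_perms n" for v using signed_perms_nth_nonzero[OF that, of 0] n2 by auto
  have "(\<Sum>v\<in>signed_perms n. F v) = (\<Sum>v\<in>{v \<in> signed_perms n. 0 < v ! 0}. F v) + (\<Sum>v\<in>{v \<in> signed_perms n. v ! 0 < 0}. F v)"
    using nz by (subst sum.union_disjoint[symmetric]) (auto intro!: sum.cong simp: neq_iff)
  also have "(\<Sum>v\<in>{v \<in> signed_perms n. v ! 0 < 0}. F v) = (\<Sum>v\<in>{v \<in> signed_perms n. 0 < v ! 0}. F v)"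
    by (rule sum.reindex_bij_witness[of _ h h]) (auto simp: h)
  also have "(\<Sum>v\<in>{v \<in> signed_perms n. 0 < v ! 0}. F v) = (\<Sum>v\<in>signed_perms n. of_bool (0 < v ! 0 \<and> compatible I v) * weight x (zip (alt True n) v))"
    by (rule sum.mono_neutral_cong_left) (auto simp: F_def)
  finally show ?thesis by (simp add: F_def)
qed

text \<open>The assumption on the fork can be arranged by \<open>flip\<close>. Under it, the first
  flag is set iff both nodes of the fork lie in \<open>I\<close>, and a clear first flag imposes no
  condition.\<close>

lemma is_cyclotomic_product_quotient:
  assumes I: "I \<subseteq> \<Delta>" and fork: "c 0 + c 1 \<in> I \<Longrightarrow> c 1 - c 0 \<in> I"
    and ex: "\<not> (\<exists>m>0. n = 2 * m \<and> (\<exists>K. K \<subseteq> I \<and> is_A1_sum (m + 1) (parabolic_roots \<Phi> K)))"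
  shows "is_cyclotomic_product (signed_odd_poly \<Phi> \<Delta> I)"
proof -
  define x :: "complex poly" where "x = monom 1 1"
  define P :: "complex poly" where "P = map_poly of_int (signed_odd_poly \<Phi> \<Delta> I)"
  define fl where "fl = (\<lambda>k. if k = 0 then c 0 + c 1 \<in> I else c k - c (k - 1) \<in> I)"
  define fs where "fs = map fl [0..<n]"
  have len: "length fs = n" by (simp add: fs_def)
  obtain d ls where ls: "0 \<notin> set ls" and zip: "zip fs (alt True (length fs)) = forced (alt True d) @ blocks (True \<noteq> odd d) ls"
    and d: "d = 0 \<longleftrightarrow> fs = [] \<or> \<not> hd fs"
    using zip_alt_decompose[of fs True] by blast
  have cells: "zip fs (alt True n) = cells_of d ls" using zip by (simp add: len cells_of_def)
  have "fs \<noteq> []" "hd fs = fl 0" using n2 by (auto simp: fs_def hd_map upt_conv_Cons)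
  then have d0: "d = 0 \<longleftrightarrow> \<not> fl 0" using d by simp
  have flags: "flags (cells_of d ls) = fs" "letters (cells_of d ls) = alt True n" "length (cells_of d ls) = n"
    unfolding cells[symmetric] by (simp_all add: flags_def letters_def len)
  have n_eq: "n = d + sum_list ls" using flags(3) by (simp add: cells_of_def)
  have P: "2 * P = (\<Sum>v\<in>signed_perms n. of_bool (compatible I v) * weight x (zip (alt True n) v))"
    unfolding P_def x_def by (rule map_poly_signed_odd_poly[OF I])
  have chain: "chain 0 fs v \<longleftrightarrow> (fl 0 \<longrightarrow> 0 < v ! 0) \<and> (\<forall>k. Suc k < n \<longrightarrow> c (Suc k) - c k \<in> I \<longrightarrow> v ! k < v ! Suc k)"
    if "v \<in> signed_perms n" for v
  proof -
    obtain n' where n': "n = Suc n'" using n2 by (cases n) auto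
    have lv: "length v = n" using that by (simp add: signed_perms_def)
    have "chain 0 fs v \<longleftrightarrow> (\<forall>k<n. fl k \<longrightarrow> (0 # v) ! k < v ! k)"
      using chain_iff_nth[of fs v 0] lv by (auto simp: fs_def)
    then show ?thesis unfolding n' All_less_Suc2 by (simp add: fl_def)
  qed
  have sum: "signed_sum x (cells_of d ls) = (\<Sum>v\<in>signed_perms n. of_bool (chain 0 fs v) * weight x (zip (alt True n) v))"
    unfolding signed_sum_def flags ..
  have "cyclo_prod P"
  proof (cases "c 0 + c 1 \<in> I")
    case False
    then have "2 * P = signed_sum x (cells_of d ls)"
      unfolding P sum by (intro sum.cong) (simp_all add: chain compatible_def fl_def)
    moreover have d: "d = 0" using d0 False by (simp add: fl_def)
    moreover have "ls \<noteq> []" using n_eq n2 d by auto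
    ultimately show ?thesis using cyclo_prod_cells_of_0[OF _ ls] by (simp add: x_def)
  next
    case True
    have "2 * P = 2 * signed_sum x (cells_of d ls)"
      unfolding P sum sum_negate_first[OF True fork[OF True]]
    proof (intro arg_cong[of _ _ "\<lambda>y. 2 * y"] sum.cong)
      fix v assume v: "v \<in> signed_perms n"
      have "0 < v ! 0 \<and> compatible I v \<longleftrightarrow> chain 0 fs v"
      proof -
        have "v ! 0 < v ! 1" if "\<forall>k. Suc k < n \<longrightarrow> c (Suc k) - c k \<in> I \<longrightarrow> v ! k < v ! Suc k"
          using that[rule_format, of 0] True fork n2 by simp
        then show ?thesis unfolding chain[OF v] compatible_def using True by (auto simp: fl_def)
      qed
      then show "of_bool (0 < v ! 0 \<and> compatible I v) * weight x (zip (alt True n) v) = of_bool (chain 0 fs v) * weight x (zip (alt True n) v)"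
        by simp
    qed simp
    then have "P = signed_sum x (cells_of d ls)" by simp
    \<comment> \<open>An even run followed by even blocks only would set the flags at all odd places
      and so put the roots of \<open>alternate_A1_sum\<close> into \<open>I\<close>.\<close>
    moreover have "\<not> (even d \<and> (\<forall>l\<in>set ls. even l))"
    proof
      assume ev: "even d \<and> (\<forall>l\<in>set ls. even l)"
      then have "even n" using n_eq even_sum_list by auto
      then obtain m where m: "n = 2 * m" by (elim evenE)
      have "c (2 * t + 1) - c (2 * t) \<in> I" if "t < m" for t
      proof -
        have "fs ! (2 * t + 1)"
          using flags_even_cells_of[of d ls "2 * t + 1"] ev that m flags by simp
        then show ?thesis using that m by (simp add: fs_def fl_def)
      qed
      then have "insert (c 0 + c 1) {c (2 * t + 1) - c (2 * t) | t. t < m} \<subseteq> I" using True by auto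
      moreover have "0 < m" using m n2 by simp
      ultimately show False using ex alternate_A1_sum[OF m] m by blast
    qed
    moreover have "0 < d" using d0 True by (simp add: fl_def)
    ultimately show ?thesis using cyclo_prod_cells_of[OF ls, of d] by (simp add: x_def)
  qed
  then show ?thesis by (simp add: is_cyclotomic_product_iff P_def)
qed

end

theorem corollary6p3:
  fixes \<Phi> \<Delta> I :: "'a::euclidean_space set"
  assumes "root_system \<Phi>" and "crystallographic \<Phi>" and "irreducible_roots \<Phi>"
    and "root_iso \<Phi> (D_roots :: (real ^ 'n) set)"
    and "simple_system \<Phi> \<Delta>"
    and "I \<subseteq> \<Delta>"
    and "\<not> (\<exists>m>0. CARD('n) = 2 * m \<and>
               (\<exists>K. K \<subseteq> I \<and> is_A1_sum (m + 1) (parabolic_roots \<Phi> K)))"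
  shows "is_cyclotomic_product (signed_odd_poly \<Phi> \<Delta> I)"
proof -
  have "\<Phi> \<noteq> {}" using assms(3) by (simp add: irreducible_roots_def)
  then obtain c \<phi> where "root_frame CARD('n) \<Phi> \<Delta> c \<phi>"
    using root_frame_exists[OF assms(1) _ assms(4,5)] by metis
  then interpret F: root_frame "CARD('n)" \<Phi> \<Delta> c \<phi> .
  show ?thesis
  \<comment> \<open>If c_0 + c_1 is the only node of the fork in \<open>I\<close>, the flipped frame
    renames it to the difference of its first two vectors.\<close>
  proof (cases "c 0 + c 1 \<in> I \<longrightarrow> c 1 - c 0 \<in> I")
    case True
    then show ?thesis using F.is_cyclotomic_product_quotient[OF assms(6) _ assms(7)] by blast
  next
    case False
    interpret G: root_frame "CARD('n)" \<Phi> \<Delta> "c(0 := - c 0)" "\<phi>(0 := \<lambda>v. - \<phi> 0 v)" by (rule F.flip)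
    show ?thesis
      using False by (intro G.is_cyclotomic_product_quotient[OF assms(6) _ assms(7)]) simp
  qed
qed

end
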